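(* Let $a(z,x,\xi)=-i\,b(z,x,\xi)+c(z,x,\xi)$, $z\in[0,Z]$, satisfy the standing assumption stated in the context, and let $\mathcal G_{(z',z)}$ be the associated thin-slab propagator. There exists $\Delta_2>0$ such that if $z',z\in[0,Z]$ with $0\le\Delta:=z'-z\le\Delta_2$, then $\mathcal G_{(z',z)}$ maps $\mathscr S(\mathbb R^n)$ into $\mathscr S(\mathbb R^n)$ and $\mathscr S'(\mathbb R^n)$ into $\mathscr S'(\mathbb R^n)$ continuously.
   Context: Symbols are global: $S^m(\mathbb R^n\times\mathbb R^n)$ is the Fréchet space of $p\in C^\infty(\mathbb R^n\times\mathbb R^n)$ with $\sup_{x,\xi}(1+|\xi|)^{-m+|\beta|}|\partial_x^\alpha\partial_\xi^\beta p(x,\xi)|<\infty$ for all multi-indices $\alpha,\beta$ (these suprema are the seminorms). Standing assumption: $Z>0$, $b,c\in C^0([0,Z],S^1(\mathbb R^n\times\mathbb R^n))$; $b=b_1+b_0$, $c=c_1+c_0$, where $b_1,c_1\in C^0([0,Z],S^1)$ are the principal symbols, homogeneous of degree 1 in $\xi$ for $|\xi|\ge1$, $b_1$ is real-valued, $c_1\ge0$, and $b_0,c_0\in C^0([0,Z],S^0(\mathbb R^n\times\mathbb R^n))$. For $0\le z\le z'\le Z$, the thin-slab propagator $\mathcal G_{(z',z)}$ is the operator with distribution kernel (oscillatory integral) $$G_{(z',z)}(x',x)=(2\pi)^{-n}\int \exp[i\langle x'-x,\xi\rangle]\,\exp[-(z'-z)\,a(z,x',\xi)]\,d\xi .$$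 $\mathscr S$ is the Schwartz space and $\mathscr S'$ the space of tempered distributions; the action on $\mathscr S'$ is defined by duality through the transpose. *)

theory Defs
  imports "HOL-Analysis.Analysis" "HOL-Library.Nonpos_Ints"
begin

subsection \<open>Smooth functions and partial derivatives\<close>

(* A multi-index is encoded as a list of coordinate directions (elements of Basis), its order
   being the length of the list; for smooth functions the order of the entries is irrelevant.
   The head of the list is the derivative taken last. *)

primrec iter_partial :: "'a::euclidean_space list \<Rightarrow> ('a \<Rightarrow> complex) \<Rightarrow> 'a \<Rightarrow> complex" where
  "iter_partial [] f = f"
| "iter_partial (e # es) f = (\<lambda>x. frechet_derivative (iter_partial es f) (at x) e)"

definition C_infinity :: "('a::euclidean_space \<Rightarrow> complex) set" where
  "C_infinity = {f. \<forall>es \<in> lists Basis. iter_partial es f differentiable_on UNIV}"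


subsection \<open>Locally convex topologies\<close>

(* Topology on V generated by the seminorms p i, i \<in> I: the open balls of the single seminorms
   form a subbasis. *)

definition seminorm_topology ::
    "'f::minus set \<Rightarrow> 'i set \<Rightarrow> ('i \<Rightarrow> 'f \<Rightarrow> real) \<Rightarrow> 'f topology" where
  "seminorm_topology V I p =
     topology_generated_by {{g \<in> V. p i (g - f) < r} | f i r. f \<in> V \<and> i \<in> I \<and> 0 < r}"

lemma topspace_seminorm_topology:
  assumes "i \<in> I" and "\<And>f. f \<in> V \<Longrightarrow> p i (f - f) \<le> 0"
  shows "topspace (seminorm_topology V I p) = V"
proof
  show "topspace (seminorm_topology V I p) \<subseteq> V"
    unfolding seminorm_topology_def topology_generated_by_topspace by blast
  show "V \<subseteq> topspace (seminorm_topology V I p)"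
  proof
    fix f assume f: "f \<in> V"
    then have "f \<in> {g \<in> V. p i (g - f) < 1}"
      using assms(2)[OF f] by simp
    then show "f \<in> topspace (seminorm_topology V I p)"
      unfolding seminorm_topology_def topology_generated_by_topspace
      using f assms(1) zero_less_one by blast
  qed
qed


subsection \<open>Symbol spaces\<close>

definition symbol_weighted ::
    "real \<Rightarrow> 'a::euclidean_space list \<Rightarrow> 'a list \<Rightarrow> ('a \<times> 'a \<Rightarrow> complex) \<Rightarrow> 'a \<times> 'a \<Rightarrow> real" where
  "symbol_weighted m \<alpha> \<beta> p = (\<lambda>(x, \<xi>).
     (1 + norm \<xi>) powr (- m + real (length \<beta>)) *
     cmod (iter_partial (map (\<lambda>e. (e, 0)) \<alpha> @ map (\<lambda>e. (0, e)) \<beta>) p (x, \<xi>)))"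

definition symbols :: "real \<Rightarrow> ('a::euclidean_space \<times> 'a \<Rightarrow> complex) set" where
  "symbols m = {p \<in> C_infinity. \<forall>\<alpha> \<in> lists Basis. \<forall>\<beta> \<in> lists Basis.
                  bdd_above (range (symbol_weighted m \<alpha> \<beta> p))}"

definition symbol_topology :: "real \<Rightarrow> ('a::euclidean_space \<times> 'a \<Rightarrow> complex) topology" where
  "symbol_topology m = seminorm_topology (symbols m) (lists Basis \<times> lists Basis)
     (\<lambda>(\<alpha>, \<beta>) p. SUP y. symbol_weighted m \<alpha> \<beta> p y)"

lemma topspace_symbol_topology: "topspace (symbol_topology m) = symbols m"
  unfolding symbol_topology_def
  by (rule topspace_seminorm_topology[where i = "([], [])"])
    (auto simp: symbol_weighted_def case_prod_unfold)


subsection \<open>The Schwartz space and tempered distributions\<close>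

definition schwartz_weighted ::
    "nat \<Rightarrow> 'a::euclidean_space list \<Rightarrow> ('a \<Rightarrow> complex) \<Rightarrow> 'a \<Rightarrow> real" where
  "schwartz_weighted k \<beta> f = (\<lambda>x. (1 + norm x) ^ k * cmod (iter_partial \<beta> f x))"

definition schwartz :: "('a::euclidean_space \<Rightarrow> complex) set" where
  "schwartz = {f \<in> C_infinity. \<forall>k. \<forall>\<beta> \<in> lists Basis. bdd_above (range (schwartz_weighted k \<beta> f))}"

definition schwartz_seminorm ::
    "nat \<times> 'a::euclidean_space list \<Rightarrow> ('a \<Rightarrow> complex) \<Rightarrow> real" where
  "schwartz_seminorm = (\<lambda>(k, \<beta>) f. SUP x. schwartz_weighted k \<beta> f x)"

definition schwartz_topology :: "('a::euclidean_space \<Rightarrow> complex) topology" where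
  "schwartz_topology = seminorm_topology schwartz (UNIV \<times> lists Basis) schwartz_seminorm"

lemma topspace_schwartz_topology: "topspace schwartz_topology = schwartz"
  unfolding schwartz_topology_def
  by (rule topspace_seminorm_topology[where i = "(0, [])"])
    (auto simp: schwartz_seminorm_def schwartz_weighted_def)

definition schwartz_bounded :: "('a::euclidean_space \<Rightarrow> complex) set \<Rightarrow> bool" where
  "schwartz_bounded B \<longleftrightarrow> B \<subseteq> schwartz \<and>
     (\<forall>i \<in> UNIV \<times> lists Basis. bdd_above (schwartz_seminorm i ` B))"

(* Functionals on the Schwartz space are total functions of the logic; membership in
   "extensional schwartz" fixes their irrelevant values outside the Schwartz space. *)

definition tempered_distributions :: "(('a::euclidean_space \<Rightarrow> complex) \<Rightarrow> complex) set" where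
  "tempered_distributions = {T \<in> extensional schwartz.
     (\<forall>\<phi> \<in> schwartz. \<forall>\<psi> \<in> schwartz. T (\<lambda>x. \<phi> x + \<psi> x) = T \<phi> + T \<psi>) \<and>
     (\<forall>s. \<forall>\<phi> \<in> schwartz. T (\<lambda>x. s * \<phi> x) = s * T \<phi>) \<and>
     continuous_map schwartz_topology euclidean T}"

definition weak_dual_topology :: "(('a::euclidean_space \<Rightarrow> complex) \<Rightarrow> complex) topology" where
  "weak_dual_topology = seminorm_topology tempered_distributions schwartz (\<lambda>\<phi> T. cmod (T \<phi>))"

definition strong_dual_topology :: "(('a::euclidean_space \<Rightarrow> complex) \<Rightarrow> complex) topology" where
  "strong_dual_topology = seminorm_topology tempered_distributions
     {B. B \<noteq> {} \<and> schwartz_bounded B} (\<lambda>B T. SUP \<phi>\<in>B. cmod (T \<phi>))"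

lemma zero_in_schwartz: "(\<lambda>_. 0) \<in> schwartz"
proof -
  have "iter_partial es (\<lambda>_. 0) = (\<lambda>_. 0)" for es :: "'a list"
    by (induction es) (auto simp: frechet_derivative_const)
  then show ?thesis
    by (auto simp: schwartz_def C_infinity_def schwartz_weighted_def)
qed

lemma topspace_weak_dual_topology: "topspace weak_dual_topology = tempered_distributions"
  unfolding weak_dual_topology_def
  by (rule topspace_seminorm_topology[OF zero_in_schwartz]) simp

lemma topspace_strong_dual_topology: "topspace strong_dual_topology = tempered_distributions"
  unfolding strong_dual_topology_def
  by (rule topspace_seminorm_topology[where i = "{\<lambda>_. 0}"])
    (auto simp: schwartz_bounded_def zero_in_schwartz)


subsection \<open>Oscillatory integrals and operators with a distribution kernel\<close>

(* The distribution given by the oscillatory integral y \<mapsto> \<integral> \<kappa> y \<xi> d\<xi>, evaluated at the test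
   function \<psi>, has the value L: insert a cutoff \<theta>(\<epsilon>\<xi>) with \<theta>(0) = 1, pair with \<psi>, and let
   \<epsilon> \<rightarrow> 0; the limit has to exist and to be the same for all cutoffs. *)

definition has_oscillatory_integral ::
    "('b::euclidean_space \<Rightarrow> 'a::euclidean_space \<Rightarrow> complex) \<Rightarrow> ('b \<Rightarrow> complex) \<Rightarrow> complex \<Rightarrow> bool" where
  "has_oscillatory_integral \<kappa> \<psi> L \<longleftrightarrow> (\<forall>\<theta> \<in> schwartz. \<theta> 0 = 1 \<longrightarrow>
     ((\<lambda>\<epsilon>. LINT y|lborel. (LINT \<xi>|lborel. \<theta> (\<epsilon> *\<^sub>R \<xi>) * \<kappa> y \<xi>) * \<psi> y) \<longlongrightarrow> L) (at_right 0))"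

(* A distribution kernel K on R^n \<times> R^n is given as a relation between test functions and
   values. The operator G on the Schwartz space has kernel K if <G u, v> = <K, v \<otimes> u> for all
   Schwartz functions u, v, where the first variable of K is the output variable x'. This
   determines G on the Schwartz space. *)

definition schwartz_operator_with_kernel ::
    "(('a::euclidean_space \<times> 'a \<Rightarrow> complex) \<Rightarrow> complex \<Rightarrow> bool) \<Rightarrow>
     (('a \<Rightarrow> complex) \<Rightarrow> ('a \<Rightarrow> complex)) \<Rightarrow> bool" where
  "schwartz_operator_with_kernel K G \<longleftrightarrow> G \<in> schwartz \<rightarrow> schwartz \<and>
     (\<forall>u \<in> schwartz. \<forall>v \<in> schwartz.
        K (\<lambda>(x', x). v x' * u x) (LINT x'|lborel. G u x' * v x'))"

definition transpose_kernel ::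
    "(('a \<times> 'a \<Rightarrow> complex) \<Rightarrow> complex \<Rightarrow> bool) \<Rightarrow> ('a \<times> 'a \<Rightarrow> complex) \<Rightarrow> complex \<Rightarrow> bool" where
  "transpose_kernel K \<psi> = K (\<psi> \<circ> prod.swap)"

(* The action on distributions by duality, A being the transposed operator. *)

definition dual_action ::
    "(('a::euclidean_space \<Rightarrow> complex) \<Rightarrow> ('a \<Rightarrow> complex)) \<Rightarrow>
     (('a \<Rightarrow> complex) \<Rightarrow> complex) \<Rightarrow> ('a \<Rightarrow> complex) \<Rightarrow> complex" where
  "dual_action A T = (\<lambda>\<phi>\<in>schwartz. T (A \<phi>))"


subsection \<open>The thin-slab propagator\<close>

definition thin_slab_integrand ::
    "(real \<Rightarrow> (real^'n) \<times> (real^'n) \<Rightarrow> complex) \<Rightarrow> real \<Rightarrow> real \<Rightarrow>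
     (real^'n) \<times> (real^'n) \<Rightarrow> real^'n \<Rightarrow> complex" where
  "thin_slab_integrand a z' z = (\<lambda>(x', x) \<xi>.
     of_real (1 / (2 * pi) ^ CARD('n)) *
     exp (\<i> * of_real ((x' - x) \<bullet> \<xi>)) * exp (- of_real (z' - z) * a z (x', \<xi>)))"

definition thin_slab_kernel ::
    "(real \<Rightarrow> (real^'n) \<times> (real^'n) \<Rightarrow> complex) \<Rightarrow> real \<Rightarrow> real \<Rightarrow>
     ((real^'n) \<times> (real^'n) \<Rightarrow> complex) \<Rightarrow> complex \<Rightarrow> bool" where
  "thin_slab_kernel a z' z = has_oscillatory_integral (thin_slab_integrand a z' z)"

definition homogeneous_deg1_outside_ball ::
    "('a::euclidean_space \<times> 'a \<Rightarrow> complex) \<Rightarrow> bool" where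
  "homogeneous_deg1_outside_ball p \<longleftrightarrow>
     (\<forall>x \<xi> t. 1 \<le> norm \<xi> \<and> 1 \<le> t \<longrightarrow> p (x, t *\<^sub>R \<xi>) = of_real t * p (x, \<xi>))"

end

theory Submission
  imports Defs
begin

text \<open>Put \<open>\<Phi>(x', \<xi>) = i\<langle>x', \<xi>\<rangle> - \<Delta> a(z, x', \<xi>)\<close>. Since \<open>b\<^sub>1\<close> is real and \<open>c\<^sub>1 \<ge> 0\<close>, the real part of \<open>\<Phi>\<close> is
  bounded above. Up to the factor \<open>(2\<pi>)\<^sup>-\<^sup>n\<close>, the propagator is a Fourier transform followed by the integral
  operator with kernel \<open>exp \<Phi>(x', \<xi>)\<close> acting in \<open>\<xi>\<close>, and its transpose is the same operator acting
  in \<open>x'\<close> followed by a Fourier transform. So everything reduces to operators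
  \<open>v \<mapsto> \<integral> exp \<Phi>(x, y) v(x) dx\<close> with a complex phase. Such an operator is continuous on the Schwartz space
  as soon as \<open>\<Phi>\<close> has symbol-like derivatives and, for every large \<open>y\<close>, some coordinate derivative
  \<open>\<partial>\<Phi>/\<partial>x\<^sub>j\<close> is at least \<open>c(1 + |y|)\<close> in modulus for all \<open>x\<close>: integrating by parts in that single
  direction yields decay of any order. With \<open>x'\<close> as the integration variable this lower bound is where
  \<open>\<Delta>\<close> has to be small, because \<open>\<partial>a/\<partial>x'\<^sub>j\<close> grows like \<open>|\<xi>|\<close>. The complex phase is not split into
  its oscillating and decaying parts, so no finer estimate of the derivatives of \<open>c\<^sub>1\<close> is needed.\<close>

section \<open>Topologies generated by seminorms\<close>

text \<open>The exponent of the kernel is a function of \<open>(x', \<xi>)\<close> plus a function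
  of \<open>(x, \<xi>)\<close>. Pairing the regularised kernel with v(x') u(x) therefore leaves one
  integral over \<xi> of a product of two Schwartz functions, and this one identity yields both
  operators: Fubini moves the first factor across to give the propagator, the second to give its
  transpose. Distributions need no estimates of their own, because they are acted on through the
  transpose. With \<xi> as the integration variable no smallness of \<Delta> is involved: a
  \<xi>-derivative of a symbol of order 1 is bounded, so x' dominates it as soon as |x'| is large.
  With x' as the integration variable the two competing terms have the same order, and the
  admissible \<Delta> depends on a seminorm of the symbols; continuity in z on a compact interval
  makes it uniform. Each derivative in the output variable brings down a derivative of \<Phi> and so
  raises the growth there by one order. It is won back by further integrations by parts, which is
  why amplitudes of arbitrary real order appear.\<close>

lemma openin_seminorm_ball:
  assumes "i \<in> I" "f \<in> V" "0 < r"
  shows "openin (seminorm_topology V I p) {g \<in> V. p i (g - f) < r}"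
  unfolding seminorm_topology_def by (rule topology_generated_by_Basis) (use assms in blast)

text \<open>Induction over the generation of open sets. Subbasic balls may be centred anywhere; the
  triangle inequality recentres one at \<open>f\<close> with the smaller radius
  \<open>r - p i (f - f0)\<close>.\<close>

lemma seminorm_topology_nhd:
  assumes tri: "\<And>i f g h. i \<in> I \<Longrightarrow> f \<in> V \<Longrightarrow> g \<in> V \<Longrightarrow> h \<in> V \<Longrightarrow> p i (h - f) \<le> p i (h - g) + p i (g - f)"
    and U: "openin (seminorm_topology V I p) U" and "f \<in> U"
  shows "\<exists>F \<delta>. finite F \<and> F \<subseteq> I \<and> 0 < \<delta> \<and> {g \<in> V. \<forall>i\<in>F. p i (g - f) < \<delta>} \<subseteq> U"
proof -
  have "generate_topology_on {{g \<in> V. p i (g - f) < r} | f i r. f \<in> V \<and> i \<in> I \<and> 0 < r} U"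
    using U unfolding seminorm_topology_def by (rule openin_topology_generated_by)
  then show ?thesis using \<open>f \<in> U\<close>
  proof (induction arbitrary: f)
    case Empty
    then show ?case by simp
  next
    case (Int a b)
    obtain F \<delta> where 1: "finite F" "F \<subseteq> I" "0 < \<delta>" "{g \<in> V. \<forall>i\<in>F. p i (g - f) < \<delta>} \<subseteq> a"
      using Int.IH(1)[of f] Int.prems by blast
    obtain F' \<delta>' where 2: "finite F'" "F' \<subseteq> I" "0 < \<delta>'" "{g \<in> V. \<forall>i\<in>F'. p i (g - f) < \<delta>'} \<subseteq> b"
      using Int.IH(2)[of f] Int.prems by blast
    have "{g \<in> V. \<forall>i\<in>F \<union> F'. p i (g - f) < min \<delta> \<delta>'} \<subseteq> a \<inter> b"
      using 1(4) 2(4) by auto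
    moreover have "finite (F \<union> F')" "F \<union> F' \<subseteq> I" "0 < min \<delta> \<delta>'" using 1 2 by auto
    ultimately show ?case by blast
  next
    case (UN K)
    then obtain k where "k \<in> K" "f \<in> k" by blast
    with UN.IH[of k f] show ?case by (meson Sup_upper subset_trans)
  next
    case (Basis s)
    then obtain f0 i r where s: "s = {g \<in> V. p i (g - f0) < r}" "f0 \<in> V" "i \<in> I" "0 < r"
      by blast
    have f: "f \<in> V" "p i (f - f0) < r" using Basis s by auto
    have "{g \<in> V. \<forall>i\<in>{i}. p i (g - f) < r - p i (f - f0)} \<subseteq> s"
    proof
      fix g assume "g \<in> {g \<in> V. \<forall>i\<in>{i}. p i (g - f) < r - p i (f - f0)}"
      then show "g \<in> s" using tri[OF \<open>i \<in> I\<close> \<open>f0 \<in> V\<close> f(1), of g] s by auto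
    qed
    moreover have "finite {i}" "{i} \<subseteq> I" "0 < r - p i (f - f0)" using s f by auto
    ultimately show ?case by blast
  qed
qed

lemma openin_seminorm_topologyI:
  assumes zero: "\<And>i f. i \<in> I \<Longrightarrow> f \<in> V \<Longrightarrow> p i (f - f) \<le> 0"
    and "I \<noteq> {}" "U \<subseteq> V"
    and nhd: "\<And>f. f \<in> U \<Longrightarrow> \<exists>F \<delta>. finite F \<and> F \<subseteq> I \<and> 0 < \<delta> \<and> {g \<in> V. \<forall>i\<in>F. p i (g - f) < \<delta>} \<subseteq> U"
  shows "openin (seminorm_topology V I p) U"
proof (subst openin_subopen, intro ballI)
  fix f assume f: "f \<in> U"
  then obtain F \<delta> where F: "finite F" "F \<subseteq> I" "0 < \<delta>" "{g \<in> V. \<forall>i\<in>F. p i (g - f) < \<delta>} \<subseteq> U"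
    using nhd by meson
  obtain i0 where i0: "i0 \<in> I" using \<open>I \<noteq> {}\<close> by blast
  \<comment> \<open>\<open>i0\<close> keeps the index set nonempty when \<open>F = {}\<close>; an
    empty intersection would be \<open>UNIV\<close>, not a subset of \<open>V\<close>.\<close>
  let ?T = "\<Inter>i\<in>insert i0 F. {g \<in> V. p i (g - f) < \<delta>}"
  have "openin (seminorm_topology V I p) ?T"
    using F i0 f \<open>U \<subseteq> V\<close> by (intro openin_INT2 openin_seminorm_ball) auto
  moreover have "f \<in> ?T"
  proof -
    have "p i (f - f) < \<delta>" if "i \<in> I" for i
      using zero[OF that, of f] f \<open>U \<subseteq> V\<close> F(3) by auto
    then show ?thesis using F(2) i0 f \<open>U \<subseteq> V\<close> by auto
  qed
  moreover have "?T \<subseteq> U" using F(4) by blast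
  ultimately show "\<exists>T. openin (seminorm_topology V I p) T \<and> f \<in> T \<and> T \<subseteq> U" by blast
qed

text \<open>Continuity is tested on the subbasic balls of the target. The estimate is on
  differences, so linearity of \<open>A\<close> enters only in the applications.\<close>

lemma continuous_map_seminorm_topologyI:
  assumes zero: "\<And>i f. i \<in> I \<Longrightarrow> f \<in> V \<Longrightarrow> p i (f - f) \<le> 0"
    and nonneg: "\<And>i f g. i \<in> I \<Longrightarrow> f \<in> V \<Longrightarrow> g \<in> V \<Longrightarrow> 0 \<le> p i (g - f)"
    and ne: "I \<noteq> {}" "J \<noteq> {}"
    and tri': "\<And>i f g h. i \<in> J \<Longrightarrow> f \<in> W \<Longrightarrow> g \<in> W \<Longrightarrow> h \<in> W \<Longrightarrow> q i (h - f) \<le> q i (h - g) + q i (g - f)"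
    and zero': "\<And>i f. i \<in> J \<Longrightarrow> f \<in> W \<Longrightarrow> q i (f - f) \<le> 0"
    and A: "A \<in> V \<rightarrow> W"
    and dom: "\<And>j. j \<in> J \<Longrightarrow> \<exists>F C. finite F \<and> F \<subseteq> I \<and>
        (\<forall>f\<in>V. \<forall>g\<in>V. q j (A g - A f) \<le> C * (\<Sum>i\<in>F. p i (g - f)))"
  shows "continuous_map (seminorm_topology V I p) (seminorm_topology W J q) A"
proof -
  obtain i0 j0 where ij: "i0 \<in> I" "j0 \<in> J" using ne by blast
  have tV: "topspace (seminorm_topology V I p) = V"
    by (rule topspace_seminorm_topology[of i0]) (use ij zero in auto)
  have "topspace (seminorm_topology W J q) = W"
    by (rule topspace_seminorm_topology[of j0]) (use ij zero' in auto)
  then have tW: "\<Union>{{g \<in> W. q i (g - f) < r} | f i r. f \<in> W \<and> i \<in> J \<and> 0 < r} = W"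
    unfolding seminorm_topology_def topology_generated_by_topspace .
  show ?thesis
    unfolding seminorm_topology_def[of W]
  proof (subst continuous_on_generated_topo_iff, unfold tV tW, intro conjI allI impI)
    fix U assume "U \<in> {{g \<in> W. q i (g - f) < r} | f i r. f \<in> W \<and> i \<in> J \<and> 0 < r}"
    then obtain h j r where U: "U = {g \<in> W. q j (g - h) < r}" and h: "h \<in> W" "j \<in> J" "0 < r"
      by blast
    obtain F C where F: "finite F" "F \<subseteq> I"
      and C: "\<And>f g. f \<in> V \<Longrightarrow> g \<in> V \<Longrightarrow> q j (A g - A f) \<le> C * (\<Sum>i\<in>F. p i (g - f))"
      using dom[OF \<open>j \<in> J\<close>] by meson
    show "openin (seminorm_topology V I p) (A -` U \<inter> V)"
    proof (rule openin_seminorm_topologyI)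
      fix f assume f: "f \<in> A -` U \<inter> V"
      define s where "s = r - q j (A f - h)"
      have s: "0 < s" using f U s_def by auto
      \<comment> \<open>\<open>C\<close> may be negative, hence the absolute value; the summand 1
        keeps the denominator positive and makes the final estimate strict.\<close>
      define \<delta> where "\<delta> = s / (\<bar>C\<bar> * card F + 1)"
      have D: "0 < \<bar>C\<bar> * card F + 1" by (smt (verit) mult_nonneg_nonneg abs_ge_zero of_nat_0_le_iff)
      have \<delta>: "0 < \<delta>" using s D by (simp add: \<delta>_def)
      have "{g \<in> V. \<forall>i\<in>F. p i (g - f) < \<delta>} \<subseteq> A -` U \<inter> V"
      proof
        fix g assume g: "g \<in> {g \<in> V. \<forall>i\<in>F. p i (g - f) < \<delta>}"
        have "q j (A g - A f) \<le> C * (\<Sum>i\<in>F. p i (g - f))" using C f g by auto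
        also have "\<dots> \<le> \<bar>C\<bar> * (\<Sum>i\<in>F. p i (g - f))"
          using F f g by (intro mult_right_mono sum_nonneg nonneg) auto
        also have "\<dots> \<le> \<bar>C\<bar> * (card F * \<delta>)"
          using g by (intro mult_left_mono sum_bounded_above) (auto intro: less_imp_le)
        also have "\<dots> < s"
        proof -
          have "\<bar>C\<bar> * (card F * \<delta>) = s * (\<bar>C\<bar> * card F / (\<bar>C\<bar> * card F + 1))" by (simp add: \<delta>_def)
          also have "\<dots> < s * 1" using s D by (intro mult_strict_left_mono) auto
          finally show ?thesis by simp
        qed
        finally have "q j (A g - A f) < s" .
        moreover have "q j (A g - h) \<le> q j (A g - A f) + q j (A f - h)"
          using A f g h by (intro tri') auto
        ultimately show "g \<in> A -` U \<inter> V" using U A g by (auto simp: s_def)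
      qed
      then show "\<exists>F \<delta>. finite F \<and> F \<subseteq> I \<and> 0 < \<delta> \<and> {g \<in> V. \<forall>i\<in>F. p i (g - f) < \<delta>} \<subseteq> A -` U \<inter> V"
        using F \<delta> by blast
    qed (use zero ne in auto)
  next
    show "A ` V \<subseteq> W" using A by auto
  qed
qed

text \<open>Around each point of \<open>K\<close> the values of \<gamma> stay within seminorm
  distance 1 of its value there, and finitely many of these neighbourhoods cover
  \<open>K\<close>.\<close>

lemma seminorm_bounded_on_compact:
  fixes \<gamma> :: "'t::topological_space \<Rightarrow> 'f::minus"
  assumes K: "compact K" and cont: "continuous_map (top_of_set K) (seminorm_topology V I p) \<gamma>"
    and i: "i \<in> I" and zero: "\<And>f. f \<in> V \<Longrightarrow> p i (f - f) \<le> 0" 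
    and tri: "\<And>f g. f \<in> V \<Longrightarrow> g \<in> V \<Longrightarrow> p i g \<le> p i (g - f) + p i f"
  shows "\<exists>C. \<forall>z\<in>K. p i (\<gamma> z) \<le> C"
proof -
  have V: "topspace (seminorm_topology V I p) = V"
    by (rule topspace_seminorm_topology[of i]) (use i zero in auto)
  have \<gamma>: "\<gamma> z \<in> V" if "z \<in> K" for z
    using continuous_map_image_subset_topspace[OF cont] that V by auto
  define N where "N z0 = {z \<in> K. \<gamma> z \<in> {g \<in> V. p i (g - \<gamma> z0) < 1}}" for z0
  have "openin (top_of_set K) (N z0)" if "z0 \<in> K" for z0
    using openin_continuous_map_preimage[OF cont openin_seminorm_ball[OF i \<gamma>[OF that] zero_less_one]]
    by (simp add: N_def)
  then have "\<exists>T. \<forall>z0\<in>K. open (T z0) \<and> N z0 = K \<inter> T z0"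
    by (intro bchoice) (auto simp: openin_open)
  then obtain T where T: "\<And>z0. z0 \<in> K \<Longrightarrow> open (T z0) \<and> N z0 = K \<inter> T z0" by meson
  have self: "z \<in> T z" if "z \<in> K" for z
  proof -
    have "p i (\<gamma> z - \<gamma> z) < 1" using zero[OF \<gamma>[OF that]] by simp
    then have "z \<in> N z" using that \<gamma>[OF that] by (simp add: N_def)
    then show ?thesis using T[OF that] by blast
  qed
  have cov: "K \<subseteq> (\<Union>z\<in>K. T z)" using self by blast
  obtain D where D: "D \<subseteq> K" "finite D" "K \<subseteq> (\<Union>z\<in>D. T z)"
    by (rule compactE_image[OF K _ cov]) (use T in auto)
  have "p i (\<gamma> z) \<le> 1 + (\<Sum>w\<in>D. \<bar>p i (\<gamma> w)\<bar>)" if z: "z \<in> K" for z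
  proof -
    obtain w where w: "w \<in> D" "z \<in> T w" using D z by blast
    then have "z \<in> N w" using T D z by blast
    then have "p i (\<gamma> z - \<gamma> w) < 1" by (simp add: N_def)
    moreover have "p i (\<gamma> z) \<le> p i (\<gamma> z - \<gamma> w) + p i (\<gamma> w)" using tri \<gamma> w z D by blast
    moreover have "\<bar>p i (\<gamma> w)\<bar> \<le> (\<Sum>w\<in>D. \<bar>p i (\<gamma> w)\<bar>)" using w D by (intro member_le_sum) auto
    ultimately show ?thesis by linarith
  qed
  then show ?thesis by blast
qed

section \<open>Partial derivatives of smooth functions\<close>

lemma iter_partial_append: "iter_partial (es @ es') f = iter_partial es (iter_partial es' f)"
  by (induction es) auto

lemma C_infinity_iter_partial_differentiable:
  "f \<in> C_infinity \<Longrightarrow> es \<in> lists Basis \<Longrightarrow> iter_partial es f differentiable (at x)"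
  by (auto simp: C_infinity_def differentiable_on_def)

lemma C_infinity_iter_partial:
  assumes "f \<in> C_infinity" "es \<in> lists Basis"
  shows "iter_partial es f \<in> C_infinity"
  using assms by (auto simp: C_infinity_def simp flip: iter_partial_append)

lemma C_infinity_continuous_on_iter_partial:
  "f \<in> C_infinity \<Longrightarrow> es \<in> lists Basis \<Longrightarrow> continuous_on UNIV (iter_partial es f)"
  by (auto simp: C_infinity_def intro: differentiable_imp_continuous_on)

lemma C_infinity_continuous_on: "f \<in> C_infinity \<Longrightarrow> continuous_on UNIV f"
  using C_infinity_continuous_on_iter_partial[of f "[]"] by simp

lemma iter_partial_lincomb:
  assumes f: "f \<in> C_infinity" and g: "g \<in> C_infinity" and es: "es \<in> lists Basis"
  shows "iter_partial es (\<lambda>x. s * f x + t * g x) = (\<lambda>x. s * iter_partial es f x + t * iter_partial es g x)"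
  using es
proof (induction es)
  case (Cons e es)
  have "((\<lambda>x. s * iter_partial es f x + t * iter_partial es g x) has_derivative
      (\<lambda>h. s * frechet_derivative (iter_partial es f) (at x) h
         + t * frechet_derivative (iter_partial es g) (at x) h)) (at x)" for x
    using C_infinity_iter_partial_differentiable[OF f] C_infinity_iter_partial_differentiable[OF g] Cons
    by (intro has_derivative_add has_derivative_mult_right) (auto simp: frechet_derivative_works)
  from frechet_derivative_at[OF this, symmetric] show ?case by (simp add: Cons.IH)
qed simp

lemma C_infinity_lincomb:
  assumes f: "f \<in> C_infinity" and g: "g \<in> C_infinity"
  shows "(\<lambda>x. s * f x + t * g x) \<in> C_infinity"
  unfolding C_infinity_def mem_Collect_eq
proof (intro ballI)
  fix es :: "'a list" assume es: "es \<in> lists Basis"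
  then show "iter_partial es (\<lambda>x. s * f x + t * g x) differentiable_on UNIV"
    unfolding iter_partial_lincomb[OF f g es]
    using f g by (auto simp: C_infinity_def intro!: differentiable_on_add differentiable_on_mult)
qed

lemma iter_partial_diff:
  assumes "f \<in> C_infinity" "g \<in> C_infinity" "es \<in> lists Basis"
  shows "iter_partial es (f - g) = (\<lambda>x. iter_partial es f x - iter_partial es g x)"
  using iter_partial_lincomb[OF assms, of 1 "-1"] by (simp add: fun_diff_def)

text \<open>The mean value inequality shows that the second difference of \<open>f\<close> along \<open>u\<close> and \<open>v\<close> determines
  the mixed derivative; being symmetric in \<open>u\<close> and \<open>v\<close>, it makes the mixed derivatives agree.\<close>

lemma second_difference_bound:
  fixes f :: "'c::real_normed_vector \<Rightarrow> 'd::real_normed_vector"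
  assumes f: "\<And>y. (f has_derivative f' y) (at y)"
    and g: "((\<lambda>y. f' y u) has_derivative g') (at x)" and "0 < \<epsilon>"
  shows "\<exists>d>0. \<forall>t. 0 < t \<and> t < d \<longrightarrow>
    norm (f (x + t *\<^sub>R u + t *\<^sub>R v) - f (x + t *\<^sub>R u) - f (x + t *\<^sub>R v) + f x - (t * t) *\<^sub>R g' v) \<le> \<epsilon> * (t * t)"
proof -
  interpret g': bounded_linear g' using g by (rule has_derivative_bounded_linear)
  \<comment> \<open>For 0 \<le> s \<le> t both displacements s u + t v and s u have norm at most t
    c, and the summand 1 keeps c positive. The tolerance \<epsilon> / (2 c) shares \<epsilon>
    between the two first-order remainders.\<close>
  define c where "c = 2 * norm u + norm v + 1"
  have c: "0 < c" unfolding c_def by (smt (verit) norm_ge_zero)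
  have "0 < \<epsilon> / (2 * c)" using c \<open>0 < \<epsilon>\<close> by simp
  then obtain d where d: "0 < d"
    and gd: "\<And>y. norm (y - x) < d \<Longrightarrow> norm (f' y u - f' x u - g' (y - x)) \<le> \<epsilon> / (2 * c) * norm (y - x)"
    using g unfolding has_derivative_at_alt by meson
  show ?thesis
  proof (intro exI[of _ "d / c"] conjI allI impI)
    show "0 < d / c" using d c by simp
    fix t assume t: "0 < t \<and> t < d / c"
    then have tc: "t * c < d" using c by (simp add: field_simps)
    \<comment> \<open>\<open>\<psi> t - \<psi> 0\<close> is exactly the quantity to be bounded, so
      the mean value inequality in the single variable s applies.\<close>
    define \<psi> where "\<psi> s = f (x + s *\<^sub>R u + t *\<^sub>R v) - f (x + s *\<^sub>R u) - (s * t) *\<^sub>R g' v" for s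
    have \<psi>: "(\<psi> has_derivative (\<lambda>h. h *\<^sub>R (f' (x + s *\<^sub>R u + t *\<^sub>R v) u - f' (x + s *\<^sub>R u) u - t *\<^sub>R g' v))) (at s within {0..t})" for s
    proof -
      have 1: "((\<lambda>s. x + s *\<^sub>R u + t *\<^sub>R v) has_derivative (\<lambda>h. h *\<^sub>R u)) (at s within {0..t})"
        "((\<lambda>s. x + s *\<^sub>R u) has_derivative (\<lambda>h. h *\<^sub>R u)) (at s within {0..t})"
        "((\<lambda>s. (s * t) *\<^sub>R g' v) has_derivative (\<lambda>h. (h * t) *\<^sub>R g' v)) (at s within {0..t})"
        by (auto intro!: derivative_eq_intros)
      have 2: "f' y (h *\<^sub>R u) = h *\<^sub>R f' y u" for y h
        using has_derivative_linear[OF f] by (simp add: linear_scale)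
      show ?thesis
        unfolding \<psi>_def
        using has_derivative_diff[OF has_derivative_diff[OF has_derivative_compose[OF 1(1) f] has_derivative_compose[OF 1(2) f]] 1(3)]
        by (simp add: 2 algebra_simps)
    qed
    have bnd: "norm (f' (x + s *\<^sub>R u + t *\<^sub>R v) u - f' (x + s *\<^sub>R u) u - t *\<^sub>R g' v) \<le> \<epsilon> * t" if s: "s \<in> {0..t}" for s
    proof -
      have n1: "norm (s *\<^sub>R u + t *\<^sub>R v) \<le> t * c"
      proof -
        have "norm (s *\<^sub>R u + t *\<^sub>R v) \<le> s * norm u + t * norm v" using s t norm_triangle_ineq[of "s *\<^sub>R u" "t *\<^sub>R v"] by auto
        also have "\<dots> \<le> t * norm u + t * norm v" using s by (intro add_mono mult_right_mono) auto
        also have "\<dots> \<le> t * c" using t by (simp add: c_def algebra_simps)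
        finally show ?thesis .
      qed
      have n2: "norm (s *\<^sub>R u) \<le> t * c"
      proof -
        have "norm (s *\<^sub>R u) \<le> t * norm u" using s by (auto intro!: mult_right_mono)
        also have "\<dots> \<le> t * c" using t by (intro mult_left_mono) (auto simp: c_def)
        finally show ?thesis .
      qed
      have p: "0 \<le> \<epsilon> / (2 * c)" using c \<open>0 < \<epsilon>\<close> by simp
      have "norm (f' (x + (s *\<^sub>R u + t *\<^sub>R v)) u - f' x u - g' (s *\<^sub>R u + t *\<^sub>R v)) \<le> \<epsilon> / (2 * c) * norm (s *\<^sub>R u + t *\<^sub>R v)"
        using gd[of "x + (s *\<^sub>R u + t *\<^sub>R v)"] n1 tc by auto
      also have "\<dots> \<le> \<epsilon> / (2 * c) * (t * c)" using n1 p by (rule mult_left_mono)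
      also have "\<dots> = \<epsilon> * t / 2" using c by simp
      finally have 1: "norm (f' (x + (s *\<^sub>R u + t *\<^sub>R v)) u - f' x u - g' (s *\<^sub>R u + t *\<^sub>R v)) \<le> \<epsilon> * t / 2" .
      have "norm (f' (x + s *\<^sub>R u) u - f' x u - g' (s *\<^sub>R u)) \<le> \<epsilon> / (2 * c) * norm (s *\<^sub>R u)"
        using gd[of "x + s *\<^sub>R u"] n2 tc by auto
      also have "\<dots> \<le> \<epsilon> / (2 * c) * (t * c)" using n2 p by (rule mult_left_mono)
      also have "\<dots> = \<epsilon> * t / 2" using c by simp
      finally have 2: "norm (f' (x + s *\<^sub>R u) u - f' x u - g' (s *\<^sub>R u)) \<le> \<epsilon> * t / 2" .
      have "f' (x + s *\<^sub>R u + t *\<^sub>R v) u - f' (x + s *\<^sub>R u) u - t *\<^sub>R g' v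
         = (f' (x + (s *\<^sub>R u + t *\<^sub>R v)) u - f' x u - g' (s *\<^sub>R u + t *\<^sub>R v)) - (f' (x + s *\<^sub>R u) u - f' x u - g' (s *\<^sub>R u))"
        by (simp add: g'.add g'.scaleR algebra_simps)
      then show ?thesis using norm_triangle_ineq4 1 2 by (smt (verit) field_sum_of_halves)
    qed
    have "norm (\<psi> t - \<psi> 0) \<le> (\<epsilon> * t) * norm (t - 0)"
    proof (rule differentiable_bound[OF _ \<psi>])
      fix s assume s: "s \<in> {0..t}"
      show "onorm (\<lambda>h. h *\<^sub>R (f' (x + s *\<^sub>R u + t *\<^sub>R v) u - f' (x + s *\<^sub>R u) u - t *\<^sub>R g' v)) \<le> \<epsilon> * t"
        using bnd[OF s] by (intro onorm_le) (metis mult.commute mult_right_mono norm_ge_zero norm_scaleR real_norm_def)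
    qed (use t in auto)
    then show "norm (f (x + t *\<^sub>R u + t *\<^sub>R v) - f (x + t *\<^sub>R u) - f (x + t *\<^sub>R v) + f x - (t * t) *\<^sub>R g' v) \<le> \<epsilon> * (t * t)"
      using t by (simp add: \<psi>_def algebra_simps)
  qed
qed

lemma symmetric_mixed_derivative:
  fixes f :: "'c::real_normed_vector \<Rightarrow> 'd::real_normed_vector"
  assumes f: "\<And>y. (f has_derivative f' y) (at y)"
    and g: "((\<lambda>y. f' y u) has_derivative g') (at x)"
    and h: "((\<lambda>y. f' y v) has_derivative h') (at x)"
  shows "g' v = h' u"
proof (rule ccontr)
  assume "g' v \<noteq> h' u"
  \<comment> \<open>Two approximations with error \<epsilon> each put the candidates within 2
    \<epsilon> of one another, against a distance of 3 \<epsilon>.\<close>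
  define \<epsilon> where "\<epsilon> = norm (g' v - h' u) / 3"
  have \<epsilon>: "0 < \<epsilon>" using \<open>g' v \<noteq> h' u\<close> by (simp add: \<epsilon>_def)
  obtain d1 where d1: "d1 > 0" "\<And>t. 0 < t \<and> t < d1 \<Longrightarrow>
    norm (f (x + t *\<^sub>R u + t *\<^sub>R v) - f (x + t *\<^sub>R u) - f (x + t *\<^sub>R v) + f x - (t * t) *\<^sub>R g' v) \<le> \<epsilon> * (t * t)"
    using second_difference_bound[OF f g \<epsilon>] by meson
  obtain d2 where d2: "d2 > 0" "\<And>t. 0 < t \<and> t < d2 \<Longrightarrow>
    norm (f (x + t *\<^sub>R v + t *\<^sub>R u) - f (x + t *\<^sub>R v) - f (x + t *\<^sub>R u) + f x - (t * t) *\<^sub>R h' u) \<le> \<epsilon> * (t * t)"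
    using second_difference_bound[OF f h \<epsilon>] by meson
  define t where "t = min d1 d2 / 2"
  have t: "0 < t" "t < d1" "t < d2" using d1 d2 by (auto simp: t_def)
  define D where "D = f (x + t *\<^sub>R u + t *\<^sub>R v) - f (x + t *\<^sub>R u) - f (x + t *\<^sub>R v) + f x"
  have "norm (D - (t * t) *\<^sub>R g' v) \<le> \<epsilon> * (t * t)" using d1 t by (simp add: D_def)
  moreover have "norm (D - (t * t) *\<^sub>R h' u) \<le> \<epsilon> * (t * t)"
    using d2(2)[of t] t by (simp add: D_def algebra_simps)
  moreover have "(t * t) *\<^sub>R (g' v - h' u) = (D - (t * t) *\<^sub>R h' u) - (D - (t * t) *\<^sub>R g' v)"
    by (simp add: algebra_simps)
  ultimately have "norm ((t * t) *\<^sub>R (g' v - h' u)) \<le> 2 * (\<epsilon> * (t * t))"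
    using norm_triangle_ineq4[of "D - (t * t) *\<^sub>R h' u" "D - (t * t) *\<^sub>R g' v"] by simp
  then have "(t * t) * (3 * \<epsilon>) \<le> (t * t) * (2 * \<epsilon>)" by (simp add: \<epsilon>_def)
  then show False using t \<epsilon> by (simp add: mult_le_cancel_left)
qed

section \<open>Independence of the order of differentiation\<close>

lemma iter_partial_swap:
  assumes "f \<in> C_infinity" "e \<in> Basis" "e' \<in> Basis"
  shows "iter_partial [e, e'] f = iter_partial [e', e] f"
proof
  fix x
  have d: "(iter_partial es f has_derivative frechet_derivative (iter_partial es f) (at y)) (at y)"
    if "es \<in> lists Basis" for es y
    using C_infinity_iter_partial_differentiable[OF assms(1) that] by (simp add: frechet_derivative_works)
  show "iter_partial [e, e'] f x = iter_partial [e', e] f x"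
    using symmetric_mixed_derivative[of f "\<lambda>y. frechet_derivative f (at y)" e' _ x e]
      d[of "[]"] d[of "[e]"] d[of "[e']"] assms by simp
qed

lemma iter_partial_move:
  assumes "f \<in> C_infinity" "e \<in> Basis" "es \<in> lists Basis" "es' \<in> lists Basis"
  shows "iter_partial (es @ e # es') f = iter_partial (e # es @ es') f"
  using assms(3)
proof (induction es)
  case (Cons d es)
  have "iter_partial ((d # es) @ e # es') f = iter_partial [d] (iter_partial (es @ e # es') f)" by simp
  also have "\<dots> = iter_partial [d, e] (iter_partial (es @ es') f)" using Cons by simp
  also have "\<dots> = iter_partial [e, d] (iter_partial (es @ es') f)"
    using assms Cons by (intro iter_partial_swap C_infinity_iter_partial) auto
  finally show ?case by simp
qed simp

text \<open>Symbol seminorms only see lists with all x directions in front of the \<xi> directions,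
  whereas amplitudes are differentiated in every order; this lemma links the two.\<close>

lemma iter_partial_mset:
  assumes "f \<in> C_infinity" "es \<in> lists Basis" "mset es = mset es'"
  shows "iter_partial es f = iter_partial es' f"
  using assms(2,3)
proof (induction es arbitrary: es')
  case (Cons e es)
  have "e \<in> set es'" using mset_eq_setD[OF Cons.prems] by auto
  then obtain a b where ab: "es' = a @ e # b" by (meson split_list)
  have m: "mset es = mset (a @ b)" using Cons.prems ab by simp
  have "set es = set a \<union> set b" using mset_eq_setD[OF m] by simp
  then have b: "a \<in> lists Basis" "b \<in> lists Basis" using Cons.hyps by auto
  have "iter_partial (e # es) f = iter_partial (e # a @ b) f" using Cons.IH[OF m] by simp
  also have "\<dots> = iter_partial es' f"
    unfolding ab by (rule iter_partial_move[OF assms(1) Cons.hyps(1) b, symmetric])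
  finally show ?case .
qed simp

section \<open>Exchange of the two variables\<close>

lemma swap_in_Basis [simp]: "prod.swap e \<in> Basis \<longleftrightarrow> e \<in> Basis"
  by (cases e) (auto simp: Basis_prod_def)

lemma has_derivative_swap: "(prod.swap has_derivative prod.swap) F"
  for F :: "('a::real_normed_vector \<times> 'b::real_normed_vector) filter"
  by (intro bounded_linear_imp_has_derivative)
    (simp add: prod.swap_def[abs_def] bounded_linear_Pair bounded_linear_fst bounded_linear_snd)

lemma iter_partial_swap_args:
  fixes f :: "'a::euclidean_space \<times> 'a \<Rightarrow> complex"
  assumes f: "f \<in> C_infinity" and es: "es \<in> lists Basis"
  shows "iter_partial es (f \<circ> prod.swap) = iter_partial (map prod.swap es) f \<circ> prod.swap"
  using es
proof (induction es)
  case (Cons e es)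
  have es': "map prod.swap es \<in> lists Basis" using Cons.hyps by (simp add: in_lists_conv_set)
  have "(iter_partial (map prod.swap es) f \<circ> prod.swap has_derivative
      frechet_derivative (iter_partial (map prod.swap es) f) (at (prod.swap x)) \<circ> prod.swap) (at x)" for x
    using C_infinity_iter_partial_differentiable[OF f es']
    by (intro has_derivative_swap diff_chain_at) (auto simp: frechet_derivative_works)
  note fun_cong[OF frechet_derivative_at[OF this, symmetric], of _ e]
  then show ?case unfolding iter_partial.simps list.map Cons.IH by (intro ext) simp
qed simp

lemma C_infinity_swap_args:
  fixes f :: "'a::euclidean_space \<times> 'a \<Rightarrow> complex"
  assumes f: "f \<in> C_infinity"
  shows "f \<circ> prod.swap \<in> C_infinity"
  unfolding C_infinity_def mem_Collect_eq
proof (intro ballI)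
  fix es :: "('a \<times> 'a) list" assume es: "es \<in> lists Basis"
  then have es': "map prod.swap es \<in> lists Basis" by (simp add: in_lists_conv_set)
  have "prod.swap differentiable (at x)" for x :: "'a \<times> 'a"
    using has_derivative_swap by (rule differentiableI)
  then show "iter_partial es (f \<circ> prod.swap) differentiable_on UNIV"
    unfolding iter_partial_swap_args[OF f es] differentiable_on_def
    using C_infinity_iter_partial_differentiable[OF f es']
    by (auto intro!: differentiable_chain_at)
qed

section \<open>Integrals of decaying functions\<close>

text \<open>\<open>arctan\<close> is a bounded antiderivative on the positive half-line, and
  reflection gives the other half.\<close>

lemma integrable_inverse_1_plus_square: "integrable lborel (\<lambda>x::real. 1 / (1 + x\<^sup>2))"
proof -
  have 1: "(\<integral>\<^sup>+ x. ennreal (1 / (1 + x\<^sup>2)) * indicator {0..} x \<partial>lborel) = ennreal (pi / 2 - arctan 0)"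
  proof (rule nn_integral_FTC_atLeast)
    show "DERIV arctan x :> 1 / (1 + x\<^sup>2)" for x
      by (auto intro!: derivative_eq_intros simp: field_simps)
  qed (auto intro: tendsto_arctan_at_top simp: add_pos_nonneg)
  have 2: "(\<integral>\<^sup>+ x. ennreal (1 / (1 + x\<^sup>2)) * indicator {..0} x \<partial>lborel)
      = (\<integral>\<^sup>+ x. ennreal (1 / (1 + x\<^sup>2)) * indicator {0..} x \<partial>lborel)"
    by (subst nn_integral_real_affine[where c="-1" and t=0])
      (auto intro!: nn_integral_cong split: split_indicator)
  have "(\<integral>\<^sup>+ x. ennreal (1 / (1 + x\<^sup>2)) \<partial>lborel)
     \<le> (\<integral>\<^sup>+ x. ennreal (1 / (1 + x\<^sup>2)) * indicator {0..} x + ennreal (1 / (1 + x\<^sup>2)) * indicator {..0} x \<partial>lborel)"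
    by (intro nn_integral_mono) (auto split: split_indicator)
  also have "\<dots> < \<infinity>"
    by (subst nn_integral_add) (auto simp: 1 2 simp flip: ennreal_plus)
  finally show ?thesis
    by (intro integrableI_bounded) (auto simp: add_pos_nonneg)
qed

text \<open>Each coordinate satisfies
  \<open>1 + (x \<bullet> b)\<^sup>2 \<le> (1 + norm x)\<^sup>2\<close>, so a product of
  one-dimensional integrable functions dominates. Two powers per dimension explain the exponent
  \<open>2 * DIM('a)\<close> that recurs in all integrability estimates.\<close>

lemma integrable_decay:
  "integrable lborel (\<lambda>x::'a::euclidean_space. 1 / (1 + norm x) ^ (2 * DIM('a)))"
proof (rule Bochner_Integration.integrable_bound)
  show "integrable lborel (\<lambda>x::'a. \<Prod>b\<in>Basis. 1 / (1 + (x \<bullet> b)\<^sup>2))"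
  proof (rule integrableI_bounded)
    have "(\<integral>\<^sup>+ x. ennreal (norm (\<Prod>b\<in>Basis. 1 / (1 + (x \<bullet> b)\<^sup>2))) \<partial>(lborel :: 'a measure))
        = (\<integral>\<^sup>+ x. (\<Prod>b\<in>Basis. ennreal (1 / (1 + (x \<bullet> b)\<^sup>2))) \<partial>(lborel :: 'a measure))"
      by (intro nn_integral_cong) (simp add: prod_ennreal prod_nonneg)
    also have "\<dots> = (\<Prod>b\<in>(Basis :: 'a set). (\<integral>\<^sup>+ x. ennreal (1 / (1 + x\<^sup>2)) \<partial>lborel))"
      by (rule nn_integral_lborel_prod) auto
    also have "\<dots> < \<infinity>"
    proof -
      have "(\<integral>\<^sup>+ x. ennreal (1 / (1 + x\<^sup>2)) \<partial>lborel) < \<infinity>"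
        using integrable_inverse_1_plus_square by (simp add: integrable_iff_bounded)
      then show ?thesis by (simp add: power_less_top_ennreal)
    qed
    finally show "(\<integral>\<^sup>+ x. ennreal (norm (\<Prod>b\<in>Basis. 1 / (1 + (x \<bullet> b)\<^sup>2))) \<partial>(lborel :: 'a measure)) < \<infinity>" .
  qed simp
  show "AE x in (lborel :: 'a measure). norm (1 / (1 + norm x) ^ (2 * DIM('a))) \<le> norm (\<Prod>b\<in>Basis. 1 / (1 + (x \<bullet> b)\<^sup>2))"
  proof (rule AE_I2)
    fix x :: 'a
    have "(\<Prod>b\<in>Basis. 1 + (x \<bullet> b)\<^sup>2) \<le> (\<Prod>b\<in>(Basis::'a set). (1 + norm x) ^ 2)"
    proof (rule prod_mono)
      fix b :: 'a assume "b \<in> Basis"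
      then have "\<bar>x \<bullet> b\<bar> \<le> norm x" by (rule Basis_le_norm)
      then have "(x \<bullet> b)\<^sup>2 \<le> (norm x)\<^sup>2" using abs_le_square_iff[of "x \<bullet> b" "norm x"] by simp
      then show "0 \<le> 1 + (x \<bullet> b)\<^sup>2 \<and> 1 + (x \<bullet> b)\<^sup>2 \<le> (1 + norm x)\<^sup>2"
        by (simp add: power2_sum add_increasing2)
    qed
    then have "(\<Prod>b\<in>Basis. 1 + (x \<bullet> b)\<^sup>2) \<le> (1 + norm x) ^ (2 * DIM('a))"
      by (simp add: power_mult)
    moreover have "0 < (\<Prod>b\<in>Basis. 1 + (x \<bullet> b)\<^sup>2)"
      by (intro prod_pos) (auto simp: add_pos_nonneg)
    ultimately show "norm (1 / (1 + norm x) ^ (2 * DIM('a))) \<le> norm (\<Prod>b\<in>Basis. 1 / (1 + (x \<bullet> b)\<^sup>2))"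
      by (simp add: prod_dividef divide_left_mono abs_of_pos)
  qed
qed simp

lemma integrable_decay_bound:
  fixes f :: "'a::euclidean_space \<Rightarrow> complex"
  assumes [measurable]: "f \<in> borel_measurable borel" and "\<And>x. norm (f x) \<le> C / (1 + norm x) ^ (2 * DIM('a))"
  shows "integrable lborel f"
proof (rule Bochner_Integration.integrable_bound)
  show "integrable lborel (\<lambda>x::'a. C * (1 / (1 + norm x) ^ (2 * DIM('a))))"
    by (intro integrable_mult_right integrable_decay)
  show "AE x in lborel. norm (f x) \<le> norm (C * (1 / (1 + norm x) ^ (2 * DIM('a))))"
    using assms(2) by (intro AE_I2) (metis abs_ge_self mult.right_neutral order_trans real_norm_def times_divide_eq_right)
qed simp

text \<open>Dominated convergence for the normalised first-order remainder along sequences tending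
  to \<open>y0\<close>. The mean value inequality on the convex unit ball bounds the increment of
  \<open>h x\<close>, and the hypothesis bounds its linear part, each by
  \<open>g x * norm (y - y0)\<close>; hence the majorant \<open>2 * g x\<close>.\<close>

lemma has_derivative_integral:
  fixes h :: "'a::euclidean_space \<Rightarrow> 'b::euclidean_space \<Rightarrow> complex"
  assumes int: "\<And>y. y \<in> ball y0 1 \<Longrightarrow> integrable lborel (\<lambda>x. h x y)"
    and deriv: "\<And>x y. y \<in> ball y0 1 \<Longrightarrow> (h x has_derivative h' x y) (at y)"
    and meas: "\<And>s. (\<lambda>x. h' x y0 s) \<in> borel_measurable borel"
    and bound: "\<And>x y s. y \<in> ball y0 1 \<Longrightarrow> norm (h' x y s) \<le> g x * norm s"
    and g: "integrable lborel g"
  shows "((\<lambda>y. LINT x|lborel. h x y) has_derivative (\<lambda>s. LINT x|lborel. h' x y0 s)) (at y0)"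
proof -
  have y0: "y0 \<in> ball y0 1" by simp
  have int': "integrable lborel (\<lambda>x. h' x y0 s)" for s
  proof (rule Bochner_Integration.integrable_bound)
    show "integrable lborel (\<lambda>x. g x * norm s)" using g by simp
    show "AE x in lborel. norm (h' x y0 s) \<le> norm (g x * norm s)"
      using bound[OF y0] by (intro AE_I2) (auto intro: order_trans[OF _ abs_ge_self])
  qed (use meas in simp)
  have lin: "linear (h' x y0)" for x using deriv[OF y0] by (rule has_derivative_linear)
  have bl: "bounded_linear (\<lambda>s. LINT x|lborel. h' x y0 s)"
  proof (rule bounded_linear_intro[where K="LINT x|lborel. g x"])
    show "(LINT x|lborel. h' x y0 (s + t)) = (LINT x|lborel. h' x y0 s) + (LINT x|lborel. h' x y0 t)" for s t
      using int' by (simp add: linear_add[OF lin])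
    show "(LINT x|lborel. h' x y0 (r *\<^sub>R s)) = r *\<^sub>R (LINT x|lborel. h' x y0 s)" for r s
      by (simp add: linear_scale[OF lin])
    show "norm (LINT x|lborel. h' x y0 s) \<le> norm s * (LINT x|lborel. g x)" for s
    proof -
      have "norm (LINT x|lborel. h' x y0 s) \<le> (LINT x|lborel. g x * norm s)"
        by (intro Bochner_Integration.integral_norm_bound_integral int' bound y0 integrable_mult_left g)
      then show ?thesis by (simp add: mult.commute)
    qed
  qed
  have lim: "((\<lambda>y. norm ((LINT x|lborel. h x y) - (LINT x|lborel. h x y0) - (LINT x|lborel. h' x y0 (y - y0))) / norm (y - y0)) \<longlongrightarrow> 0)
      (at y0 within ball y0 1)"
    unfolding tendsto_at_iff_sequentially
  proof (intro allI impI)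
    fix X assume X: "\<forall>i. X i \<in> ball y0 1 - {y0}" and Xlim: "X \<longlonglongrightarrow> y0"
    define q where "q i x = (h x (X i) - h x y0 - h' x y0 (X i - y0)) /\<^sub>R norm (X i - y0)" for i x
    have "(\<lambda>i. LINT x|lborel. q i x) \<longlonglongrightarrow> (LINT x|(lborel :: 'a measure). 0 :: complex)"
    proof (rule integral_dominated_convergence[where w="\<lambda>x. 2 * g x"])
      show "AE x in lborel. (\<lambda>i. q i x) \<longlonglongrightarrow> 0"
      proof (rule AE_I2)
        fix x
        have "((\<lambda>y. norm (h x y - h x y0 - h' x y0 (y - y0)) / norm (y - y0)) \<longlongrightarrow> 0) (at y0)"
          using deriv[OF y0, of x] by (simp add: has_derivative_iff_norm)
        then have "(\<lambda>i. norm (h x (X i) - h x y0 - h' x y0 (X i - y0)) / norm (X i - y0)) \<longlonglongrightarrow> 0"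
          using X Xlim unfolding tendsto_at_iff_sequentially comp_def by blast
        then show "(\<lambda>i. q i x) \<longlonglongrightarrow> 0"
          by (intro tendsto_norm_zero_cancel[of "\<lambda>i. q i x"]) (simp add: q_def divide_inverse mult.commute)
      qed
      fix i
      have Xi: "X i \<in> ball y0 1" "X i \<noteq> y0" using X by auto
      show "q i \<in> borel_measurable lborel"
        unfolding q_def using int[OF Xi(1)] int[OF y0] int' by (intro borel_measurable_integrable) auto
      show "AE x in lborel. norm (q i x) \<le> 2 * g x"
      proof (rule AE_I2)
        fix x
        have "norm (h x (X i) - h x y0) \<le> g x * norm (X i - y0)"
        proof (rule differentiable_bound[of "ball y0 1"])
          show "(h x has_derivative h' x y) (at y within ball y0 1)" if "y \<in> ball y0 1" for y
            using deriv[OF that] by (rule has_derivative_at_withinI)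
          show "onorm (h' x y) \<le> g x" if "y \<in> ball y0 1" for y
            using bound[OF that] by (rule onorm_le)
        qed (use Xi in auto)
        moreover have "norm (h' x y0 (X i - y0)) \<le> g x * norm (X i - y0)" by (rule bound[OF y0])
        ultimately have "norm (h x (X i) - h x y0 - h' x y0 (X i - y0)) \<le> 2 * g x * norm (X i - y0)"
          using norm_triangle_ineq4[of "h x (X i) - h x y0" "h' x y0 (X i - y0)"] by linarith
        moreover have "norm (q i x) = norm (h x (X i) - h x y0 - h' x y0 (X i - y0)) / norm (X i - y0)"
          by (simp add: q_def divide_inverse mult.commute)
        ultimately show "norm (q i x) \<le> 2 * g x"
          using Xi by (simp add: pos_divide_le_eq)
      qed
    qed (use g in auto)
    then have "(\<lambda>i. norm (LINT x|lborel. q i x)) \<longlonglongrightarrow> 0" by (simp add: tendsto_norm_zero)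
    moreover have "norm (LINT x|lborel. q i x) = norm ((LINT x|lborel. h x (X i)) - (LINT x|lborel. h x y0) - (LINT x|lborel. h' x y0 (X i - y0))) / norm (X i - y0)" for i
    proof -
      have "X i \<in> ball y0 1" using X by auto
      then have "(LINT x|lborel. q i x) = ((LINT x|lborel. h x (X i)) - (LINT x|lborel. h x y0) - (LINT x|lborel. h' x y0 (X i - y0))) /\<^sub>R norm (X i - y0)"
        using int[of "X i"] int[OF y0] int' by (simp add: q_def)
      then show ?thesis by (simp add: divide_inverse mult.commute)
    qed
    ultimately show "((\<lambda>y. norm ((LINT x|lborel. h x y) - (LINT x|lborel. h x y0) - (LINT x|lborel. h' x y0 (y - y0))) / norm (y - y0)) \<circ> X) \<longlonglongrightarrow> 0"
      by (simp add: comp_def)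
  qed
  show ?thesis
    using lim bl at_within_open[of y0 "ball y0 1"] by (simp add: has_derivative_iff_norm)
qed

lemma integral_translation:
  fixes f :: "'a::euclidean_space \<Rightarrow> complex"
  assumes [measurable]: "f \<in> borel_measurable borel"
  shows "(LINT x|lborel. f (x + c)) = (LINT x|lborel. f x)"
proof -
  have "(LINT x|lborel. f x) = (LINT x|distr lborel borel ((+) c). f x)"
    by (simp add: lborel_distr_plus)
  also have "\<dots> = (LINT x|lborel. f (c + x))" by (rule integral_distr) simp_all
  finally show ?thesis by (simp add: add.commute)
qed

text \<open>Integration by parts without boundary terms: by translation invariance the integral of
  F(x + t u) over x is constant in t, and differentiating it at t = 0 under the integral gives the
  claim.\<close>

lemma integral_directional_derivative_eq_0:
  fixes F :: "'a::euclidean_space \<Rightarrow> complex"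
  assumes deriv: "\<And>x. (F has_derivative F' x) (at x)"
    and meas: "(\<lambda>x. F' x u) \<in> borel_measurable borel"
    and F: "\<And>x. norm (F x) \<le> C / (1 + norm x) ^ (2 * DIM('a))"
    and F': "\<And>x. norm (F' x u) \<le> C / (1 + norm x) ^ (2 * DIM('a))"
  shows "(LINT x|lborel. F' x u) = 0"
proof -
  let ?K = "2 * DIM('a)"
  have "continuous_on UNIV F"
    using deriv by (auto intro!: continuous_at_imp_continuous_on has_derivative_continuous)
  then have Fm[measurable]: "F \<in> borel_measurable borel" by (rule borel_measurable_continuous_onI)
  have lin: "F' x (r *\<^sub>R u) = r *\<^sub>R F' x u" for x r
    using has_derivative_linear[OF deriv] by (rule linear_scale)
  have C: "0 \<le> C" using F[of 0] by (simp add: order_trans[OF norm_ge_zero])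
  \<comment> \<open>A shift by t u with |t| < 1 changes \<open>1 + norm x\<close> by at most the
    factor \<open>1 + norm u\<close>, so one majorant serves all t in the unit ball.\<close>
  have shift: "C / (1 + norm (x + t *\<^sub>R u)) ^ ?K \<le> C * (1 + norm u) ^ ?K * (1 / (1 + norm x) ^ ?K)"
    if t: "t \<in> ball 0 1" for x t
  proof -
    have "norm x \<le> norm (x + t *\<^sub>R u) + norm (t *\<^sub>R u)" using norm_triangle_ineq4[of "x + t *\<^sub>R u" "t *\<^sub>R u"] by simp
    also have "norm (t *\<^sub>R u) \<le> norm u" using t by (simp add: mult_left_le_one_le)
    finally have "1 + norm x \<le> (1 + norm u) * (1 + norm (x + t *\<^sub>R u))" 
      by (simp add: algebra_simps) (smt (verit) mult_nonneg_nonneg norm_ge_zero)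
    then have "(1 + norm x) ^ ?K \<le> (1 + norm u) ^ ?K * (1 + norm (x + t *\<^sub>R u)) ^ ?K"
      by (metis power_mono power_mult_distrib add_nonneg_nonneg norm_ge_zero zero_le_one)
    moreover have "0 < (1 + norm x) ^ ?K" "0 < (1 + norm (x + t *\<^sub>R u)) ^ ?K" by (simp_all add: add_pos_nonneg)
    ultimately have "1 / (1 + norm (x + t *\<^sub>R u)) ^ ?K \<le> (1 + norm u) ^ ?K / (1 + norm x) ^ ?K"
      by (simp add: field_simps)
    from mult_left_mono[OF this C] show ?thesis by simp
  qed
  have "((\<lambda>t. LINT x|lborel. F (x + t *\<^sub>R u)) has_derivative (\<lambda>s. LINT x|lborel. s *\<^sub>R F' (x + 0 *\<^sub>R u) u)) (at 0)"
  proof (rule has_derivative_integral[where g="\<lambda>x. C * (1 + norm u) ^ ?K * (1 / (1 + norm x) ^ ?K)"])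
    show "integrable lborel (\<lambda>x. F (x + t *\<^sub>R u))" if "t \<in> ball 0 1" for t
    proof (rule integrable_decay_bound)
      show "norm (F (x + t *\<^sub>R u)) \<le> (C * (1 + norm u) ^ ?K) / (1 + norm x) ^ ?K" for x
        using order_trans[OF F shift[OF that]] by simp
    qed simp
    show "((\<lambda>t. F (x + t *\<^sub>R u)) has_derivative (\<lambda>s. s *\<^sub>R F' (x + t *\<^sub>R u) u)) (at t)" for x t
    proof -
      have "((\<lambda>t. x + t *\<^sub>R u) has_derivative (\<lambda>s. s *\<^sub>R u)) (at t)" by (auto intro!: derivative_eq_intros)
      from has_derivative_compose[OF this deriv] show ?thesis by (simp add: lin)
    qed
    show "norm (s *\<^sub>R F' (x + t *\<^sub>R u) u) \<le> C * (1 + norm u) ^ ?K * (1 / (1 + norm x) ^ ?K) * norm s"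
      if "t \<in> ball 0 1" for x t s
      using mult_left_mono[OF order_trans[OF F' shift[OF that]], of "\<bar>s\<bar>" x] by (simp add: mult.commute)
    show "integrable lborel (\<lambda>x::'a. C * (1 + norm u) ^ ?K * (1 / (1 + norm x) ^ ?K))"
      by (intro integrable_mult_right integrable_decay)
  qed (use meas in simp)
  moreover have "(\<lambda>t. LINT x|lborel. F (x + t *\<^sub>R u)) = (\<lambda>t. LINT x|lborel. F x)"
    by (simp add: integral_translation)
  ultimately have "((\<lambda>t::real. LINT x|lborel. F x) has_derivative (\<lambda>s. LINT x|lborel. s *\<^sub>R F' x u)) (at 0)" by simp
  then have "(\<lambda>s. LINT x|lborel. s *\<^sub>R F' x u) = (\<lambda>s. 0)"
    using has_derivative_const by (rule has_derivative_unique)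
  from fun_cong[OF this, of 1] show ?thesis by simp
qed

section \<open>Amplitudes\<close>

definition poly_bounded :: "'b::real_normed_vector set \<Rightarrow> real \<Rightarrow> ('a::real_normed_vector \<times> 'b \<Rightarrow> complex) \<Rightarrow> bool" where
  "poly_bounded Y r p \<longleftrightarrow>
     (\<exists>C N. 0 \<le> C \<and> (\<forall>x. \<forall>y\<in>Y. cmod (p (x, y)) \<le> C * (1 + norm x) ^ N * (1 + norm y) powr r))"

text \<open>All iterated derivatives of \<open>p\<close> along \<open>D\<close> up to order \<open>l\<close>, in any order, grow at most like
  \<open>(1 + |y|)\<^sup>r\<close> on \<open>Y\<close>, up to a power of \<open>1 + |x|\<close> that may depend on the derivative: powers of \<open>x\<close> are
  absorbed by Schwartz functions, powers of \<open>y\<close> are not.\<close>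

primrec amp :: "('a::real_normed_vector \<times> 'b::real_normed_vector) set \<Rightarrow> 'b set \<Rightarrow> nat \<Rightarrow> real \<Rightarrow> ('a \<times> 'b \<Rightarrow> complex) \<Rightarrow> bool" where
  "amp D Y 0 r p \<longleftrightarrow> poly_bounded Y r p"
| "amp D Y (Suc l) r p \<longleftrightarrow> poly_bounded Y r p \<and>
     (\<exists>p'. (\<forall>x. \<forall>y\<in>Y. (p has_derivative p' (x, y)) (at (x, y))) \<and> (\<forall>e\<in>D. amp D Y l r (\<lambda>z. p' z e)))"

lemma poly_boundedE:
  assumes "poly_bounded Y r p"
  obtains C N where "0 \<le> C" "\<And>x y. y \<in> Y \<Longrightarrow> cmod (p (x, y)) \<le> C * (1 + norm x) ^ N * (1 + norm y) powr r"
  using assms unfolding poly_bounded_def by blast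

lemma poly_boundedI:
  fixes p :: "'a::real_normed_vector \<times> 'b::real_normed_vector \<Rightarrow> complex"
  assumes "\<And>x y. y \<in> Y \<Longrightarrow> cmod (p (x, y)) \<le> C * (1 + norm x) ^ N * (1 + norm y) powr r"
  shows "poly_bounded Y r p"
  unfolding poly_bounded_def
proof (intro exI conjI allI ballI)
  show "0 \<le> \<bar>C\<bar>" by simp
  fix x :: 'a and y :: 'b assume "y \<in> Y"
  have "C * ((1 + norm x) ^ N * (1 + norm y) powr r) \<le> \<bar>C\<bar> * ((1 + norm x) ^ N * (1 + norm y) powr r)"
    by (intro mult_right_mono) auto
  with assms[OF \<open>y \<in> Y\<close>, of x] show "cmod (p (x, y)) \<le> \<bar>C\<bar> * (1 + norm x) ^ N * (1 + norm y) powr r"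
    by (simp add: mult.assoc)
qed

lemma poly_bounded_mono:
  fixes p :: "'a::real_normed_vector \<times> 'b::real_normed_vector \<Rightarrow> complex"
  assumes "poly_bounded Y r p" "r \<le> s"
  shows "poly_bounded Y s p"
proof -
  obtain C N where C: "0 \<le> C" "\<And>x y. y \<in> Y \<Longrightarrow> cmod (p (x, y)) \<le> C * (1 + norm x) ^ N * (1 + norm y) powr r"
    using assms(1) by (rule poly_boundedE) blast
  show ?thesis
  proof (rule poly_boundedI)
    fix x :: 'a and y :: 'b assume "y \<in> Y"
    have "C * (1 + norm x) ^ N * (1 + norm y) powr r \<le> C * (1 + norm x) ^ N * (1 + norm y) powr s"
      using C(1) assms(2) by (intro mult_left_mono powr_mono) auto
    with C(2)[OF \<open>y \<in> Y\<close>] show "cmod (p (x, y)) \<le> C * (1 + norm x) ^ N * (1 + norm y) powr s"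
      by (rule order_trans)
  qed
qed

lemma poly_bounded_add:
  fixes p q :: "'a::real_normed_vector \<times> 'b::real_normed_vector \<Rightarrow> complex"
  assumes "poly_bounded Y r p" "poly_bounded Y r q"
  shows "poly_bounded Y r (\<lambda>z. p z + q z)"
proof -
  obtain C N where C: "0 \<le> C" "\<And>x y. y \<in> Y \<Longrightarrow> cmod (p (x, y)) \<le> C * (1 + norm x) ^ N * (1 + norm y) powr r"
    using assms(1) by (rule poly_boundedE) blast
  obtain C' N' where C': "0 \<le> C'" "\<And>x y. y \<in> Y \<Longrightarrow> cmod (q (x, y)) \<le> C' * (1 + norm x) ^ N' * (1 + norm y) powr r"
    using assms(2) by (rule poly_boundedE) blast
  show ?thesis
  proof (rule poly_boundedI)
    fix x :: 'a and y :: 'b assume y: "y \<in> Y"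
    have "cmod (p (x, y)) \<le> C * (1 + norm x) ^ (N + N') * (1 + norm y) powr r"
      using C(1) by (intro order_trans[OF C(2)[OF y]] mult_left_mono mult_right_mono power_increasing) auto
    moreover have "cmod (q (x, y)) \<le> C' * (1 + norm x) ^ (N + N') * (1 + norm y) powr r"
      using C'(1) by (intro order_trans[OF C'(2)[OF y]] mult_left_mono mult_right_mono power_increasing) auto
    ultimately show "cmod (p (x, y) + q (x, y)) \<le> (C + C') * (1 + norm x) ^ (N + N') * (1 + norm y) powr r"
      using norm_triangle_ineq[of "p (x, y)" "q (x, y)"] by (simp add: algebra_simps)
  qed
qed

lemma poly_bounded_mult:
  fixes p q :: "'a::real_normed_vector \<times> 'b::real_normed_vector \<Rightarrow> complex"
  assumes "poly_bounded Y r p" "poly_bounded Y s q"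
  shows "poly_bounded Y (r + s) (\<lambda>z. p z * q z)"
proof -
  obtain C N where C: "0 \<le> C" "\<And>x y. y \<in> Y \<Longrightarrow> cmod (p (x, y)) \<le> C * (1 + norm x) ^ N * (1 + norm y) powr r"
    using assms(1) by (rule poly_boundedE) blast
  obtain C' N' where C': "0 \<le> C'" "\<And>x y. y \<in> Y \<Longrightarrow> cmod (q (x, y)) \<le> C' * (1 + norm x) ^ N' * (1 + norm y) powr s"
    using assms(2) by (rule poly_boundedE) blast
  show ?thesis
  proof (rule poly_boundedI)
    fix x :: 'a and y :: 'b assume y: "y \<in> Y"
    have "cmod (p (x, y)) * cmod (q (x, y)) \<le>
        (C * (1 + norm x) ^ N * (1 + norm y) powr r) * (C' * (1 + norm x) ^ N' * (1 + norm y) powr s)"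
      using C(1) by (intro mult_mono C C' y) auto
    then show "cmod (p (x, y) * q (x, y)) \<le> (C * C') * (1 + norm x) ^ (N + N') * (1 + norm y) powr (r + s)"
      by (simp add: norm_mult powr_add power_add mult_ac)
  qed
qed

lemma amp_imp_poly_bounded: "amp D Y l r p \<Longrightarrow> poly_bounded Y r p"
  by (cases l) auto

lemma amp_Suc_imp: "amp D Y (Suc l) r p \<Longrightarrow> amp D Y l r p"
proof (induction l arbitrary: p)
  case (Suc l)
  then obtain p' where "poly_bounded Y r p" "\<forall>x. \<forall>y\<in>Y. (p has_derivative p' (x, y)) (at (x, y))"
     "\<forall>e\<in>D. amp D Y (Suc l) r (\<lambda>z. p' z e)" by (subst (asm) (2) amp.simps) blast
  then show ?case using Suc.IH by (subst amp.simps) blast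
qed auto

lemma amp_mono: "amp D Y l r p \<Longrightarrow> r \<le> s \<Longrightarrow> amp D Y l s p"
proof (induction l arbitrary: p)
  case (Suc l)
  then obtain p' where "poly_bounded Y r p" "\<forall>x. \<forall>y\<in>Y. (p has_derivative p' (x, y)) (at (x, y))"
     "\<forall>e\<in>D. amp D Y l r (\<lambda>z. p' z e)" by auto
  then show ?case using Suc.IH Suc.prems poly_bounded_mono by (auto intro!: exI[of _ p'])
qed (auto intro: poly_bounded_mono)

lemma amp_subset: "amp D Y l r p \<Longrightarrow> D' \<subseteq> D \<Longrightarrow> Y' \<subseteq> Y \<Longrightarrow> amp D' Y' l r p"
proof (induction l arbitrary: p)
  case (Suc l)
  have b: "poly_bounded Y' r p" if "poly_bounded Y r p" for p :: "'a \<times> 'b \<Rightarrow> complex"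
    using that Suc.prems(3) unfolding poly_bounded_def by blast
  from Suc.prems(1) obtain p' where "poly_bounded Y r p" "\<forall>x. \<forall>y\<in>Y. (p has_derivative p' (x, y)) (at (x, y))"
     "\<forall>e\<in>D. amp D Y l r (\<lambda>z. p' z e)" by auto
  then show ?case using Suc.IH Suc.prems b by (auto intro!: exI[of _ p'])
qed (auto simp: poly_bounded_def; blast)

lemma amp_add: "amp D Y l r p \<Longrightarrow> amp D Y l r q \<Longrightarrow> amp D Y l r (\<lambda>z. p z + q z)"
proof (induction l arbitrary: p q)
  case (Suc l)
  from Suc.prems obtain p' q' where
    p: "poly_bounded Y r p" "\<forall>x. \<forall>y\<in>Y. (p has_derivative p' (x, y)) (at (x, y))" "\<forall>e\<in>D. amp D Y l r (\<lambda>z. p' z e)" and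
    q: "poly_bounded Y r q" "\<forall>x. \<forall>y\<in>Y. (q has_derivative q' (x, y)) (at (x, y))" "\<forall>e\<in>D. amp D Y l r (\<lambda>z. q' z e)"
    by auto
  have "\<forall>x. \<forall>y\<in>Y. ((\<lambda>z. p z + q z) has_derivative (\<lambda>h. p' (x, y) h + q' (x, y) h)) (at (x, y))"
    using p q by (auto intro!: has_derivative_add)
  moreover have "\<forall>e\<in>D. amp D Y l r (\<lambda>z. p' z e + q' z e)" using Suc.IH p q by auto
  ultimately show ?case using p q poly_bounded_add by (auto intro!: exI[of _ "\<lambda>z h. p' z h + q' z h"])
qed (auto intro: poly_bounded_add)

lemma amp_mult: "amp D Y l r p \<Longrightarrow> amp D Y l s q \<Longrightarrow> amp D Y l (r + s) (\<lambda>z. p z * q z)"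
proof (induction l arbitrary: p q)
  case (Suc l)
  from Suc.prems obtain p' q' where
    p: "poly_bounded Y r p" "\<forall>x. \<forall>y\<in>Y. (p has_derivative p' (x, y)) (at (x, y))" "\<forall>e\<in>D. amp D Y l r (\<lambda>z. p' z e)" and
    q: "poly_bounded Y s q" "\<forall>x. \<forall>y\<in>Y. (q has_derivative q' (x, y)) (at (x, y))" "\<forall>e\<in>D. amp D Y l s (\<lambda>z. q' z e)"
    by auto
  have "\<forall>x. \<forall>y\<in>Y. ((\<lambda>z. p z * q z) has_derivative (\<lambda>h. p (x, y) * q' (x, y) h + p' (x, y) h * q (x, y))) (at (x, y))"
    using p q by (auto intro!: has_derivative_mult)
  moreover have "\<forall>e\<in>D. amp D Y l (r + s) (\<lambda>z. p z * q' z e + p' z e * q z)"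
    using Suc.IH p q Suc.prems[THEN amp_Suc_imp] by (auto intro!: amp_add)
  ultimately show ?case using p q poly_bounded_mult by (auto intro!: exI[of _ "\<lambda>z h. p z * q' z h + p' z h * q z"])
qed (auto intro: poly_bounded_mult)

lemma poly_bounded_const:
  "poly_bounded (Y :: 'b::real_normed_vector set) 0 (\<lambda>_ :: 'a::real_normed_vector \<times> 'b. k)"
proof (rule poly_boundedI[where C="cmod k" and N=0])
  fix x :: 'a and y :: 'b
  have "1 + norm y \<noteq> 0" by (smt (verit) norm_ge_zero)
  then show "cmod k \<le> cmod k * (1 + norm x) ^ 0 * (1 + norm y) powr 0" by simp
qed

lemma amp_const: "amp D Y l 0 (\<lambda>_. k)"
proof (induction l arbitrary: k)
  case (Suc l)
  then show ?case by (auto intro!: poly_bounded_const exI[of _ "\<lambda>_ _. 0"])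
qed (simp add: poly_bounded_const)

lemma amp_cmult: "amp D Y l r p \<Longrightarrow> amp D Y l r (\<lambda>z. k * p z)"
  using amp_mult[OF amp_const, of D Y l r p k] by simp

text \<open>The order is 1 because \<open>norm x + norm y \<le> (1 + norm x) * (1 + norm y)\<close>;
  the derivatives are constants. This is for the bilinear part of the phase, whose first derivatives
  are linear.\<close>

lemma amp_bounded_linear:
  fixes L :: "'a::real_normed_vector \<times> 'b::real_normed_vector \<Rightarrow> complex"
  assumes L: "bounded_linear L"
  shows "amp D Y l 1 L"
proof -
  interpret bounded_linear L by fact
  obtain K where K: "\<And>z. norm (L z) \<le> norm z * K" "0 \<le> K" using nonneg_bounded by blast
  have "poly_bounded Y 1 L"
  proof (rule poly_boundedI[where C=K and N=1])
    fix x :: 'a and y :: 'b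
    have "norm (x, y) \<le> norm x + norm y" by (rule norm_Pair_le)
    also have "\<dots> \<le> (1 + norm x) * (1 + norm y)" by (simp add: algebra_simps)
    finally have "norm (x, y) * K \<le> (1 + norm x) * (1 + norm y) * K" using K(2) by (rule mult_right_mono)
    with K(1)[of "(x, y)"] show "cmod (L (x, y)) \<le> K * (1 + norm x) ^ 1 * (1 + norm y) powr 1"
      by (simp add: mult_ac)
  qed
  then show ?thesis
    using amp_mono[OF amp_const, of 1] has_derivative[OF has_derivative_ident]
    by (cases l) (auto intro!: exI[of _ "\<lambda>_. L"])
qed

text \<open>Differentiation turns 1/q into -q'/q^2, of order -1 + 1 - 1 = -1, so the order does not
  deteriorate. The lower bound on q is uniform in x.\<close>

lemma amp_inverse:
  assumes "0 < c" and low: "\<And>x y. y \<in> Y \<Longrightarrow> c * (1 + norm y) \<le> cmod (q (x, y))"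
  shows "amp D Y l 1 q \<Longrightarrow> amp D Y l (- 1) (\<lambda>z. inverse (q z))"
proof (induction l)
  case 0
  show ?case unfolding amp.simps
  proof (rule poly_boundedI[where C="1 / c" and N=0])
    fix x y assume "y \<in> Y"
    have "0 < c * (1 + norm y)" using \<open>0 < c\<close> by (simp add: add_pos_nonneg)
    then have "1 / cmod (q (x, y)) \<le> 1 / (c * (1 + norm y))"
      using low[OF \<open>y \<in> Y\<close>, of x] by (intro divide_left_mono) (auto intro!: mult_pos_pos simp del: zero_less_mult_iff)
    then show "cmod (inverse (q (x, y))) \<le> 1 / c * (1 + norm x) ^ 0 * (1 + norm y) powr - 1"
      by (simp add: norm_inverse powr_minus divide_inverse mult_ac add_nonneg_nonneg powr_one')
  qed
next
  case (Suc l)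
  from Suc.prems obtain q' where
    q: "\<forall>x. \<forall>y\<in>Y. (q has_derivative q' (x, y)) (at (x, y))" "\<forall>e\<in>D. amp D Y l 1 (\<lambda>z. q' z e)"
    by auto
  have IH: "amp D Y l (- 1) (\<lambda>z. inverse (q z))" using Suc.IH Suc.prems amp_Suc_imp by blast
  have "q (x, y) \<noteq> 0" if "y \<in> Y" for x y
  proof -
    have "0 < c * (1 + norm y)" using \<open>0 < c\<close> by (simp add: add_pos_nonneg)
    with low[OF that, of x] show ?thesis by (metis norm_zero not_le)
  qed
  then have 1: "\<forall>x. \<forall>y\<in>Y. ((\<lambda>z. inverse (q z)) has_derivative
      (\<lambda>h. - (inverse (q (x, y)) * q' (x, y) h * inverse (q (x, y))))) (at (x, y))"
    using q by (auto intro!: has_derivative_inverse)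
  have "amp D Y l (- 1) (\<lambda>z. - (inverse (q z) * q' z e * inverse (q z)))" if "e \<in> D" for e
    using amp_cmult[OF amp_mult[OF amp_mult[OF IH bspec[OF q(2) that]] IH], of "-1"] by simp
  then show ?case
    using 1 amp_imp_poly_bounded[OF IH]
    by (auto intro!: exI[of _ "\<lambda>z h. - (inverse (q z) * q' z h * inverse (q z))"])
qed

text \<open>With \<open>Y = UNIV\<close> the derivative in \<open>amp\<close> is determined
  everywhere, so the existential witness becomes \<open>frechet_derivative\<close>.\<close>

lemma amp_Suc_UNIV:
  "amp D UNIV (Suc l) r p \<longleftrightarrow> poly_bounded UNIV r p \<and> (\<forall>z. p differentiable (at z)) \<and>
     (\<forall>e\<in>D. amp D UNIV l r (\<lambda>z. frechet_derivative p (at z) e))" (is "?L \<longleftrightarrow> ?R")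
proof
  assume ?L
  then obtain p' where p: "poly_bounded UNIV r p" "\<And>z. (p has_derivative p' z) (at z)" "\<forall>e\<in>D. amp D UNIV l r (\<lambda>z. p' z e)"
    by auto
  from p(2) have "p' = (\<lambda>z. frechet_derivative p (at z))" by (intro ext frechet_derivative_at[THEN fun_cong])
  with p show ?R by (auto intro: differentiableI)
next
  assume ?R
  then show ?L by (auto simp: frechet_derivative_works intro!: exI[of _ "\<lambda>z. frechet_derivative p (at z)"])
qed

lemma amp_continuous_on_slice:
  assumes "amp D Y (Suc l) r p" "y \<in> Y"
  shows "continuous_on UNIV (\<lambda>x. p (x, y))"
proof (intro continuous_at_imp_continuous_on ballI)
  fix x
  obtain p' where "(p has_derivative p' (x, y)) (at (x, y))" using assms by auto
  then have "isCont p (x, y)" by (rule has_derivative_continuous)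
  moreover have "isCont (\<lambda>x. (x, y)) x" by (intro continuous_intros)
  ultimately show "isCont (\<lambda>x. p (x, y)) x" using isCont_o2 by blast
qed

lemma amp_of_C_infinity:
  assumes "p \<in> C_infinity" "\<And>es. es \<in> lists Basis \<Longrightarrow> poly_bounded UNIV r (iter_partial es p)"
  shows "amp Basis UNIV l r p"
  using assms
proof (induction l arbitrary: p)
  case 0
  then show ?case using "0.prems"(2)[of "[]"] by simp
next
  case (Suc l)
  have "amp Basis UNIV l r (\<lambda>z. frechet_derivative p (at z) e)" if e: "e \<in> Basis" for e
  proof -
    have 1: "(\<lambda>z. frechet_derivative p (at z) e) = iter_partial [e] p" by simp
    show ?thesis unfolding 1
    proof (rule Suc.IH)
      show "iter_partial [e] p \<in> C_infinity" using Suc.prems(1) e by (intro C_infinity_iter_partial) auto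
      show "poly_bounded UNIV r (iter_partial es (iter_partial [e] p))" if "es \<in> lists Basis" for es
        using Suc.prems(2)[of "es @ [e]"] that e by (simp add: iter_partial_append)
    qed
  qed
  then show ?case
    unfolding amp_Suc_UNIV
    using Suc.prems(2)[of "[]"] C_infinity_iter_partial_differentiable[OF Suc.prems(1), of "[]"] by auto
qed

section \<open>Integral operators with nonstationary phase\<close>

lemma schwartz_C_infinity: "v \<in> schwartz \<Longrightarrow> v \<in> C_infinity"
  by (simp add: schwartz_def)

lemma schwartz_bound:
  assumes "v \<in> schwartz" "\<beta> \<in> lists Basis"
  shows "(1 + norm x) ^ k * cmod (iter_partial \<beta> v x) \<le> schwartz_seminorm (k, \<beta>) v"
proof -
  have "bdd_above (range (schwartz_weighted k \<beta> v))" using assms by (auto simp: schwartz_def)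
  then have "schwartz_weighted k \<beta> v x \<le> (SUP x. schwartz_weighted k \<beta> v x)"
    by (rule cSUP_upper[OF UNIV_I])
  then show ?thesis by (simp add: schwartz_weighted_def schwartz_seminorm_def)
qed

lemma schwartz_bound':
  assumes "v \<in> schwartz" "\<beta> \<in> lists Basis"
  shows "cmod (iter_partial \<beta> v x) \<le> schwartz_seminorm (k, \<beta>) v / (1 + norm x) ^ k"
proof -
  have "0 < (1 + norm x) ^ k" by (simp add: add_pos_nonneg)
  then show ?thesis using schwartz_bound[OF assms, of x k] by (simp add: pos_le_divide_eq mult.commute)
qed

lemma schwartz_seminorm_nonneg:
  assumes "v \<in> schwartz" "i \<in> UNIV \<times> lists Basis"
  shows "0 \<le> schwartz_seminorm i v"
proof -
  obtain k \<beta> where i: "i = (k, \<beta>)" "\<beta> \<in> lists Basis" using assms by auto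
  have "0 \<le> (1 + norm (0 :: 'a)) ^ k * cmod (iter_partial \<beta> v 0)" by simp
  also have "\<dots> \<le> schwartz_seminorm (k, \<beta>) v" using assms i by (intro schwartz_bound) auto
  finally show ?thesis by (simp add: i)
qed

lemma schwartz_memI:
  assumes "f \<in> C_infinity"
    and "\<And>k \<beta>. \<beta> \<in> lists Basis \<Longrightarrow> \<exists>B. \<forall>x. (1 + norm x) ^ k * cmod (iter_partial \<beta> f x) \<le> B"
  shows "f \<in> schwartz"
  unfolding schwartz_def mem_Collect_eq
proof (intro conjI allI ballI)
  fix k and \<beta> :: "'a list" assume "\<beta> \<in> lists Basis"
  then obtain B where "\<forall>x. (1 + norm x) ^ k * cmod (iter_partial \<beta> f x) \<le> B" using assms(2) by blast
  then show "bdd_above (range (schwartz_weighted k \<beta> f))"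
    by (intro bdd_aboveI[of _ B]) (auto simp: schwartz_weighted_def)
qed (rule assms)

lemma schwartz_seminorm_le:
  assumes "\<And>x. (1 + norm x) ^ k * cmod (iter_partial \<beta> f x) \<le> B"
  shows "schwartz_seminorm (k, \<beta>) f \<le> B"
  unfolding schwartz_seminorm_def schwartz_weighted_def prod.case using assms by (intro cSUP_least) auto

lemma
  assumes f: "f \<in> schwartz" and g: "g \<in> schwartz"
  shows schwartz_lincomb: "(\<lambda>x. s * f x + t * g x) \<in> schwartz"
    and schwartz_seminorm_lincomb: "i \<in> UNIV \<times> lists Basis \<Longrightarrow>
      schwartz_seminorm i (\<lambda>x. s * f x + t * g x) \<le> cmod s * schwartz_seminorm i f + cmod t * schwartz_seminorm i g"
proof -
  have fg: "f \<in> C_infinity" "g \<in> C_infinity" using f g by (auto simp: schwartz_C_infinity)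
  have *: "(1 + norm x) ^ k * cmod (iter_partial \<beta> (\<lambda>x. s * f x + t * g x) x)
     \<le> cmod s * schwartz_seminorm (k, \<beta>) f + cmod t * schwartz_seminorm (k, \<beta>) g" if \<beta>: "\<beta> \<in> lists Basis" for k \<beta> x
  proof -
    have "(1 + norm x) ^ k * cmod (iter_partial \<beta> (\<lambda>x. s * f x + t * g x) x)
      \<le> (1 + norm x) ^ k * (cmod s * cmod (iter_partial \<beta> f x) + cmod t * cmod (iter_partial \<beta> g x))"
      unfolding iter_partial_lincomb[OF fg \<beta>]
      by (intro mult_left_mono) (auto intro: order_trans[OF norm_triangle_ineq] simp: norm_mult)
    also have "\<dots> = cmod s * ((1 + norm x) ^ k * cmod (iter_partial \<beta> f x)) + cmod t * ((1 + norm x) ^ k * cmod (iter_partial \<beta> g x))"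
      by (simp add: algebra_simps)
    also have "\<dots> \<le> cmod s * schwartz_seminorm (k, \<beta>) f + cmod t * schwartz_seminorm (k, \<beta>) g"
      using f g \<beta> by (intro add_mono mult_left_mono schwartz_bound) auto
    finally show ?thesis .
  qed
  show "(\<lambda>x. s * f x + t * g x) \<in> schwartz"
    using * by (intro schwartz_memI C_infinity_lincomb fg) blast
  show "i \<in> UNIV \<times> lists Basis \<Longrightarrow>
      schwartz_seminorm i (\<lambda>x. s * f x + t * g x) \<le> cmod s * schwartz_seminorm i f + cmod t * schwartz_seminorm i g"
    using * by (auto intro!: schwartz_seminorm_le)
qed

text \<open>The constant and the finite set of seminorms are fixed before \<open>v\<close>; this
  uniformity is what later becomes continuity. Hiding them in a predicate lets estimates be added,
  scaled and composed without tracking which seminorms occur.\<close>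

definition dominated :: "(('a::euclidean_space \<Rightarrow> complex) \<Rightarrow> real) \<Rightarrow> bool" where
  "dominated Q \<longleftrightarrow> (\<exists>C F. 0 \<le> C \<and> finite F \<and> F \<subseteq> UNIV \<times> lists Basis \<and>
     (\<forall>v\<in>schwartz. 0 \<le> Q v \<and> Q v \<le> C * (\<Sum>i\<in>F. schwartz_seminorm i v)))"

lemma dominatedE:
  assumes "dominated Q"
  obtains C F where "0 \<le> C" "finite F" "F \<subseteq> UNIV \<times> lists Basis"
    "\<And>v. v \<in> schwartz \<Longrightarrow> 0 \<le> Q v \<and> Q v \<le> C * (\<Sum>i\<in>F. schwartz_seminorm i v)"
  using assms unfolding dominated_def by (elim exE conjE, intro that) blast+

lemma dominated_seminorm: "i \<in> UNIV \<times> lists Basis \<Longrightarrow> dominated (schwartz_seminorm i)"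
  unfolding dominated_def by (intro exI[of _ 1] exI[of _ "{i}"]) (auto simp: schwartz_seminorm_nonneg)

lemma dominated_mono:
  assumes "dominated Q" "\<And>v. v \<in> schwartz \<Longrightarrow> 0 \<le> Q' v" "\<And>v. v \<in> schwartz \<Longrightarrow> Q' v \<le> Q v"
  shows "dominated Q'"
  using assms unfolding dominated_def by (meson order_trans)

lemma dominated_nonneg: "dominated Q \<Longrightarrow> v \<in> schwartz \<Longrightarrow> 0 \<le> Q v"
  unfolding dominated_def by blast

lemma dominated_add:
  fixes Q Q' :: "('a::euclidean_space \<Rightarrow> complex) \<Rightarrow> real"
  assumes "dominated Q" "dominated Q'"
  shows "dominated (\<lambda>v. Q v + Q' v)"
proof -
  obtain C F where 1: "0 \<le> C" "finite F" "F \<subseteq> UNIV \<times> lists Basis"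
    "\<And>v. v \<in> schwartz \<Longrightarrow> 0 \<le> Q v \<and> Q v \<le> C * (\<Sum>i\<in>F. schwartz_seminorm i v)"
    using assms(1) by (rule dominatedE) (rule that)
  obtain C' F' where 2: "0 \<le> C'" "finite F'" "F' \<subseteq> UNIV \<times> lists Basis"
    "\<And>v. v \<in> schwartz \<Longrightarrow> 0 \<le> Q' v \<and> Q' v \<le> C' * (\<Sum>i\<in>F'. schwartz_seminorm i v)"
    using assms(2) by (rule dominatedE) (rule that)
  show ?thesis unfolding dominated_def
  proof (intro exI conjI ballI)
    show "0 \<le> C + C'" "finite (F \<union> F')" "F \<union> F' \<subseteq> UNIV \<times> lists Basis" using 1 2 by auto
    fix v :: "'a \<Rightarrow> complex" assume v: "v \<in> schwartz"
    have nn: "0 \<le> schwartz_seminorm i v" if "i \<in> F \<union> F'" for i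
      using that v 1 2 by (intro schwartz_seminorm_nonneg) auto
    show "0 \<le> Q v + Q' v" using 1(4)[OF v] 2(4)[OF v] by simp
    have "Q v \<le> C * (\<Sum>i\<in>F \<union> F'. schwartz_seminorm i v)"
      using 1 2 v nn by (intro order_trans[OF conjunct2[OF 1(4)[OF v]]] mult_left_mono sum_mono2) auto
    moreover have "Q' v \<le> C' * (\<Sum>i\<in>F \<union> F'. schwartz_seminorm i v)"
      using 1 2 v nn by (intro order_trans[OF conjunct2[OF 2(4)[OF v]]] mult_left_mono sum_mono2) auto
    ultimately show "Q v + Q' v \<le> (C + C') * (\<Sum>i\<in>F \<union> F'. schwartz_seminorm i v)"
      by (simp add: algebra_simps)
  qed
qed

lemma dominated_cmult:
  assumes "dominated Q" "0 \<le> (k::real)"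
  shows "dominated (\<lambda>v. k * Q v)"
proof -
  obtain C F where 1: "0 \<le> C" "finite F" "F \<subseteq> UNIV \<times> lists Basis"
    "\<And>v. v \<in> schwartz \<Longrightarrow> 0 \<le> Q v \<and> Q v \<le> C * (\<Sum>i\<in>F. schwartz_seminorm i v)"
    using assms(1) by (rule dominatedE) (rule that)
  have "\<forall>v\<in>schwartz. 0 \<le> k * Q v \<and> k * Q v \<le> (k * C) * (\<Sum>i\<in>F. schwartz_seminorm i v)"
    using 1(4) assms(2) by (simp add: mult.assoc mult_left_mono)
  then show ?thesis
    unfolding dominated_def using 1(1-3) assms(2)
    by (intro exI[of _ "k * C"] exI[of _ F] conjI) (simp, assumption+)
qed

lemma dominated_zero: "dominated (\<lambda>_. 0)"
  unfolding dominated_def by (intro exI[of _ 0] exI[of _ "{}"]) auto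

lemma dominated_sum: "finite A \<Longrightarrow> (\<And>j. j \<in> A \<Longrightarrow> dominated (Q j)) \<Longrightarrow> dominated (\<lambda>v. \<Sum>j\<in>A. Q j v)"
  by (induction A rule: finite_induct) (auto intro: dominated_zero dominated_add)

lemma norm_integral_decay_bound:
  fixes f :: "'a::euclidean_space \<Rightarrow> complex"
  assumes "f \<in> borel_measurable borel" and "\<And>x. norm (f x) \<le> C / (1 + norm x) ^ (2 * DIM('a))"
  shows "norm (LINT x|lborel. f x) \<le> C * (LINT x|lborel. 1 / (1 + norm (x::'a)) ^ (2 * DIM('a)))"
proof -
  have "norm (LINT x|lborel. f x) \<le> (LINT x|lborel. C * (1 / (1 + norm (x::'a)) ^ (2 * DIM('a))))"
    using integrable_decay_bound[OF assms] integrable_mult_right[OF integrable_decay] assms(2)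
    by (intro Bochner_Integration.integral_norm_bound_integral) auto
  then show ?thesis by (simp only: integral_mult_right_zero)
qed

text \<open>A seminorm with weight \<open>N + K\<close>: N powers pay for the growth of
  \<open>g\<close> in x, the other K remain as decay.\<close>

lemma poly_bounded_times_schwartz:
  fixes g :: "'a::euclidean_space \<times> 'b::real_normed_vector \<Rightarrow> complex"
  assumes "poly_bounded Y r g" "\<beta> \<in> lists Basis"
  shows "\<exists>Q. dominated Q \<and> (\<forall>v\<in>schwartz. \<forall>x. \<forall>y\<in>Y.
     cmod (g (x, y) * iter_partial \<beta> v x) \<le> Q v * (1 + norm y) powr r / (1 + norm x) ^ K)"
proof -
  obtain C N where C: "0 \<le> C" "\<And>x y. y \<in> Y \<Longrightarrow> cmod (g (x, y)) \<le> C * (1 + norm x) ^ N * (1 + norm y) powr r"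
    using assms(1) by (rule poly_boundedE) blast
  show ?thesis
  proof (intro exI conjI ballI allI)
    show "dominated (\<lambda>v. C * schwartz_seminorm (N + K, \<beta>) v)"
      using assms C by (intro dominated_cmult dominated_seminorm) auto
    fix v :: "'a \<Rightarrow> complex" and x :: 'a and y :: 'b assume v: "v \<in> schwartz" and y: "y \<in> Y"
    have "cmod (g (x, y)) * cmod (iter_partial \<beta> v x)
        \<le> (C * (1 + norm x) ^ N * (1 + norm y) powr r) * (schwartz_seminorm (N + K, \<beta>) v / (1 + norm x) ^ (N + K))"
      using C(1) by (intro mult_mono C(2)[OF y] schwartz_bound'[OF v assms(2)]) auto
    also have "\<dots> = C * schwartz_seminorm (N + K, \<beta>) v * (1 + norm y) powr r / (1 + norm x) ^ K"
    proof -
      have "1 + norm x \<noteq> 0" by (smt (verit) norm_ge_zero)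
      then show ?thesis by (simp add: power_add)
    qed
    finally show "cmod (g (x, y) * iter_partial \<beta> v x) \<le> C * schwartz_seminorm (N + K, \<beta>) v * (1 + norm y) powr r / (1 + norm x) ^ K"
      by (simp add: norm_mult)
  qed
qed

definition osc :: "('a::euclidean_space \<times> 'a \<Rightarrow> complex) \<Rightarrow> ('a \<times> 'a \<Rightarrow> complex) \<Rightarrow> ('a \<Rightarrow> complex) \<Rightarrow> 'a \<Rightarrow> complex" where
  "osc \<Phi> p v y = (LINT x|lborel. exp (\<Phi> (x, y)) * p (x, y) * v x)"

text \<open>In \<open>\<Phi> (x, y)\<close> the variable of integration is \<open>x\<close>, and \<open>y\<close> is the output variable.\<close>

locale phase =
  fixes \<Phi> :: "'a::euclidean_space \<times> 'a \<Rightarrow> complex" and M R c :: real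
  assumes Re_le: "Re (\<Phi> z) \<le> M"
    and differentiable: "\<Phi> differentiable (at z)"
    and amp_deriv: "e \<in> Basis \<Longrightarrow> amp Basis UNIV l 1 (\<lambda>z. frechet_derivative \<Phi> (at z) e)"
    and c_pos: "0 < c"
    and nonstationary: "R \<le> norm y \<Longrightarrow>
      \<exists>j\<in>Basis. \<forall>x. c * (1 + norm y) \<le> cmod (frechet_derivative \<Phi> (at (x, y)) (j, 0))"
begin

lemma has_derivative: "(\<Phi> has_derivative frechet_derivative \<Phi> (at z)) (at z)"
  using differentiable by (simp add: frechet_derivative_works)

lemma continuous_on: "continuous_on A \<Phi>"
  using has_derivative by (meson continuous_at_imp_continuous_on has_derivative_continuous)

lemma continuous_on_slice: "continuous_on UNIV (\<lambda>x. exp (\<Phi> (x, y)))"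
  by (intro continuous_intros continuous_on_compose2[OF continuous_on]) auto

lemma norm_exp_le: "cmod (exp (\<Phi> z)) \<le> exp M"
  using Re_le by simp

lemma term_bound:
  assumes "amp D Y l r g" "\<beta> \<in> lists Basis"
  shows "\<exists>Q. dominated Q \<and> (\<forall>v\<in>schwartz. \<forall>x. \<forall>y\<in>Y.
     cmod (exp (\<Phi> (x, y)) * g (x, y) * iter_partial \<beta> v x) \<le> Q v * (1 + norm y) powr r / (1 + norm x) ^ K)"
proof -
  obtain Q where Q: "dominated Q" "\<forall>v\<in>schwartz. \<forall>x. \<forall>y\<in>Y.
     cmod (g (x, y) * iter_partial \<beta> v x) \<le> Q v * (1 + norm y) powr r / (1 + norm x) ^ K"
    using poly_bounded_times_schwartz[OF amp_imp_poly_bounded[OF assms(1)] assms(2)] by blast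
  show ?thesis
  proof (intro exI conjI ballI allI)
    show "dominated (\<lambda>v. exp M * Q v)" using Q by (intro dominated_cmult) auto
    fix v :: "'a \<Rightarrow> complex" and x y assume v: "v \<in> schwartz" and y: "y \<in> Y"
    have "cmod (exp (\<Phi> (x, y))) * cmod (g (x, y) * iter_partial \<beta> v x) \<le> exp M * (Q v * (1 + norm y) powr r / (1 + norm x) ^ K)"
      using Q v y by (intro mult_mono norm_exp_le) auto
    then show "cmod (exp (\<Phi> (x, y)) * g (x, y) * iter_partial \<beta> v x) \<le> exp M * Q v * (1 + norm y) powr r / (1 + norm x) ^ K"
      by (simp add: norm_mult mult_ac)
  qed
qed

lemma term_measurable:
  assumes "amp D Y (Suc l) r g" "\<beta> \<in> lists Basis" "v \<in> schwartz" "y \<in> Y"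
  shows "(\<lambda>x. exp (\<Phi> (x, y)) * g (x, y) * iter_partial \<beta> v x) \<in> borel_measurable borel"
  using assms
  by (intro borel_measurable_continuous_onI continuous_on_mult continuous_on_slice amp_continuous_on_slice
      C_infinity_continuous_on_iter_partial schwartz_C_infinity) auto

lemma term_integrable:
  assumes "amp D Y (Suc l) r g" "\<beta> \<in> lists Basis" "v \<in> schwartz" "y \<in> Y"
  shows "integrable lborel (\<lambda>x. exp (\<Phi> (x, y)) * g (x, y) * iter_partial \<beta> v x)"
proof -
  obtain Q where "\<forall>v\<in>schwartz. \<forall>x. \<forall>y\<in>Y.
     cmod (exp (\<Phi> (x, y)) * g (x, y) * iter_partial \<beta> v x) \<le> Q v * (1 + norm y) powr r / (1 + norm x) ^ (2 * DIM('a))"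
    using term_bound[OF assms(1,2)] by blast
  then show ?thesis
    using assms by (intro integrable_decay_bound[where C="Q v * (1 + norm y) powr r"] term_measurable) auto
qed

lemma osc_trivial_bound:
  assumes "amp D Y (Suc l) r g" "\<beta> \<in> lists Basis"
  shows "\<exists>Q. dominated Q \<and> (\<forall>v\<in>schwartz. \<forall>y\<in>Y.
     cmod (osc \<Phi> g (iter_partial \<beta> v) y) \<le> Q v * (1 + norm y) powr r)"
proof -
  let ?J = "LINT x|lborel. 1 / (1 + norm (x::'a)) ^ (2 * DIM('a))"
  obtain Q where Q: "dominated Q" "\<forall>v\<in>schwartz. \<forall>x. \<forall>y\<in>Y.
     cmod (exp (\<Phi> (x, y)) * g (x, y) * iter_partial \<beta> v x) \<le> Q v * (1 + norm y) powr r / (1 + norm x) ^ (2 * DIM('a))"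
    using term_bound[OF assms] by blast
  show ?thesis
  proof (intro exI conjI ballI)
    show "dominated (\<lambda>v. ?J * Q v)" using Q by (intro dominated_cmult integral_nonneg_AE) auto
    fix v :: "'a \<Rightarrow> complex" and y assume v: "v \<in> schwartz" and y: "y \<in> Y"
    have "cmod (osc \<Phi> g (iter_partial \<beta> v) y) \<le> (Q v * (1 + norm y) powr r) * ?J"
      unfolding osc_def using Q v y by (intro norm_integral_decay_bound term_measurable[OF assms v y]) auto
    then show "cmod (osc \<Phi> g (iter_partial \<beta> v) y) \<le> ?J * Q v * (1 + norm y) powr r"
      by (simp add: mult_ac)
  qed
qed

text \<open>The x derivative in direction \<open>j\<close> of
  \<open>exp \<Phi> * h * iter_partial \<beta> v\<close> has integral zero. The product rule splits
  it into \<open>?T1\<close>, \<open>?T2\<close> and \<open>?T3\<close>, where the derivative falls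
  on the exponential, on \<open>h\<close> and on the Schwartz function.\<close>

lemma osc_parts:
  assumes h: "amp {(j, 0)} Y (Suc (Suc l)) r h" and v: "v \<in> schwartz" and \<beta>: "\<beta> \<in> lists Basis" and j: "j \<in> Basis" and y: "y \<in> Y"
    and h': "\<And>x. (h has_derivative h' (x, y)) (at (x, y))" "amp {(j, 0)} Y (Suc l) r (\<lambda>z. h' z (j, 0))"
    and q: "amp {(j, 0)} Y (Suc l) 1 (\<lambda>z. frechet_derivative \<Phi> (at z) (j, 0))"
  shows "osc \<Phi> (\<lambda>z. frechet_derivative \<Phi> (at z) (j, 0) * h z) (iter_partial \<beta> v) y
    = - (osc \<Phi> (\<lambda>z. h' z (j, 0)) (iter_partial \<beta> v) y + osc \<Phi> h (iter_partial (j # \<beta>) v) y)"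
proof -
  let ?q = "\<lambda>z. frechet_derivative \<Phi> (at z) (j, 0)"
  let ?K = "2 * DIM('a)"
  let ?F = "\<lambda>x. exp (\<Phi> (x, y)) * h (x, y) * iter_partial \<beta> v x"
  let ?T1 = "\<lambda>x. exp (\<Phi> (x, y)) * (?q (x, y) * h (x, y)) * iter_partial \<beta> v x"
  let ?T2 = "\<lambda>x. exp (\<Phi> (x, y)) * h' (x, y) (j, 0) * iter_partial \<beta> v x"
  let ?T3 = "\<lambda>x. exp (\<Phi> (x, y)) * h (x, y) * iter_partial (j # \<beta>) v x"
  have h1: "amp {(j, 0)} Y (Suc l) r h" using h by (rule amp_Suc_imp)
  have qh: "amp {(j, 0)} Y (Suc l) (1 + r) (\<lambda>z. ?q z * h z)" using amp_mult[OF q h1] .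
  have j\<beta>: "j # \<beta> \<in> lists Basis" using j \<beta> by simp
  define F' where "F' x s = exp (\<Phi> (x, y)) * frechet_derivative \<Phi> (at (x, y)) (s, 0) * h (x, y) * iter_partial \<beta> v x
     + exp (\<Phi> (x, y)) * h' (x, y) (s, 0) * iter_partial \<beta> v x
     + exp (\<Phi> (x, y)) * h (x, y) * frechet_derivative (iter_partial \<beta> v) (at x) s" for x s
  have F': "F' x j = ?T1 x + ?T2 x + ?T3 x" for x by (simp add: F'_def mult.assoc)
  have p: "((\<lambda>x. (x, y)) has_derivative (\<lambda>s. (s, 0))) (at x)" for x :: 'a
    by (intro has_derivative_Pair has_derivative_ident has_derivative_const)
  have dF: "(?F has_derivative F' x) (at x)" for x
  proof -
    have 1: "((\<lambda>x. \<Phi> (x, y)) has_derivative (\<lambda>s. frechet_derivative \<Phi> (at (x, y)) (s, 0))) (at x)"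
      by (rule has_derivative_compose[OF p has_derivative])
    have 2: "((\<lambda>x. exp (\<Phi> (x, y))) has_derivative (\<lambda>s. exp (\<Phi> (x, y)) * frechet_derivative \<Phi> (at (x, y)) (s, 0))) (at x)"
      by (rule has_derivative_compose[OF 1 DERIV_exp[unfolded has_field_derivative_def]])
    have 3: "((\<lambda>x. h (x, y)) has_derivative (\<lambda>s. h' (x, y) (s, 0))) (at x)"
      by (rule has_derivative_compose[OF p h'(1)])
    have 4: "(iter_partial \<beta> v has_derivative frechet_derivative (iter_partial \<beta> v) (at x)) (at x)"
      using C_infinity_iter_partial_differentiable[OF schwartz_C_infinity[OF v] \<beta>] by (simp add: frechet_derivative_works)
    show ?thesis
      unfolding F'_def using has_derivative_mult[OF has_derivative_mult[OF 2 3] 4]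
      by (simp add: algebra_simps)
  qed
  have I: "integrable lborel ?T1" "integrable lborel ?T2" "integrable lborel ?T3"
    using term_integrable[OF qh \<beta> v y] term_integrable[OF h'(2) \<beta> v y] term_integrable[OF h1 j\<beta> v y] by auto
  have "\<exists>A. \<forall>x. cmod (exp (\<Phi> (x, y)) * g (x, y) * iter_partial \<beta>' v x) \<le> A / (1 + norm x) ^ ?K"
    if "amp {(j, 0)} Y (Suc l) r' g" "\<beta>' \<in> lists Basis" for r' g \<beta>'
    using term_bound[OF that, of ?K] v y by meson
  note B = this
  obtain A0 where A0: "\<And>x. cmod (?F x) \<le> A0 / (1 + norm x) ^ ?K" using B[OF h1 \<beta>] by blast
  obtain A1 where A1: "\<And>x. cmod (?T1 x) \<le> A1 / (1 + norm x) ^ ?K" using B[OF qh \<beta>] by blast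
  obtain A2 where A2: "\<And>x. cmod (?T2 x) \<le> A2 / (1 + norm x) ^ ?K" using B[OF h'(2) \<beta>] by blast
  obtain A3 where A3: "\<And>x. cmod (?T3 x) \<le> A3 / (1 + norm x) ^ ?K" using B[OF h1 j\<beta>] by blast
  have pos: "0 < (1 + norm x) ^ ?K" for x :: 'a by (simp add: add_pos_nonneg)
  have A0': "0 \<le> A0" using A0[of 0] by (simp add: order_trans[OF norm_ge_zero])
  have A123: "0 \<le> A1" "0 \<le> A2" "0 \<le> A3"
    using A1[of 0] A2[of 0] A3[of 0] by (auto intro: order_trans[OF norm_ge_zero])
  let ?A = "A0 + (A1 + A2 + A3)"
  have "(LINT x|lborel. F' x j) = 0"
  proof (rule integral_directional_derivative_eq_0[OF dF])
    show "(\<lambda>x. F' x j) \<in> borel_measurable borel"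
      unfolding F' using I by (intro borel_measurable_add) (auto dest: borel_measurable_integrable)
    show "cmod (?F x) \<le> ?A / (1 + norm x) ^ ?K" for x
      by (rule order_trans[OF A0], rule divide_right_mono) (use A123 in auto)
    show "cmod (F' x j) \<le> ?A / (1 + norm x) ^ ?K" for x
    proof -
      have "cmod (F' x j) \<le> cmod (?T1 x) + cmod (?T2 x) + cmod (?T3 x)"
        unfolding F' by (intro norm_triangle_le add_mono order_refl norm_triangle_ineq)
      also have "\<dots> \<le> (A1 + A2 + A3) / (1 + norm x) ^ ?K"
        using A1 A2 A3 by (simp only: add_divide_distrib add_mono)
      also have "\<dots> \<le> ?A / (1 + norm x) ^ ?K" using A0' by (intro divide_right_mono) auto
      finally show ?thesis .
    qed
  qed
  then have "(LINT x|lborel. ?T1 x) + (LINT x|lborel. ?T2 x) + (LINT x|lborel. ?T3 x) = 0"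
    unfolding F' by (simp only: Bochner_Integration.integral_add[OF Bochner_Integration.integrable_add[OF I(1,2)] I(3)]
      Bochner_Integration.integral_add[OF I(1,2)])
  then show ?thesis unfolding osc_def by (simp add: add_eq_0_iff2 add.assoc)
qed

text \<open>Write \<open>g = q h\<close> with \<open>q = \<partial>\<Phi>/\<partial>x\<^sub>j\<close> and integrate \<open>exp \<Phi> q\<close> by parts: both resulting terms have an
  amplitude of order \<open>r - 1\<close>.\<close>

lemma osc_decay_direction:
  assumes j: "j \<in> Basis" and low: "\<And>x y. y \<in> Y \<Longrightarrow> c * (1 + norm y) \<le> cmod (frechet_derivative \<Phi> (at (x, y)) (j, 0))"
  shows "amp {(j, 0)} Y (Suc k) r g \<Longrightarrow> \<beta> \<in> lists Basis \<Longrightarrow> \<exists>Q. dominated Q \<and> (\<forall>v\<in>schwartz. \<forall>y\<in>Y.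
     cmod (osc \<Phi> g (iter_partial \<beta> v) y) \<le> Q v * (1 + norm y) powr (r - real k))"
proof (induction k arbitrary: g r \<beta>)
  case 0
  \<comment> \<open>Each integration by parts spends one level of \<open>amp\<close>. The level left
    over makes the integrand continuous in x, hence measurable.\<close>
  then show ?case using osc_trivial_bound[of "{(j, 0)}" Y 0 r g \<beta>] by simp
next
  case (Suc k)
  let ?q = "\<lambda>z. frechet_derivative \<Phi> (at z) (j, 0)"
  have j0: "(j, 0) \<in> Basis" using j by (auto simp: Basis_prod_def)
  have q: "amp {(j, 0)} Y l 1 ?q" for l
    by (rule amp_subset[OF amp_deriv[OF j0]]) (use j0 in auto)
  define h where "h z = g z * inverse (?q z)" for z
  have h: "amp {(j, 0)} Y (Suc (Suc k)) (r - 1) h"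
    using amp_mult[OF Suc.prems(1) amp_inverse[OF c_pos low q]] by (simp add: h_def[abs_def])
  then obtain h' where h': "\<And>x y. y \<in> Y \<Longrightarrow> (h has_derivative h' (x, y)) (at (x, y))"
    "amp {(j, 0)} Y (Suc k) (r - 1) (\<lambda>z. h' z (j, 0))"
    by (subst (asm) amp.simps) blast
  have j\<beta>: "j # \<beta> \<in> lists Basis" using j Suc.prems by simp
  obtain Q1 where Q1: "dominated Q1" "\<forall>v\<in>schwartz. \<forall>y\<in>Y.
     cmod (osc \<Phi> (\<lambda>z. h' z (j, 0)) (iter_partial \<beta> v) y) \<le> Q1 v * (1 + norm y) powr (r - 1 - real k)"
    using Suc.IH[OF h'(2) Suc.prems(2)] by blast
  obtain Q2 where Q2: "dominated Q2" "\<forall>v\<in>schwartz. \<forall>y\<in>Y.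
     cmod (osc \<Phi> h (iter_partial (j # \<beta>) v) y) \<le> Q2 v * (1 + norm y) powr (r - 1 - real k)"
    using Suc.IH[OF amp_Suc_imp[OF h] j\<beta>] by blast
  show ?case
  proof (intro exI conjI ballI)
    show "dominated (\<lambda>v. Q1 v + Q2 v)" using Q1 Q2 by (intro dominated_add)
    fix v :: "'a \<Rightarrow> complex" and y assume v: "v \<in> schwartz" and y: "y \<in> Y"
    have g: "g (x, y) = ?q (x, y) * h (x, y)" for x
    proof -
      have "0 < c * (1 + norm y)" using c_pos by (simp add: add_pos_nonneg)
      with low[OF y, of x] have "?q (x, y) \<noteq> 0" by (metis norm_zero not_le)
      then show ?thesis by (simp add: h_def)
    qed
    have "osc \<Phi> g (iter_partial \<beta> v) y = osc \<Phi> (\<lambda>z. ?q z * h z) (iter_partial \<beta> v) y"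
      unfolding osc_def g ..
    also have "\<dots> = - (osc \<Phi> (\<lambda>z. h' z (j, 0)) (iter_partial \<beta> v) y + osc \<Phi> h (iter_partial (j # \<beta>) v) y)"
      by (rule osc_parts[OF h v Suc.prems(2) j y h'(1)[OF y] h'(2) q])
    finally have "cmod (osc \<Phi> g (iter_partial \<beta> v) y)
        \<le> cmod (osc \<Phi> (\<lambda>z. h' z (j, 0)) (iter_partial \<beta> v) y) + cmod (osc \<Phi> h (iter_partial (j # \<beta>) v) y)"
      by (simp only: norm_minus_cancel norm_triangle_ineq)
    also have "\<dots> \<le> Q1 v * (1 + norm y) powr (r - 1 - real k) + Q2 v * (1 + norm y) powr (r - 1 - real k)"
      using Q1 Q2 v y by (intro add_mono) auto
    finally show "cmod (osc \<Phi> g (iter_partial \<beta> v) y) \<le> (Q1 v + Q2 v) * (1 + norm y) powr (r - real (Suc k))"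
      by (simp add: algebra_simps)
  qed
qed

text \<open>For |y| \<ge> R the finitely many sets \<open>Y j\<close> cover, and on each of them one
  fixed direction is used for all x; on the remaining bounded region absolute values suffice. The
  direction varies only with the parameter y, so no partition of unity has to be differentiated. The
  sets \<open>Y j\<close> may be arbitrary because \<open>amp\<close> takes derivatives in the whole
  space.\<close>

lemma osc_decay:
  assumes p: "\<And>l. amp Basis UNIV l r p"
  shows "\<exists>Q. dominated Q \<and> (\<forall>v\<in>schwartz. \<forall>y. (1 + norm y) ^ k * cmod (osc \<Phi> p v y) \<le> Q v)"
proof -
  define Y where "Y j = {y. \<forall>x. c * (1 + norm y) \<le> cmod (frechet_derivative \<Phi> (at (x, y)) (j, 0))}" for j
  \<comment> \<open>Enough integrations by parts to cancel the order \<open>r\<close> and still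
    leave decay of order \<open>k\<close>.\<close>
  define m where "m = k + nat \<lceil>r\<rceil>"
  have m: "r - real m \<le> - real k" by (simp add: m_def) linarith
  have "\<exists>Q. dominated Q \<and> (\<forall>v\<in>schwartz. \<forall>y\<in>Y j.
     cmod (osc \<Phi> p (iter_partial [] v) y) \<le> Q v * (1 + norm y) powr (r - real m))" if "j \<in> Basis" for j
  proof (rule osc_decay_direction[OF that])
    show "c * (1 + norm y) \<le> cmod (frechet_derivative \<Phi> (at (x, y)) (j, 0))" if "y \<in> Y j" for x y
      using that by (simp add: Y_def)
    show "amp {(j, 0)} (Y j) (Suc m) r p"
      by (rule amp_subset[OF p]) (use that in \<open>auto simp: Basis_prod_def\<close>)
  qed simp
  then obtain Q where Q: "\<And>j. j \<in> Basis \<Longrightarrow> dominated (Q j)"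
    and Qb: "\<And>j v y. j \<in> Basis \<Longrightarrow> v \<in> schwartz \<Longrightarrow> y \<in> Y j \<Longrightarrow> cmod (osc \<Phi> p v y) \<le> Q j v * (1 + norm y) powr (r - real m)"
    by simp metis
  obtain Q0 where Q0: "dominated Q0" "\<And>v y. v \<in> schwartz \<Longrightarrow> cmod (osc \<Phi> p v y) \<le> Q0 v * (1 + norm y) powr r"
    using osc_trivial_bound[OF p, of "[]"] by auto
  \<comment> \<open>Bounds both weights for \<open>norm y < R\<close>; the absolute value of
    \<open>r\<close> makes the power increasing in its base.\<close>
  define A where "A = (1 + \<bar>R\<bar>) ^ k * (1 + \<bar>R\<bar>) powr \<bar>r\<bar>"
  show ?thesis
  proof (intro exI conjI ballI allI)
    show "dominated (\<lambda>v. A * Q0 v + (\<Sum>j\<in>Basis. Q j v))"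
      using Q Q0 by (intro dominated_add dominated_cmult dominated_sum) (auto simp: A_def)
    fix v :: "'a \<Rightarrow> complex" and y assume v: "v \<in> schwartz"
    have nn: "0 \<le> A * Q0 v" "\<And>j. j \<in> Basis \<Longrightarrow> 0 \<le> Q j v"
      using dominated_nonneg[OF Q0(1) v] dominated_nonneg[OF Q v] by (auto simp: A_def)
    show "(1 + norm y) ^ k * cmod (osc \<Phi> p v y) \<le> A * Q0 v + (\<Sum>j\<in>Basis. Q j v)"
    proof (cases "R \<le> norm y")
      case True
      then obtain j where j: "j \<in> Basis" "y \<in> Y j" using nonstationary[of y] by (auto simp: Y_def)
      have "(1 + norm y) ^ k * cmod (osc \<Phi> p v y) \<le> (1 + norm y) ^ k * (Q j v * (1 + norm y) powr (- real k))"
      proof (intro mult_left_mono order_trans[OF Qb[OF j(1) v j(2)]])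
        show "(1 + norm y) powr (r - real m) \<le> (1 + norm y) powr (- real k)" using m by (intro powr_mono) auto
      qed (use nn j in auto)
      also have "\<dots> = Q j v"
      proof -
        have "0 < 1 + norm y" by (simp add: add_pos_nonneg)
        then show ?thesis by (simp add: powr_minus powr_realpow)
      qed
      also have "\<dots> \<le> (\<Sum>j\<in>Basis. Q j v)" using nn j by (intro member_le_sum) auto
      finally show ?thesis using nn by linarith
    next
      case False
      have "(1 + norm y) ^ k * cmod (osc \<Phi> p v y) \<le> (1 + \<bar>R\<bar>) ^ k * (Q0 v * (1 + \<bar>R\<bar>) powr \<bar>r\<bar>)"
      proof (intro mult_mono power_mono order_trans[OF Q0(2)[OF v]] mult_left_mono)
        have "(1 + norm y) powr r \<le> (1 + norm y) powr \<bar>r\<bar>" by (intro powr_mono) auto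
        also have "\<dots> \<le> (1 + \<bar>R\<bar>) powr \<bar>r\<bar>" using False by (intro powr_mono2) auto
        finally show "(1 + norm y) powr r \<le> (1 + \<bar>R\<bar>) powr \<bar>r\<bar>" .
      qed (use False dominated_nonneg[OF Q0(1) v] in auto)
      also have "\<dots> = A * Q0 v" by (simp add: A_def)
      finally show ?thesis using sum_nonneg[of Basis "\<lambda>j. Q j v"] nn(2) by simp
    qed
  qed
qed

text \<open>Differentiation under the integral. The new amplitude grows polynomially in x, so the
  Schwartz function still supplies an integrable majorant, uniform for y in a unit ball.\<close>

lemma osc_has_derivative:
  assumes p: "\<And>l. amp Basis UNIV l r p" and v: "v \<in> schwartz"
  shows "(osc \<Phi> p v has_derivative (\<lambda>s. LINT x|lborel. exp (\<Phi> (x, y)) *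
      (frechet_derivative \<Phi> (at (x, y)) (0, s) * p (x, y) + frechet_derivative p (at (x, y)) (0, s)) * v x)) (at y)"
proof -
  define w where "w s z = frechet_derivative \<Phi> (at z) (0, s) * p z + frechet_derivative p (at z) (0, s)" for s z
  have dp: "(p has_derivative frechet_derivative p (at z)) (at z)" for z
    using p[of "Suc 0"] unfolding amp_Suc_UNIV frechet_derivative_works by blast
  \<comment> \<open>The exponent dominates both orders \<open>1 + r\<close> and \<open>r\<close>,
    and it is nonnegative, so the weight at a point of the unit ball around y is at most
    \<open>(2 + norm y)\<close> to that power.\<close>
  have wamp: "amp Basis UNIV l (1 + \<bar>r\<bar>) (w e)" if "e \<in> Basis" for e l
  proof -
    have e: "(0, e) \<in> Basis" using that by (auto simp: Basis_prod_def)
    have "amp Basis UNIV l r (\<lambda>z. frechet_derivative p (at z) (0, e))"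
      using p[of "Suc l"] e unfolding amp_Suc_UNIV by blast
    then have "amp Basis UNIV l (1 + \<bar>r\<bar>) (\<lambda>z. frechet_derivative p (at z) (0, e))"
      by (rule amp_mono) (smt (verit))
    moreover have "amp Basis UNIV l (1 + \<bar>r\<bar>) (\<lambda>z. frechet_derivative \<Phi> (at z) (0, e) * p z)"
      by (rule amp_mono[OF amp_mult[OF amp_deriv[OF e] p]]) simp
    ultimately show ?thesis unfolding w_def by (intro amp_add)
  qed
  have lin: "linear (\<lambda>s. w s z)" for z
  proof -
    interpret A: linear "frechet_derivative \<Phi> (at z)" using has_derivative by (rule has_derivative_linear)
    interpret B: linear "frechet_derivative p (at z)" using dp by (rule has_derivative_linear)
    have "frechet_derivative \<Phi> (at z) (0, a + b) = frechet_derivative \<Phi> (at z) (0, a) + frechet_derivative \<Phi> (at z) (0, b)"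
      "frechet_derivative p (at z) (0, a + b) = frechet_derivative p (at z) (0, a) + frechet_derivative p (at z) (0, b)"
      "frechet_derivative \<Phi> (at z) (0, t *\<^sub>R a) = t *\<^sub>R frechet_derivative \<Phi> (at z) (0, a)"
      "frechet_derivative p (at z) (0, t *\<^sub>R a) = t *\<^sub>R frechet_derivative p (at z) (0, a)" for a b :: 'a and t
      using A.add[of "(0, a)" "(0, b)"] B.add[of "(0, a)" "(0, b)"] A.scale[of t "(0, a)"] B.scale[of t "(0, a)"] by simp_all
    then show ?thesis by (intro linearI) (simp_all add: w_def algebra_simps)
  qed
  \<comment> \<open>Amplitude bounds concern basis directions only; linearity in \<open>s\<close>
    carries the bound and the measurability over to every direction.\<close>
  have wexp: "w s z = (\<Sum>e\<in>Basis. (s \<bullet> e) *\<^sub>R w e z)" for s z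
    by (subst euclidean_representation[of s, symmetric])
      (simp add: linear_sum[OF lin] linear_scale[OF lin] del: euclidean_representation)
  have "\<exists>A. 0 \<le> A \<and> (\<forall>x y. cmod (exp (\<Phi> (x, y)) * w e (x, y) * v x) \<le> A * (1 + norm y) powr (1 + \<bar>r\<bar>) / (1 + norm x) ^ (2 * DIM('a)))"
    if e: "e \<in> Basis" for e
  proof -
    obtain Q where Q: "dominated Q" "\<forall>v\<in>schwartz. \<forall>x. \<forall>y\<in>UNIV. cmod (exp (\<Phi> (x, y)) * w e (x, y) * iter_partial [] v x)
        \<le> Q v * (1 + norm y) powr (1 + \<bar>r\<bar>) / (1 + norm x) ^ (2 * DIM('a))"
      using term_bound[OF wamp[OF e] lists.Nil] by blast
    then show ?thesis using v dominated_nonneg[OF Q(1) v] by (intro exI[of _ "Q v"]) simp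
  qed
  then obtain A where A0: "\<And>e. e \<in> Basis \<Longrightarrow> 0 \<le> A e"
    and A: "\<And>e x y. e \<in> Basis \<Longrightarrow> cmod (exp (\<Phi> (x, y)) * w e (x, y) * v x) \<le> A e * (1 + norm y) powr (1 + \<bar>r\<bar>) / (1 + norm x) ^ (2 * DIM('a))"
    by metis
  define A' where "A' = (\<Sum>e\<in>Basis. A e)"
  have A'0: "0 \<le> A'" using A0 by (auto simp: A'_def intro: sum_nonneg)
  have bound: "cmod (exp (\<Phi> (x, y)) * w s (x, y) * v x) \<le> A' * (1 + norm y) powr (1 + \<bar>r\<bar>) / (1 + norm x) ^ (2 * DIM('a)) * norm s" for x y s
  proof -
    have "cmod (exp (\<Phi> (x, y)) * w s (x, y) * v x) = cmod (\<Sum>e\<in>Basis. (s \<bullet> e) *\<^sub>R (exp (\<Phi> (x, y)) * w e (x, y) * v x))"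
      by (subst wexp) (simp add: sum_distrib_left sum_distrib_right)
    also have "\<dots> \<le> (\<Sum>e\<in>Basis. norm s * (A e * (1 + norm y) powr (1 + \<bar>r\<bar>) / (1 + norm x) ^ (2 * DIM('a))))"
    proof (rule sum_norm_le)
      fix e :: 'a assume e: "e \<in> Basis"
      have "\<bar>s \<bullet> e\<bar> * cmod (exp (\<Phi> (x, y)) * w e (x, y) * v x) \<le> norm s * (A e * (1 + norm y) powr (1 + \<bar>r\<bar>) / (1 + norm x) ^ (2 * DIM('a)))"
        using e by (intro mult_mono Basis_le_norm A) auto
      then show "cmod ((s \<bullet> e) *\<^sub>R (exp (\<Phi> (x, y)) * w e (x, y) * v x)) \<le> norm s * (A e * (1 + norm y) powr (1 + \<bar>r\<bar>) / (1 + norm x) ^ (2 * DIM('a)))"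
        by simp
    qed
    also have "\<dots> = A' * (1 + norm y) powr (1 + \<bar>r\<bar>) / (1 + norm x) ^ (2 * DIM('a)) * norm s"
      by (simp add: A'_def sum_distrib_left sum_distrib_right sum_divide_distrib mult_ac)
    finally show ?thesis .
  qed
  have p1: "amp Basis UNIV (Suc 0) r p" by (rule p)
  have "((\<lambda>y. LINT x|lborel. exp (\<Phi> (x, y)) * p (x, y) * v x) has_derivative
      (\<lambda>s. LINT x|lborel. exp (\<Phi> (x, y)) * w s (x, y) * v x)) (at y)"
  proof (rule has_derivative_integral[where g="\<lambda>x. A' * (2 + norm y) powr (1 + \<bar>r\<bar>) * (1 / (1 + norm x) ^ (2 * DIM('a)))"])
    show "integrable lborel (\<lambda>x. exp (\<Phi> (x, y)) * p (x, y) * v x)" for y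
      using term_integrable[OF p1 _ v, of "[]" y] by simp
    show "((\<lambda>y. exp (\<Phi> (x, y)) * p (x, y) * v x) has_derivative (\<lambda>s. exp (\<Phi> (x, y)) * w s (x, y) * v x)) (at y)" for x y
    proof -
      have q: "((\<lambda>y. (x, y)) has_derivative (\<lambda>s. (0, s))) (at y)"
        by (intro has_derivative_Pair has_derivative_ident has_derivative_const)
      have 1: "((\<lambda>y. \<Phi> (x, y)) has_derivative (\<lambda>s. frechet_derivative \<Phi> (at (x, y)) (0, s))) (at y)"
        by (rule has_derivative_compose[OF q has_derivative])
      have 2: "((\<lambda>y. exp (\<Phi> (x, y))) has_derivative (\<lambda>s. exp (\<Phi> (x, y)) * frechet_derivative \<Phi> (at (x, y)) (0, s))) (at y)"
        by (rule has_derivative_compose[OF 1 DERIV_exp[unfolded has_field_derivative_def]])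
      have 3: "((\<lambda>y. p (x, y)) has_derivative (\<lambda>s. frechet_derivative p (at (x, y)) (0, s))) (at y)"
        by (rule has_derivative_compose[OF q dp])
      show ?thesis
        using has_derivative_mult_left[OF has_derivative_mult[OF 2 3], of "v x"]
        by (simp add: w_def algebra_simps)
    qed
    show "(\<lambda>x. exp (\<Phi> (x, y)) * w s (x, y) * v x) \<in> borel_measurable borel" for s
    proof -
      have "(\<lambda>x. exp (\<Phi> (x, y)) * w e (x, y) * v x) \<in> borel_measurable borel" if "e \<in> Basis" for e
        using term_measurable[OF wamp[OF that] _ v, of "[]" y] by simp
      then have "(\<lambda>x. \<Sum>e\<in>Basis. (s \<bullet> e) *\<^sub>R (exp (\<Phi> (x, y)) * w e (x, y) * v x)) \<in> borel_measurable borel"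
        by (intro borel_measurable_sum borel_measurable_scaleR) auto
      then show ?thesis by (subst wexp) (simp add: sum_distrib_left sum_distrib_right)
    qed
    show "cmod (exp (\<Phi> (x, y')) * w s (x, y') * v x) \<le> A' * (2 + norm y) powr (1 + \<bar>r\<bar>) * (1 / (1 + norm x) ^ (2 * DIM('a))) * norm s"
      if y': "y' \<in> ball y 1" for x y' s
    proof -
      have "norm y' \<le> norm y + 1" using y' norm_triangle_ineq2[of y' y] by (simp add: dist_norm norm_minus_commute)
      then have "(1 + norm y') powr (1 + \<bar>r\<bar>) \<le> (2 + norm y) powr (1 + \<bar>r\<bar>)" by (intro powr_mono2) auto
      then have "A' * (1 + norm y') powr (1 + \<bar>r\<bar>) * (1 / (1 + norm x) ^ (2 * DIM('a))) * norm s
         \<le> A' * (2 + norm y) powr (1 + \<bar>r\<bar>) * (1 / (1 + norm x) ^ (2 * DIM('a))) * norm s"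
        using A'0 by (intro mult_right_mono mult_left_mono) auto
      then show ?thesis using bound[of x y' s] by simp
    qed
    show "integrable lborel (\<lambda>x::'a. A' * (2 + norm y) powr (1 + \<bar>r\<bar>) * (1 / (1 + norm x) ^ (2 * DIM('a))))"
      by (intro integrable_mult_right integrable_decay)
  qed
  then show ?thesis by (simp add: osc_def[abs_def] w_def)
qed

text \<open>Every derivative of an image is again an oscillatory integral of the same
  \<open>v\<close>, with an amplitude chosen independently of \<open>v\<close> and of order one
  higher per derivative. Smoothness and all seminorm bounds of the image thus reduce to statements
  about \<open>osc \<Phi> p v\<close>.\<close>

lemma iter_partial_osc:
  assumes "es \<in> lists Basis"
  shows "\<exists>p r. (\<forall>l. amp Basis UNIV l r p) \<and> (\<forall>v\<in>schwartz. iter_partial es (osc \<Phi> (\<lambda>_. 1) v) = osc \<Phi> p v)"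
  using assms
proof (induction es)
  case Nil
  show ?case by (intro exI[of _ "\<lambda>_. 1"] exI[of _ 0]) (simp add: amp_const)
next
  case (Cons e es)
  then obtain p r where p: "\<And>l. amp Basis UNIV l r p" "\<forall>v\<in>schwartz. iter_partial es (osc \<Phi> (\<lambda>_. 1) v) = osc \<Phi> p v"
    by blast
  let ?w = "\<lambda>z. frechet_derivative \<Phi> (at z) (0, e) * p z + frechet_derivative p (at z) (0, e)"
  have e: "(0, e) \<in> Basis" using Cons by (auto simp: Basis_prod_def)
  have "amp Basis UNIV l (1 + r) ?w" for l
    using amp_mult[OF amp_deriv[OF e] p(1)] p(1)[of "Suc l"] e unfolding amp_Suc_UNIV
    by (intro amp_add) (auto intro: amp_mono)
  moreover have "\<forall>v\<in>schwartz. iter_partial (e # es) (osc \<Phi> (\<lambda>_. 1) v) = osc \<Phi> ?w v"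
  proof
    fix v :: "'a \<Rightarrow> complex" assume v: "v \<in> schwartz"
    have "iter_partial (e # es) (osc \<Phi> (\<lambda>_. 1) v) = (\<lambda>y. frechet_derivative (osc \<Phi> p v) (at y) e)"
      using p(2) v by simp
    also have "\<dots> = osc \<Phi> ?w v"
      unfolding frechet_derivative_at[OF osc_has_derivative[OF p(1) v], symmetric] by (simp add: osc_def[abs_def])
    finally show "iter_partial (e # es) (osc \<Phi> (\<lambda>_. 1) v) = osc \<Phi> ?w v" .
  qed
  ultimately show ?case by blast
qed

definition T :: "('a \<Rightarrow> complex) \<Rightarrow> 'a \<Rightarrow> complex" where
  "T v y = (LINT x|lborel. exp (\<Phi> (x, y)) * v x)"

lemma T_eq_osc: "T = osc \<Phi> (\<lambda>_. 1)"
  by (simp add: T_def osc_def fun_eq_iff)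

lemma T_integrable: "v \<in> schwartz \<Longrightarrow> integrable lborel (\<lambda>x. exp (\<Phi> (x, y)) * v x)"
  using term_integrable[OF amp_const[of Basis UNIV "Suc 0" 1], of "[]" v y] by simp

lemma T_lincomb:
  assumes "u \<in> schwartz" "v \<in> schwartz"
  shows "T (\<lambda>x. s * u x + t * v x) = (\<lambda>y. s * T u y + t * T v y)"
proof
  fix y
  have "(\<lambda>x. exp (\<Phi> (x, y)) * (s * u x + t * v x)) = (\<lambda>x. s * (exp (\<Phi> (x, y)) * u x) + t * (exp (\<Phi> (x, y)) * v x))"
    by (simp add: algebra_simps)
  then show "T (\<lambda>x. s * u x + t * v x) y = s * T u y + t * T v y"
    unfolding T_def using T_integrable[OF assms(1), of y] T_integrable[OF assms(2), of y] by simp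
qed

lemma T_bound:
  assumes "\<beta> \<in> lists Basis"
  shows "\<exists>Q. dominated Q \<and> (\<forall>v\<in>schwartz. \<forall>y. (1 + norm y) ^ k * cmod (iter_partial \<beta> (T v) y) \<le> Q v)"
proof -
  obtain p r where p: "\<And>l. amp Basis UNIV l r p" "\<forall>v\<in>schwartz. iter_partial \<beta> (T v) = osc \<Phi> p v"
    using iter_partial_osc[OF assms] by (auto simp: T_eq_osc)
  then show ?thesis using osc_decay[OF p(1), of k] by simp
qed

lemma T_schwartz: 
  assumes v: "v \<in> schwartz"
  shows "T v \<in> schwartz"
proof (rule schwartz_memI)
  show "T v \<in> C_infinity" unfolding C_infinity_def mem_Collect_eq
  proof
    fix es :: "'a list" assume "es \<in> lists Basis"
    then obtain p r where p: "\<And>l. amp Basis UNIV l r p" "\<forall>v\<in>schwartz. iter_partial es (T v) = osc \<Phi> p v"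
      unfolding T_eq_osc using iter_partial_osc by blast
    then show "iter_partial es (T v) differentiable_on UNIV"
      using v osc_has_derivative[OF p(1) v] by (auto simp: differentiable_on_def intro: differentiableI)
  qed
qed (use T_bound v in meson)

lemma dominated_T:
  assumes "i \<in> UNIV \<times> lists Basis"
  shows "dominated (\<lambda>v. schwartz_seminorm i (T v))"
proof -
  obtain k \<beta> where i: "i = (k, \<beta>)" "\<beta> \<in> lists Basis" using assms by auto
  obtain Q where Q: "dominated Q" "\<forall>v\<in>schwartz. \<forall>y. (1 + norm y) ^ k * cmod (iter_partial \<beta> (T v) y) \<le> Q v"
    using T_bound[OF i(2)] by blast
  show ?thesis
    using Q(2) assms by (intro dominated_mono[OF Q(1)])
      (simp_all add: i T_schwartz schwartz_seminorm_nonneg schwartz_seminorm_le)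
qed

end

section \<open>Duality\<close>

lemma schwartz_diff: "f \<in> schwartz \<Longrightarrow> g \<in> schwartz \<Longrightarrow> f - g \<in> schwartz"
  using schwartz_lincomb[of f g 1 "-1"] by (simp add: fun_diff_def)

lemma schwartz_seminorm_diff_self:
  assumes "f \<in> schwartz" "i \<in> UNIV \<times> lists Basis"
  shows "schwartz_seminorm i (f - f) \<le> 0"
  using schwartz_seminorm_lincomb[OF assms(1,1,2), of 0 0] by (simp add: fun_diff_def)

lemma schwartz_seminorm_triangle:
  assumes "f \<in> schwartz" "g \<in> schwartz" "h \<in> schwartz" "i \<in> UNIV \<times> lists Basis"
  shows "schwartz_seminorm i (h - f) \<le> schwartz_seminorm i (h - g) + schwartz_seminorm i (g - f)"
  using schwartz_seminorm_lincomb[OF schwartz_diff[OF assms(3,2)] schwartz_diff[OF assms(2,1)] assms(4), of 1 1]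
  by (simp add: fun_diff_def)

lemma schwartz_seminorm_index_nonempty: "UNIV \<times> lists (Basis :: 'a::euclidean_space set) \<noteq> ({} :: (nat \<times> 'a list) set)"
  using lists.Nil[of "Basis :: 'a set"] by blast

text \<open>Continuity is recorded as seminorm estimates. In this form it composes, implies
  topological continuity, and shows that bounded sets have bounded images, as the strong dual
  requires.\<close>

definition schwartz_linear :: "(('a::euclidean_space \<Rightarrow> complex) \<Rightarrow> 'a \<Rightarrow> complex) \<Rightarrow> bool" where
  "schwartz_linear G \<longleftrightarrow> G \<in> schwartz \<rightarrow> schwartz \<and>
     (\<forall>u\<in>schwartz. \<forall>v\<in>schwartz. \<forall>s t. G (\<lambda>x. s * u x + t * v x) = (\<lambda>x. s * G u x + t * G v x)) \<and>
     (\<forall>i\<in>UNIV \<times> lists Basis. dominated (\<lambda>v. schwartz_seminorm i (G v)))"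

lemma (in phase) schwartz_linear_T: "schwartz_linear T"
  unfolding schwartz_linear_def using T_schwartz T_lincomb dominated_T by blast

lemma dominated_compose:
  assumes "dominated Q" "schwartz_linear H"
  shows "dominated (\<lambda>v. Q (H v))"
proof -
  obtain C F where 1: "0 \<le> C" "finite F" "F \<subseteq> UNIV \<times> lists Basis"
    "\<And>v. v \<in> schwartz \<Longrightarrow> 0 \<le> Q v \<and> Q v \<le> C * (\<Sum>i\<in>F. schwartz_seminorm i v)"
    using assms(1) by (rule dominatedE) (rule that)
  have H: "H v \<in> schwartz" if "v \<in> schwartz" for v using assms(2) that by (auto simp: schwartz_linear_def)
  have "dominated (\<lambda>v. C * (\<Sum>i\<in>F. schwartz_seminorm i (H v)))"
    using assms(2) 1(1-3) unfolding schwartz_linear_def by (intro dominated_cmult dominated_sum) blast+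
  then show ?thesis by (rule dominated_mono) (use 1(4)[OF H] in auto)
qed

lemma schwartz_linear_compose:
  assumes G: "schwartz_linear G" and H: "schwartz_linear H"
  shows "schwartz_linear (\<lambda>v. G (H v))"
  unfolding schwartz_linear_def
proof (intro conjI ballI allI)
  show "(\<lambda>v. G (H v)) \<in> schwartz \<rightarrow> schwartz" using G H by (auto simp: schwartz_linear_def)
  show "dominated (\<lambda>v. schwartz_seminorm i (G (H v)))" if "i \<in> UNIV \<times> lists Basis" for i
    using dominated_compose[OF _ H, of "\<lambda>v. schwartz_seminorm i (G v)"] that G unfolding schwartz_linear_def by blast
  show "G (H (\<lambda>x. s * u x + t * v x)) = (\<lambda>x. s * G (H u) x + t * G (H v) x)"
    if "u \<in> schwartz" "v \<in> schwartz" for u v s t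
  proof -
    have "H u \<in> schwartz" "H v \<in> schwartz" using that H by (auto simp: schwartz_linear_def)
    moreover have "H (\<lambda>x. s * u x + t * v x) = (\<lambda>x. s * H u x + t * H v x)" using that H unfolding schwartz_linear_def by blast
    ultimately show ?thesis using G unfolding schwartz_linear_def by simp
  qed
qed

lemma schwartz_linear_cmult: "schwartz_linear (\<lambda>u x. k * u x)"
  unfolding schwartz_linear_def
proof (intro conjI ballI allI)
  show "(\<lambda>u x. k * u x) \<in> schwartz \<rightarrow> schwartz" using schwartz_lincomb[of _ _ k 0] by auto
  show "dominated (\<lambda>v. schwartz_seminorm i (\<lambda>x. k * v x))" if i: "i \<in> UNIV \<times> lists (Basis :: 'a set)" for i :: "nat \<times> 'a list"
  proof (rule dominated_mono[OF dominated_cmult[OF dominated_seminorm[OF i], of "cmod k"]])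
    fix v :: "'a \<Rightarrow> complex" assume v: "v \<in> schwartz"
    show "0 \<le> schwartz_seminorm i (\<lambda>x. k * v x)"
      using schwartz_lincomb[OF v v, of k 0] i by (intro schwartz_seminorm_nonneg) auto
    show "schwartz_seminorm i (\<lambda>x. k * v x) \<le> cmod k * schwartz_seminorm i v"
      using schwartz_seminorm_lincomb[OF v v i, of k 0] by simp
  qed simp
qed (simp add: algebra_simps)

lemma schwartz_linear_diff:
  assumes "schwartz_linear G" "f \<in> schwartz" "g \<in> schwartz"
  shows "G g - G f = G (g - f)"
proof -
  have "G (\<lambda>x. 1 * g x + (-1) * f x) = (\<lambda>x. 1 * G g x + (-1) * G f x)"
    using assms unfolding schwartz_linear_def by blast
  then show ?thesis by (simp add: fun_diff_def)
qed

lemma schwartz_linear_continuous: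
  assumes G: "schwartz_linear G"
  shows "continuous_map schwartz_topology schwartz_topology G"
  unfolding schwartz_topology_def
proof (rule continuous_map_seminorm_topologyI)
  show "G \<in> schwartz \<rightarrow> schwartz" using G by (simp add: schwartz_linear_def)
  fix j :: "nat \<times> 'a list" assume "j \<in> UNIV \<times> lists (Basis :: 'a set)"
  then have "dominated (\<lambda>v. schwartz_seminorm j (G v))" using G unfolding schwartz_linear_def by blast
  then obtain C F where C: "finite F" "F \<subseteq> UNIV \<times> lists Basis"
    "\<And>v. v \<in> schwartz \<Longrightarrow> 0 \<le> schwartz_seminorm j (G v) \<and> schwartz_seminorm j (G v) \<le> C * (\<Sum>i\<in>F. schwartz_seminorm i v)"
    by (rule dominatedE) (rule that)
  show "\<exists>F C. finite F \<and> F \<subseteq> UNIV \<times> lists Basis \<and> (\<forall>f\<in>schwartz. \<forall>g\<in>schwartz.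
      schwartz_seminorm j (G g - G f) \<le> C * (\<Sum>i\<in>F. schwartz_seminorm i (g - f)))"
  proof (intro exI conjI ballI)
    fix f g :: "'a \<Rightarrow> complex" assume "f \<in> schwartz" "g \<in> schwartz"
    then show "schwartz_seminorm j (G g - G f) \<le> C * (\<Sum>i\<in>F. schwartz_seminorm i (g - f))"
      using C(3)[OF schwartz_diff] by (simp add: schwartz_linear_diff[OF G])
  qed (use C in auto)
  show "0 \<le> schwartz_seminorm i (g - f)"
    if "i \<in> UNIV \<times> lists Basis" "f \<in> schwartz" "g \<in> schwartz" for i and f g :: "'a \<Rightarrow> complex"
    using that by (intro schwartz_seminorm_nonneg schwartz_diff)
qed (rule schwartz_seminorm_diff_self schwartz_seminorm_triangle schwartz_seminorm_index_nonempty; assumption)+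

text \<open>Continuity at 0 puts a seminorm neighbourhood of radius \<delta> inside |T| < 1; then
  rescale \<phi> by \<delta> / (S + 1), where S is the sum of its relevant seminorms. The summand 1
  covers S = 0.\<close>

lemma tempered_distribution_bound:
  assumes T: "T \<in> tempered_distributions"
  shows "\<exists>C F. 0 \<le> C \<and> finite F \<and> F \<subseteq> UNIV \<times> lists Basis \<and>
    (\<forall>\<phi>\<in>schwartz. cmod (T \<phi>) \<le> C * (1 + (\<Sum>i\<in>F. schwartz_seminorm i \<phi>)))"
proof -
  have hom: "\<And>s \<phi>. \<phi> \<in> schwartz \<Longrightarrow> T (\<lambda>x. s * \<phi> x) = s * T \<phi>"
    and cont: "continuous_map schwartz_topology euclidean T"
    using T by (auto simp: tempered_distributions_def)
  let ?z = "\<lambda>_ :: 'a. 0 :: complex"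
  have "T ?z = 0" using hom[OF zero_in_schwartz, of 0] by simp
  then have z: "?z \<in> {\<phi> \<in> schwartz. T \<phi> \<in> ball 0 1}" using zero_in_schwartz by simp
  have "openin schwartz_topology {\<phi> \<in> topspace schwartz_topology. T \<phi> \<in> ball 0 1}"
    using cont by (rule openin_continuous_map_preimage) simp
  then have U: "openin (seminorm_topology schwartz (UNIV \<times> lists Basis) schwartz_seminorm) {\<phi> \<in> schwartz. T \<phi> \<in> ball 0 1}"
    unfolding topspace_schwartz_topology unfolding schwartz_topology_def .
  have "\<exists>F \<delta>. finite F \<and> F \<subseteq> UNIV \<times> lists Basis \<and> 0 < \<delta> \<and>
      {g \<in> schwartz. \<forall>i\<in>F. schwartz_seminorm i (g - ?z) < \<delta>} \<subseteq> {\<phi> \<in> schwartz. T \<phi> \<in> ball 0 1}"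
    by (rule seminorm_topology_nhd[OF _ U z]) (rule schwartz_seminorm_triangle)
  then obtain F \<delta> where F: "finite F" "F \<subseteq> UNIV \<times> lists Basis" "0 < \<delta>"
    "{g \<in> schwartz. \<forall>i\<in>F. schwartz_seminorm i (g - ?z) < \<delta>} \<subseteq> {\<phi> \<in> schwartz. T \<phi> \<in> ball 0 1}"
    by blast
  have "cmod (T \<phi>) \<le> (1 / \<delta>) * (1 + (\<Sum>i\<in>F. schwartz_seminorm i \<phi>))" if \<phi>: "\<phi> \<in> schwartz" for \<phi>
  proof -
    define S where "S = (\<Sum>i\<in>F. schwartz_seminorm i \<phi>)"
    have nn: "0 \<le> schwartz_seminorm i \<phi>" if "i \<in> F" for i using F \<phi> that by (intro schwartz_seminorm_nonneg) auto
    have S: "0 \<le> S" unfolding S_def using nn by (rule sum_nonneg)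
    define t where "t = \<delta> / (S + 1)"
    have t: "0 < t" using S F by (simp add: t_def)
    have g: "(\<lambda>x. complex_of_real t * \<phi> x) \<in> schwartz" using schwartz_lincomb[OF \<phi> \<phi>, of "of_real t" 0] by simp
    have "schwartz_seminorm i ((\<lambda>x. complex_of_real t * \<phi> x) - ?z) < \<delta>" if i: "i \<in> F" for i
    proof -
      have "schwartz_seminorm i ((\<lambda>x. complex_of_real t * \<phi> x) - ?z) \<le> t * schwartz_seminorm i \<phi>"
        using schwartz_seminorm_lincomb[OF \<phi> \<phi>, of i "of_real t" 0] t i F(2) by (auto simp: fun_diff_def)
      also have "\<dots> \<le> t * S" unfolding S_def using t nn i F(1) by (intro mult_left_mono member_le_sum) auto
      also have "\<dots> < \<delta>" using S F by (simp add: t_def field_simps)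
      finally show ?thesis .
    qed
    then have "cmod (T (\<lambda>x. complex_of_real t * \<phi> x)) < 1" using F(4) g by auto
    then have "t * cmod (T \<phi>) < 1" using t by (simp add: hom[OF \<phi>] norm_mult)
    then show ?thesis using S F(3) by (simp add: t_def S_def[symmetric] field_simps)
  qed
  then show ?thesis using F by (intro exI[of _ "1 / \<delta>"] exI[of _ F]) auto
qed

lemma schwartz_bounded_sum:
  assumes B: "schwartz_bounded B" and "finite F" "F \<subseteq> UNIV \<times> lists Basis"
  shows "\<exists>M. \<forall>\<phi>\<in>B. (\<Sum>i\<in>F. schwartz_seminorm i \<phi>) \<le> M"
proof -
  have "\<forall>i\<in>F. \<exists>m. \<forall>\<phi>\<in>B. schwartz_seminorm i \<phi> \<le> m"
    using B assms(3) unfolding schwartz_bounded_def bdd_above_def by fast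
  then obtain m where "\<And>i \<phi>. i \<in> F \<Longrightarrow> \<phi> \<in> B \<Longrightarrow> schwartz_seminorm i \<phi> \<le> m i" by metis
  then show ?thesis by (intro exI[of _ "\<Sum>i\<in>F. m i"]) (auto intro: sum_mono)
qed

text \<open>Makes the suprema in the strong dual topology genuine: on the reals, \<open>SUP\<close>
  of an unbounded set carries no information.\<close>

lemma tempered_distribution_bounded_on:
  assumes T: "T \<in> tempered_distributions" and B: "schwartz_bounded B"
  shows "\<exists>M. \<forall>\<phi>\<in>B. cmod (T \<phi>) \<le> M"
proof -
  obtain C F where C: "0 \<le> C" "finite F" "F \<subseteq> UNIV \<times> lists Basis"
    "\<And>\<phi>. \<phi> \<in> schwartz \<Longrightarrow> cmod (T \<phi>) \<le> C * (1 + (\<Sum>i\<in>F. schwartz_seminorm i \<phi>))"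
    using tempered_distribution_bound[OF T] by meson
  obtain M where M: "\<And>\<phi>. \<phi> \<in> B \<Longrightarrow> (\<Sum>i\<in>F. schwartz_seminorm i \<phi>) \<le> M"
    using schwartz_bounded_sum[OF B C(2,3)] by blast
  have "cmod (T \<phi>) \<le> C * (1 + M)" if "\<phi> \<in> B" for \<phi>
    using that B M[OF that] C(1)
    by (intro order_trans[OF C(4)] mult_left_mono) (auto simp: schwartz_bounded_def)
  then show ?thesis by blast
qed

lemma schwartz_bounded_image:
  assumes G: "schwartz_linear G" and B: "schwartz_bounded B"
  shows "schwartz_bounded (G ` B)"
  unfolding schwartz_bounded_def
proof (intro conjI ballI)
  show "G ` B \<subseteq> schwartz" using G B by (auto simp: schwartz_bounded_def schwartz_linear_def)
  fix j :: "nat \<times> 'a list" assume "j \<in> UNIV \<times> lists (Basis :: 'a set)"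
  then have "dominated (\<lambda>v. schwartz_seminorm j (G v))" using G unfolding schwartz_linear_def by blast
  then obtain C F where C: "0 \<le> C" "finite F" "F \<subseteq> UNIV \<times> lists Basis"
    "\<And>v. v \<in> schwartz \<Longrightarrow> 0 \<le> schwartz_seminorm j (G v) \<and> schwartz_seminorm j (G v) \<le> C * (\<Sum>i\<in>F. schwartz_seminorm i v)"
    by (rule dominatedE) (rule that)
  obtain M where M: "\<And>\<phi>. \<phi> \<in> B \<Longrightarrow> (\<Sum>i\<in>F. schwartz_seminorm i \<phi>) \<le> M"
    using schwartz_bounded_sum[OF B C(2,3)] by blast
  show "bdd_above (schwartz_seminorm j ` G ` B)"
  proof (rule bdd_aboveI)
    fix y assume "y \<in> schwartz_seminorm j ` G ` B"
    then obtain \<phi> where \<phi>: "\<phi> \<in> B" "y = schwartz_seminorm j (G \<phi>)" by blast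
    then have "y \<le> C * (\<Sum>i\<in>F. schwartz_seminorm i \<phi>)" using C(4) B by (auto simp: schwartz_bounded_def)
    also have "\<dots> \<le> C * M" using C(1) M \<phi> by (intro mult_left_mono) auto
    finally show "y \<le> C * M" .
  qed
qed

lemma dual_action_tempered:
  assumes G: "schwartz_linear G" and T: "T \<in> tempered_distributions"
  shows "dual_action G T \<in> tempered_distributions"
  unfolding tempered_distributions_def mem_Collect_eq
proof (intro conjI ballI allI)
  have Gs: "G \<phi> \<in> schwartz" if "\<phi> \<in> schwartz" for \<phi> using G that by (auto simp: schwartz_linear_def)
  have lin: "G (\<lambda>x. s * u x + t * v x) = (\<lambda>x. s * G u x + t * G v x)" if "u \<in> schwartz" "v \<in> schwartz" for u v s t
    using G that unfolding schwartz_linear_def by blast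
  show "dual_action G T \<in> extensional schwartz" by (simp add: dual_action_def)
  show "dual_action G T (\<lambda>x. \<phi> x + \<psi> x) = dual_action G T \<phi> + dual_action G T \<psi>"
    if "\<phi> \<in> schwartz" "\<psi> \<in> schwartz" for \<phi> \<psi>
    using that lin[OF that, of 1 1] Gs[OF that(1)] Gs[OF that(2)] T schwartz_lincomb[OF that, of 1 1]
    by (simp add: dual_action_def tempered_distributions_def)
  show "dual_action G T (\<lambda>x. s * \<phi> x) = s * dual_action G T \<phi>" if "\<phi> \<in> schwartz" for s \<phi>
    using that lin[OF that that, of s 0] Gs[OF that] T schwartz_lincomb[OF that that, of s 0]
    by (simp add: dual_action_def tempered_distributions_def)
  have "continuous_map schwartz_topology euclidean (T \<circ> G)"
    using T by (intro continuous_map_compose[OF schwartz_linear_continuous[OF G]]) (auto simp: tempered_distributions_def)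
  then show "continuous_map schwartz_topology euclidean (dual_action G T)"
    by (rule continuous_map_eq) (simp add: dual_action_def topspace_schwartz_topology)
qed

text \<open>The seminorm of the image at \<phi> is the seminorm of the argument at
  \<open>G \<phi>\<close>: one seminorm with constant 1.\<close>

lemma dual_action_continuous_weak:
  assumes G: "schwartz_linear G"
  shows "continuous_map weak_dual_topology weak_dual_topology (dual_action G)"
  unfolding weak_dual_topology_def
proof (rule continuous_map_seminorm_topologyI)
  show "dual_action G \<in> tempered_distributions \<rightarrow> tempered_distributions"
    using dual_action_tempered[OF G] by blast
  show "schwartz \<noteq> ({} :: ('a \<Rightarrow> complex) set)" "schwartz \<noteq> ({} :: ('a \<Rightarrow> complex) set)"
    using zero_in_schwartz by blast+
  show "\<exists>F C. finite F \<and> F \<subseteq> schwartz \<and> (\<forall>f\<in>tempered_distributions. \<forall>g\<in>tempered_distributions.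
     cmod ((dual_action G g - dual_action G f) \<phi>) \<le> C * (\<Sum>\<phi>\<in>F. cmod ((g - f) \<phi>)))" if "\<phi> \<in> schwartz" for \<phi>
    using that G by (intro exI[of _ "{G \<phi>}"] exI[of _ 1]) (auto simp: dual_action_def schwartz_linear_def)
  show "cmod ((h - f) \<phi>) \<le> cmod ((h - g) \<phi>) + cmod ((g - f) \<phi>)" for f g h :: "('a \<Rightarrow> complex) \<Rightarrow> complex" and \<phi>
    using norm_triangle_ineq[of "(h - g) \<phi>" "(g - f) \<phi>"] by simp
qed auto

lemma dual_action_continuous_strong:
  assumes G: "schwartz_linear G"
  shows "continuous_map strong_dual_topology strong_dual_topology (dual_action G)"
  unfolding strong_dual_topology_def
proof (rule continuous_map_seminorm_topologyI)
  let ?I = "{B. B \<noteq> {} \<and> schwartz_bounded B} :: ('a \<Rightarrow> complex) set set"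
  have bdd: "bdd_above ((\<lambda>\<phi>. cmod ((g - f) \<phi>)) ` B)"
    if fg: "f \<in> tempered_distributions" "g \<in> tempered_distributions" and B: "B \<in> ?I" for f g B
  proof -
    obtain M where M: "\<And>\<phi>. \<phi> \<in> B \<Longrightarrow> cmod (f \<phi>) \<le> M" using tempered_distribution_bounded_on[OF fg(1)] B by blast
    obtain M' where M': "\<And>\<phi>. \<phi> \<in> B \<Longrightarrow> cmod (g \<phi>) \<le> M'" using tempered_distribution_bounded_on[OF fg(2)] B by blast
    show ?thesis
    proof (rule bdd_aboveI2)
      fix \<phi> assume "\<phi> \<in> B"
      then show "cmod ((g - f) \<phi>) \<le> M' + M"
        using M M' norm_triangle_ineq4[of "g \<phi>" "f \<phi>"] by fastforce
    qed
  qed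
  show "dual_action G \<in> tempered_distributions \<rightarrow> tempered_distributions"
    using dual_action_tempered[OF G] by blast
  have "schwartz_bounded {\<lambda>_::'a. 0}" by (simp add: schwartz_bounded_def zero_in_schwartz)
  then show "?I \<noteq> {}" "?I \<noteq> {}" by blast+
  show "(SUP \<phi>\<in>B. cmod ((f - f) \<phi>)) \<le> 0" "(SUP \<phi>\<in>B. cmod ((f - f) \<phi>)) \<le> 0" if "B \<in> ?I" for B and f :: "('a \<Rightarrow> complex) \<Rightarrow> complex"
    using that by (auto intro!: cSUP_least)
  show "0 \<le> (SUP \<phi>\<in>B. cmod ((g - f) \<phi>))"
    if B: "B \<in> ?I" "f \<in> tempered_distributions" "g \<in> tempered_distributions" for B f g
  proof -
    obtain \<phi> where "\<phi> \<in> B" using B by blast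
    from cSUP_upper[OF this bdd[OF B(2,3,1)]] show ?thesis using norm_ge_zero order_trans by blast
  qed
  show "(SUP \<phi>\<in>B. cmod ((h - f) \<phi>)) \<le> (SUP \<phi>\<in>B. cmod ((h - g) \<phi>)) + (SUP \<phi>\<in>B. cmod ((g - f) \<phi>))"
    if B: "B \<in> ?I" "f \<in> tempered_distributions" "g \<in> tempered_distributions" "h \<in> tempered_distributions" for B f g h
  proof (rule cSUP_least)
    fix \<phi> assume \<phi>: "\<phi> \<in> B"
    have "cmod ((h - f) \<phi>) \<le> cmod ((h - g) \<phi>) + cmod ((g - f) \<phi>)"
      using norm_triangle_ineq[of "(h - g) \<phi>" "(g - f) \<phi>"] by simp
    also have "\<dots> \<le> (SUP \<phi>\<in>B. cmod ((h - g) \<phi>)) + (SUP \<phi>\<in>B. cmod ((g - f) \<phi>))"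
      using B by (intro add_mono cSUP_upper[OF \<phi>] bdd) auto
    finally show "cmod ((h - f) \<phi>) \<le> (SUP \<phi>\<in>B. cmod ((h - g) \<phi>)) + (SUP \<phi>\<in>B. cmod ((g - f) \<phi>))" .
  qed (use B in auto)
  show "\<exists>F C. finite F \<and> F \<subseteq> ?I \<and> (\<forall>f\<in>tempered_distributions. \<forall>g\<in>tempered_distributions.
     (SUP \<phi>\<in>B. cmod ((dual_action G g - dual_action G f) \<phi>)) \<le> C * (\<Sum>B\<in>F. SUP \<phi>\<in>B. cmod ((g - f) \<phi>)))" if B: "B \<in> ?I" for B
  proof (intro exI conjI ballI)
    show "finite {G ` B}" by simp
    show "{G ` B} \<subseteq> ?I" using B schwartz_bounded_image[OF G] by auto
    fix f g :: "('a \<Rightarrow> complex) \<Rightarrow> complex"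
    have "cmod ((dual_action G g - dual_action G f) \<phi>) = cmod ((g - f) (G \<phi>))" if "\<phi> \<in> B" for \<phi>
      using that B by (auto simp: dual_action_def schwartz_bounded_def)
    then have "(SUP \<phi>\<in>B. cmod ((dual_action G g - dual_action G f) \<phi>)) = (SUP \<phi>\<in>G ` B. cmod ((g - f) \<phi>))"
      by (simp add: image_image)
    then show "(SUP \<phi>\<in>B. cmod ((dual_action G g - dual_action G f) \<phi>)) \<le> 1 * (\<Sum>B\<in>{G ` B}. SUP \<phi>\<in>B. cmod ((g - f) \<phi>))"
      by simp
  qed
qed

section \<open>Fubini and the oscillatory integral\<close>

lemma schwartz_continuous_on: "v \<in> schwartz \<Longrightarrow> continuous_on UNIV v"
  by (intro C_infinity_continuous_on schwartz_C_infinity)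

lemma schwartz_measurable: "v \<in> schwartz \<Longrightarrow> v \<in> borel_measurable borel"
  by (intro borel_measurable_continuous_onI schwartz_continuous_on)

lemma schwartz_integrable:
  fixes v :: "'a::euclidean_space \<Rightarrow> complex"
  assumes "v \<in> schwartz"
  shows "integrable lborel v"
  using schwartz_bound'[OF assms, of "[]"] schwartz_measurable[OF assms]
  by (intro integrable_decay_bound[where C="schwartz_seminorm (2 * DIM('a), []) v"]) auto

text \<open>Used for each fixed \<epsilon> to justify Fubini before the limit; the constant
  \<open>1 + 1 / \<epsilon>\<close> may blow up as \<epsilon> tends to 0.\<close>

lemma schwartz_scaled_integrable:
  fixes v :: "'a::euclidean_space \<Rightarrow> complex"
  assumes v: "v \<in> schwartz" and "0 < \<epsilon>"
  shows "integrable lborel (\<lambda>x. v (\<epsilon> *\<^sub>R x))"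
proof (rule integrable_decay_bound)
  let ?K = "2 * DIM('a)" and ?B = "schwartz_seminorm (2 * DIM('a), []) v"
  show "(\<lambda>x. v (\<epsilon> *\<^sub>R x)) \<in> borel_measurable borel"
    using schwartz_measurable[OF v] by measurable
  fix x :: 'a
  have "1 + norm x \<le> (1 + 1 / \<epsilon>) * (1 + norm (\<epsilon> *\<^sub>R x))"
    using \<open>0 < \<epsilon>\<close> by (simp add: field_simps)
  then have "(1 + norm x) ^ ?K \<le> (1 + 1 / \<epsilon>) ^ ?K * (1 + norm (\<epsilon> *\<^sub>R x)) ^ ?K"
    unfolding power_mult_distrib[symmetric] by (intro power_mono) auto
  moreover have "0 < (1 + norm x) ^ ?K" "0 < (1 + norm (\<epsilon> *\<^sub>R x)) ^ ?K" by (simp_all add: add_pos_nonneg)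
  ultimately have "1 / (1 + norm (\<epsilon> *\<^sub>R x)) ^ ?K \<le> (1 + 1 / \<epsilon>) ^ ?K / (1 + norm x) ^ ?K"
    by (simp add: divide_simps mult.commute)
  then have "?B * (1 / (1 + norm (\<epsilon> *\<^sub>R x)) ^ ?K) \<le> ?B * ((1 + 1 / \<epsilon>) ^ ?K / (1 + norm x) ^ ?K)"
    using v by (intro mult_left_mono schwartz_seminorm_nonneg) auto
  moreover have "cmod (v (\<epsilon> *\<^sub>R x)) \<le> ?B / (1 + norm (\<epsilon> *\<^sub>R x)) ^ ?K"
    using schwartz_bound'[OF v lists.Nil, of "\<epsilon> *\<^sub>R x"] by (simp only: iter_partial.simps)
  ultimately show "cmod (v (\<epsilon> *\<^sub>R x)) \<le> ?B * (1 + 1 / \<epsilon>) ^ ?K / (1 + norm x) ^ ?K" by simp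
qed

lemma
  fixes f :: "'a::euclidean_space \<Rightarrow> complex" and g :: "'b::euclidean_space \<Rightarrow> complex"
  assumes f: "integrable lborel f" and g: "integrable lborel g"
  shows integrable_tensor: "integrable lborel (\<lambda>z. f (fst z) * g (snd z))"
    and integral_tensor: "(LINT z|lborel. f (fst z) * g (snd z)) = (LINT x|lborel. f x) * (LINT y|lborel. g y)"
proof -
  have [measurable]: "f \<in> borel_measurable borel" "g \<in> borel_measurable borel"
    using f g by (auto dest: borel_measurable_integrable)
  have I: "integrable (lborel \<Otimes>\<^sub>M lborel) (\<lambda>z. f (fst z) * g (snd z))"
  proof (rule lborel_pair.Fubini_integrable)
    show "integrable lborel (\<lambda>x. LINT y|lborel. norm (f (fst (x, y)) * g (snd (x, y))))"
      using f g by (simp add: norm_mult)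
    show "AE x in lborel. integrable lborel (\<lambda>y. f (fst (x, y)) * g (snd (x, y)))" using g by simp
  qed measurable
  then show "integrable lborel (\<lambda>z. f (fst z) * g (snd z))" by (simp add: lborel_prod)
  have "(LINT z|(lborel \<Otimes>\<^sub>M lborel). f (fst z) * g (snd z)) = (LINT x|lborel. LINT y|lborel. f x * g y)"
    using lborel_pair.integral_fst'[OF I] by simp
  then show "(LINT z|lborel. f (fst z) * g (snd z)) = (LINT x|lborel. f x) * (LINT y|lborel. g y)"
    by (simp add: lborel_prod)
qed

lemma integral_swap_dominated:
  fixes h :: "'a::euclidean_space \<Rightarrow> 'b::euclidean_space \<Rightarrow> complex"
  assumes h: "(\<lambda>z. h (fst z) (snd z)) \<in> borel_measurable borel"
    and f: "integrable lborel f" and g: "integrable lborel g"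
    and bound: "\<And>x y. cmod (h x y) \<le> C * cmod (f x * g y)"
  shows "(LINT x|lborel. LINT y|lborel. h x y) = (LINT y|lborel. LINT x|lborel. h x y)"
proof (rule lborel_pair.Fubini_integral[symmetric])
  have "integrable (lborel :: ('a \<times> 'b) measure) (\<lambda>z. h (fst z) (snd z))"
  proof (rule Bochner_Integration.integrable_bound)
    show "integrable lborel (\<lambda>z. C * norm (f (fst z) * g (snd z)))"
      using integrable_tensor[OF f g] by (intro integrable_mult_right integrable_norm)
    show "AE z in lborel. norm (h (fst z) (snd z)) \<le> norm (C * norm (f (fst z) * g (snd z)))"
      using bound by (intro AE_I2) (auto intro: order_trans[OF _ abs_ge_self])
  qed (use h in simp)
  then show "integrable (lborel \<Otimes>\<^sub>M lborel) (case_prod h)" by (simp add: lborel_prod case_prod_unfold)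
qed

context phase
begin

text \<open>The transpose of \<open>T\<close> is the operator of the swapped phase. Since the
  exponential is bounded by \<open>exp M\<close>, the double integral converges absolutely and
  Fubini applies without a cutoff.\<close>

lemma T_duality:
  assumes P: "phase (\<Phi> \<circ> prod.swap) M' R' c'" and v: "v \<in> schwartz" and w: "w \<in> schwartz"
  shows "(LINT y|lborel. T v y * w y) = (LINT x|lborel. v x * phase.T (\<Phi> \<circ> prod.swap) w x)"
proof -
  interpret P: phase "\<Phi> \<circ> prod.swap" M' R' c' by (rule P)
  have "(LINT y|lborel. T v y * w y) = (LINT y|lborel. LINT x|lborel. exp (\<Phi> (x, y)) * v x * w y)"
    by (simp add: T_def)
  also have "\<dots> = (LINT x|lborel. LINT y|lborel. exp (\<Phi> (x, y)) * v x * w y)"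
  proof (rule integral_swap_dominated[OF _ schwartz_integrable[OF w] schwartz_integrable[OF v], where C="exp M"])
    show "(\<lambda>z. exp (\<Phi> (snd z, fst z)) * v (snd z) * w (fst z)) \<in> borel_measurable borel"
      by (intro borel_measurable_continuous_onI continuous_intros continuous_on_compose2[OF continuous_on[of UNIV]]
        continuous_on_compose2[OF schwartz_continuous_on[OF v]] continuous_on_compose2[OF schwartz_continuous_on[OF w]]) auto
    show "cmod (exp (\<Phi> (x, y)) * v x * w y) \<le> exp M * cmod (w y * v x)" for x y
      using mult_right_mono[OF norm_exp_le[of "(x, y)"], of "cmod (w y * v x)"] by (simp add: norm_mult mult_ac)
  qed
  also have "\<dots> = (LINT x|lborel. LINT y|lborel. v x * (exp (\<Phi> (x, y)) * w y))" by (simp add: mult_ac)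
  also have "\<dots> = (LINT x|lborel. v x * P.T w x)" by (simp add: P.T_def)
  finally show ?thesis .
qed

lemma T_measurable: "v \<in> schwartz \<Longrightarrow> T v \<in> borel_measurable borel"
  by (intro schwartz_measurable T_schwartz)

text \<open>The cutoff makes the triple integral absolutely convergent; after Fubini the inner integral
  factorises into two Schwartz functions of \<open>\<xi>\<close>, and the cutoff is removed by dominated convergence.\<close>

lemma oscillatory_tensor:
  assumes P: "phase \<Phi>' M' R' c'" and v: "v \<in> schwartz" and u: "u \<in> schwartz"
  shows "has_oscillatory_integral (\<lambda>(x', x) \<xi>. k * exp (\<Phi> (x', \<xi>)) * exp (\<Phi>' (x, \<xi>))) (\<lambda>(x', x). v x' * u x)
     (k * (LINT \<xi>|lborel. T v \<xi> * phase.T \<Phi>' u \<xi>))"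
  unfolding has_oscillatory_integral_def
proof (intro ballI impI)
  interpret P: phase \<Phi>' M' R' c' by (rule P)
  fix \<theta> :: "'a \<Rightarrow> complex" assume \<theta>: "\<theta> \<in> schwartz" "\<theta> 0 = 1"
  have eq: "(LINT y|lborel. (LINT \<xi>|lborel. \<theta> (\<epsilon> *\<^sub>R \<xi>) * (case y of (x', x) \<Rightarrow> \<lambda>\<xi>. k * exp (\<Phi> (x', \<xi>)) * exp (\<Phi>' (x, \<xi>))) \<xi>) * (case y of (x', x) \<Rightarrow> v x' * u x))
     = k * (LINT \<xi>|lborel. \<theta> (\<epsilon> *\<^sub>R \<xi>) * (T v \<xi> * P.T u \<xi>))" if \<epsilon>: "0 < \<epsilon>" for \<epsilon>
  proof -
    define h where "h y \<xi> = \<theta> (\<epsilon> *\<^sub>R \<xi>) * ((exp (\<Phi> (fst y, \<xi>)) * v (fst y)) * (exp (\<Phi>' (snd y, \<xi>)) * u (snd y)))" for y \<xi>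
    have "(LINT y|lborel. (LINT \<xi>|lborel. \<theta> (\<epsilon> *\<^sub>R \<xi>) * (case y of (x', x) \<Rightarrow> \<lambda>\<xi>. k * exp (\<Phi> (x', \<xi>)) * exp (\<Phi>' (x, \<xi>))) \<xi>) * (case y of (x', x) \<Rightarrow> v x' * u x))
      = (LINT y|lborel. k * (LINT \<xi>|lborel. h y \<xi>))"
      unfolding integral_mult_left_zero[symmetric] integral_mult_right_zero[symmetric]
      by (intro Bochner_Integration.integral_cong refl) (auto simp: h_def)
    also have "\<dots> = k * (LINT y|lborel. LINT \<xi>|lborel. h y \<xi>)" by simp
    also have "(LINT y|lborel. LINT \<xi>|lborel. h y \<xi>) = (LINT \<xi>|lborel. LINT y|lborel. h y \<xi>)"
    proof (rule integral_swap_dominated[OF _ integrable_tensor[OF schwartz_integrable[OF v] schwartz_integrable[OF u]]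
          schwartz_scaled_integrable[OF \<theta>(1) \<epsilon>], where C="exp M * exp M'"])
      show "(\<lambda>z. h (fst z) (snd z)) \<in> borel_measurable borel"
        unfolding h_def
        by (intro borel_measurable_continuous_onI continuous_intros continuous_on_compose2[OF continuous_on[of UNIV]]
          continuous_on_compose2[OF P.continuous_on[of UNIV]] continuous_on_compose2[OF schwartz_continuous_on[OF v]]
          continuous_on_compose2[OF schwartz_continuous_on[OF u]] continuous_on_compose2[OF schwartz_continuous_on[OF \<theta>(1)]]) auto
      show "cmod (h y \<xi>) \<le> exp M * exp M' * cmod ((v (fst y) * u (snd y)) * \<theta> (\<epsilon> *\<^sub>R \<xi>))" for y \<xi>
      proof -
        have "cmod (exp (\<Phi> (fst y, \<xi>))) * cmod (exp (\<Phi>' (snd y, \<xi>))) \<le> exp M * exp M'"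
          by (intro mult_mono norm_exp_le P.norm_exp_le) auto
        from mult_right_mono[OF this, of "cmod ((v (fst y) * u (snd y)) * \<theta> (\<epsilon> *\<^sub>R \<xi>))"] show ?thesis
          by (simp add: h_def norm_mult mult_ac)
      qed
    qed
    also have "\<dots> = (LINT \<xi>|lborel. \<theta> (\<epsilon> *\<^sub>R \<xi>) * (T v \<xi> * P.T u \<xi>))"
      unfolding h_def T_def P.T_def by (simp add: integral_tensor[OF T_integrable[OF v] P.T_integrable[OF u]])
    finally show ?thesis .
  qed
  obtain B where B: "\<And>x. cmod (\<theta> x) \<le> B" using schwartz_bound[OF \<theta>(1), of "[]" _ 0] by auto
  have TT: "integrable lborel (\<lambda>\<xi>. T v \<xi> * P.T u \<xi>)"
  proof -
    obtain A where A: "\<And>x. cmod (T v x) \<le> A" using schwartz_bound[OF T_schwartz[OF v], of "[]" _ 0] by auto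
    show ?thesis
    proof (rule Bochner_Integration.integrable_bound)
      show "integrable lborel (\<lambda>\<xi>. A * norm (P.T u \<xi>))"
        using schwartz_integrable[OF P.T_schwartz[OF u]] by (intro integrable_mult_right integrable_norm)
      show "AE \<xi> in lborel. cmod (T v \<xi> * P.T u \<xi>) \<le> norm (A * norm (P.T u \<xi>))"
        using A by (intro AE_I2) (auto simp: norm_mult intro!: order_trans[OF mult_right_mono abs_ge_self])
    qed (use T_measurable[OF v] P.T_measurable[OF u] in simp)
  qed
  have "((\<lambda>\<epsilon>. k * (LINT \<xi>|lborel. \<theta> (\<epsilon> *\<^sub>R \<xi>) * (T v \<xi> * P.T u \<xi>))) \<longlongrightarrow> k * (LINT \<xi>|lborel. T v \<xi> * P.T u \<xi>)) (at_right 0)"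
    unfolding tendsto_at_iff_sequentially
  proof (intro allI impI)
    fix X :: "nat \<Rightarrow> real" assume X: "X \<longlonglongrightarrow> 0"
    have "(\<lambda>i. LINT \<xi>|lborel. \<theta> (X i *\<^sub>R \<xi>) * (T v \<xi> * P.T u \<xi>)) \<longlonglongrightarrow> (LINT \<xi>|lborel. T v \<xi> * P.T u \<xi>)"
    \<comment> \<open>Only the supremum of \<theta> enters the majorant, so it is independent of the
      cutoff scale.\<close>
    proof (rule integral_dominated_convergence[where w="\<lambda>\<xi>. B * norm (T v \<xi> * P.T u \<xi>)"])
      show "AE \<xi> in lborel. (\<lambda>i. \<theta> (X i *\<^sub>R \<xi>) * (T v \<xi> * P.T u \<xi>)) \<longlonglongrightarrow> T v \<xi> * P.T u \<xi>"
      proof (rule AE_I2)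
        fix \<xi> :: 'a
        have "isCont \<theta> 0" using schwartz_continuous_on[OF \<theta>(1)] by (simp add: continuous_on_eq_continuous_at)
        moreover have "(\<lambda>i. X i *\<^sub>R \<xi>) \<longlonglongrightarrow> 0" using tendsto_scaleR[OF X tendsto_const[of \<xi>]] by simp
        ultimately have "(\<lambda>i. \<theta> (X i *\<^sub>R \<xi>)) \<longlonglongrightarrow> \<theta> 0" by (rule isCont_tendsto_compose)
        from tendsto_mult_right[OF this, of "T v \<xi> * P.T u \<xi>"]
        show "(\<lambda>i. \<theta> (X i *\<^sub>R \<xi>) * (T v \<xi> * P.T u \<xi>)) \<longlonglongrightarrow> T v \<xi> * P.T u \<xi>" by (simp add: \<theta>(2))
      qed
      show "AE \<xi> in lborel. norm (\<theta> (X i *\<^sub>R \<xi>) * (T v \<xi> * P.T u \<xi>)) \<le> B * norm (T v \<xi> * P.T u \<xi>)" for i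
        using B by (intro AE_I2) (simp add: norm_mult mult_right_mono)
      show "(\<lambda>\<xi>. \<theta> (X i *\<^sub>R \<xi>) * (T v \<xi> * P.T u \<xi>)) \<in> borel_measurable lborel" for i
        using T_measurable[OF v] P.T_measurable[OF u] schwartz_measurable[OF \<theta>(1)] by measurable
    qed (use TT in \<open>auto dest: borel_measurable_integrable\<close>)
    then show "((\<lambda>\<epsilon>. k * (LINT \<xi>|lborel. \<theta> (\<epsilon> *\<^sub>R \<xi>) * (T v \<xi> * P.T u \<xi>))) \<circ> X) \<longlonglongrightarrow> k * (LINT \<xi>|lborel. T v \<xi> * P.T u \<xi>)"
      unfolding comp_def by (intro tendsto_mult tendsto_const)
  qed
  then show "((\<lambda>\<epsilon>. LINT y|lborel. (LINT \<xi>|lborel. \<theta> (\<epsilon> *\<^sub>R \<xi>) * (case y of (x', x) \<Rightarrow> \<lambda>\<xi>. k * exp (\<Phi> (x', \<xi>)) * exp (\<Phi>' (x, \<xi>))) \<xi>) * (case y of (x', x) \<Rightarrow> v x' * u x))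
     \<longlongrightarrow> k * (LINT \<xi>|lborel. T v \<xi> * P.T u \<xi>)) (at_right 0)"
    \<comment> \<open>\<open>eq\<close> holds for positive \<epsilon>, which is all that
      \<open>at_right 0\<close> sees.\<close>
    by (rule Lim_transform_eventually) (use eq in \<open>auto simp: eventually_at_filter\<close>)
qed

end

section \<open>Symbols and the propagator\<close>

text \<open>Both pairings equal \<open>k\<close> times the integral of
  \<open>P.T v * P0.T u\<close>, up to the names of the test functions. \<open>T_duality\<close> for
  the swapped phase produces \<open>G\<close>, \<open>T_duality\<close> for \<open>\<Phi>0\<close>
  produces \<open>Gt\<close>; symmetry of \<open>\<Phi>0\<close> says that the Fourier factor is its
  own transpose.\<close>

lemma thin_slab_operators:
  fixes \<Phi> :: "'a::euclidean_space \<times> 'a \<Rightarrow> complex"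
  assumes P: "phase \<Phi> M R c" and Ps: "phase (\<Phi> \<circ> prod.swap) M' R' c'" and P0: "phase \<Phi>0 M0 R0 c0"
    and sym: "\<Phi>0 \<circ> prod.swap = \<Phi>0"
    and K: "K = has_oscillatory_integral (\<lambda>(x', x) \<xi>. k * exp (\<Phi> (x', \<xi>)) * exp (\<Phi>0 (x, \<xi>)))"
  shows "\<exists>G Gt.
       schwartz_operator_with_kernel K G \<and>
       schwartz_operator_with_kernel (transpose_kernel K) Gt \<and>
       continuous_map schwartz_topology schwartz_topology G \<and>
       continuous_map weak_dual_topology weak_dual_topology (dual_action Gt) \<and>
       continuous_map strong_dual_topology strong_dual_topology (dual_action Gt)"
proof -
  interpret P: phase \<Phi> M R c by (rule P)
  interpret Ps: phase "\<Phi> \<circ> prod.swap" M' R' c' by (rule Ps)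
  interpret P0: phase \<Phi>0 M0 R0 c0 by (rule P0)
  define G where "G u = (\<lambda>x. k * Ps.T (P0.T u) x)" for u
  define Gt where "Gt u = (\<lambda>x. k * P0.T (P.T u) x)" for u
  have G: "schwartz_linear G" unfolding G_def[abs_def]
    by (intro schwartz_linear_compose[OF schwartz_linear_cmult] schwartz_linear_compose[OF Ps.schwartz_linear_T P0.schwartz_linear_T])
  have Gt: "schwartz_linear Gt" unfolding Gt_def[abs_def]
    by (intro schwartz_linear_compose[OF schwartz_linear_cmult] schwartz_linear_compose[OF P0.schwartz_linear_T P.schwartz_linear_T])
  have G_pair: "(LINT x|lborel. G u x * v x) = k * (LINT \<xi>|lborel. P.T v \<xi> * P0.T u \<xi>)"
    if u: "u \<in> schwartz" and v: "v \<in> schwartz" for u v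
  proof -
    have swap: "\<Phi> \<circ> prod.swap \<circ> prod.swap = \<Phi>" by (simp add: fun_eq_iff)
    have "(LINT x|lborel. Ps.T (P0.T u) x * v x) = (LINT \<xi>|lborel. P0.T u \<xi> * P.T v \<xi>)"
      using Ps.T_duality[of M R c "P0.T u" v] P u v P0.T_schwartz unfolding swap by blast
    then show ?thesis by (simp add: G_def mult.assoc mult.commute[of "P.T v _"])
  qed
  have Gt_pair: "(LINT x|lborel. Gt u x * v x) = k * (LINT \<xi>|lborel. P.T u \<xi> * P0.T v \<xi>)"
    if u: "u \<in> schwartz" and v: "v \<in> schwartz" for u v
  proof -
    have "(LINT x|lborel. P0.T (P.T u) x * v x) = (LINT \<xi>|lborel. P.T u \<xi> * P0.T v \<xi>)"
      using P0.T_duality[of M0 R0 c0 "P.T u" v] P0 u v P.T_schwartz unfolding sym by blast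
    then show ?thesis by (simp add: Gt_def mult.assoc)
  qed
  have "schwartz_operator_with_kernel K G"
    unfolding schwartz_operator_with_kernel_def K
    using G P.oscillatory_tensor[OF P0] by (auto simp: schwartz_linear_def G_pair)
  moreover have "schwartz_operator_with_kernel (transpose_kernel K) Gt"
  proof -
    have "K ((\<lambda>(x', x). v x' * u x) \<circ> prod.swap) (LINT x'|lborel. Gt u x' * v x')"
      if "u \<in> schwartz" "v \<in> schwartz" for u v
    proof -
      \<comment> \<open>Transposing the kernel only exchanges the roles of \<open>u\<close> and
        \<open>v\<close> in the pairing.\<close>
      have "(\<lambda>(x', x). v x' * u x) \<circ> prod.swap = (\<lambda>(x', x). u x' * v x)" by (auto simp: fun_eq_iff)
      then show ?thesis using P.oscillatory_tensor[OF P0 that, of k] that by (simp add: Gt_pair K)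
    qed
    then show ?thesis
      using Gt unfolding schwartz_operator_with_kernel_def transpose_kernel_def schwartz_linear_def by blast
  qed
  ultimately show ?thesis
    using schwartz_linear_continuous[OF G] dual_action_continuous_weak[OF Gt] dual_action_continuous_strong[OF Gt]
    by blast
qed

section \<open>Bilinear phases with a perturbation\<close>

lemma norm_le_DIM_component:
  fixes y :: "'a::euclidean_space"
  shows "\<exists>j\<in>Basis. norm y / DIM('a) \<le> \<bar>y \<bullet> j\<bar>"
proof (rule ccontr)
  assume "\<not> ?thesis"
  then have "(\<Sum>j\<in>Basis. \<bar>y \<bullet> j\<bar>) < (\<Sum>j\<in>(Basis :: 'a set). norm y / DIM('a))"
    by (intro sum_strict_mono) (auto simp: not_le)
  then show False using norm_le_l1[of y] by simp
qed

text \<open>The bilinear part contributes \<open>\<sigma> * (y \<bullet> j)\<close> to the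
  derivative in direction \<open>(j, 0)\<close>, whatever x is. Choosing \<open>j\<close> as a
  coordinate in which y is largest up to the factor 1/n, n being the dimension, leaves room for a
  perturbation of size (1 + |y|) / (4 n).\<close>

lemma phase_bilinear_plus:
  fixes f :: "'a::euclidean_space \<times> 'a \<Rightarrow> complex"
  assumes f: "f \<in> C_infinity" and pb: "\<And>es. es \<in> lists Basis \<Longrightarrow> poly_bounded UNIV 1 (iter_partial es f)"
    and re: "\<And>z. Re (f z) \<le> M" and \<sigma>: "\<sigma> = \<i> \<or> \<sigma> = - \<i>" and R: "1 \<le> R"
    and small: "\<And>x y j. R \<le> norm y \<Longrightarrow> j \<in> Basis \<Longrightarrow> cmod (iter_partial [(j, 0)] f (x, y)) \<le> (1 + norm y) / (4 * real DIM('a))"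
  shows "phase (\<lambda>z. \<sigma> * of_real (fst z \<bullet> snd z) + f z) M R (1 / (4 * real DIM('a)))"
proof -
  let ?\<Phi> = "\<lambda>z. \<sigma> * of_real (fst z \<bullet> snd z) + f z"
  have df: "f differentiable (at z)" for z using C_infinity_iter_partial_differentiable[OF f, of "[]"] by simp
  have df': "(f has_derivative frechet_derivative f (at z)) (at z)" for z
    using df[of z] by (simp only: frechet_derivative_works)
  have "(?\<Phi> has_derivative (\<lambda>h. \<sigma> * of_real (fst z \<bullet> snd h + fst h \<bullet> snd z) + frechet_derivative f (at z) h)) (at z)" for z
    by (intro has_derivative_add has_derivative_mult_right has_derivative_of_real has_derivative_inner
      has_derivative_fst has_derivative_snd has_derivative_ident df')
  note d = this
  note fd = frechet_derivative_at[OF d, symmetric]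
  show ?thesis
  proof
    show "Re (?\<Phi> z) \<le> M" for z using re[of z] \<sigma> by auto
    show "?\<Phi> differentiable (at z)" for z using d by (rule differentiableI)
    show "amp Basis UNIV l 1 (\<lambda>z. frechet_derivative ?\<Phi> (at z) e)" if "e \<in> Basis" for e l
      unfolding fd
    proof (rule amp_add)
      have "bounded_linear (\<lambda>z :: 'a \<times> 'a. fst z \<bullet> snd e + fst e \<bullet> snd z)"
        by (intro bounded_linear_add bounded_linear_inner_left_comp bounded_linear_inner_right_comp bounded_linear_fst bounded_linear_snd)
      then have "bounded_linear (\<lambda>z :: 'a \<times> 'a. \<sigma> * of_real (fst z \<bullet> snd e + fst e \<bullet> snd z))"
        by (intro bounded_linear_const_mult bounded_linear_compose[OF bounded_linear_of_real])
      then show "amp Basis UNIV l 1 (\<lambda>z. \<sigma> * of_real (fst z \<bullet> snd e + fst e \<bullet> snd z))"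
        by (rule amp_bounded_linear)
      show "amp Basis UNIV l 1 (\<lambda>z. frechet_derivative f (at z) e)"
        using amp_of_C_infinity[OF f pb, of "Suc l"] that unfolding amp_Suc_UNIV by blast
    qed
    show "0 < 1 / (4 * real DIM('a))" by simp
    fix y :: 'a assume y: "R \<le> norm y"
    obtain j :: 'a where j: "j \<in> Basis" "norm y / DIM('a) \<le> \<bar>y \<bullet> j\<bar>" using norm_le_DIM_component by blast
    have "1 / (4 * real DIM('a)) * (1 + norm y) \<le> cmod (frechet_derivative ?\<Phi> (at (x, y)) (j, 0))" for x
    proof -
      have "cmod \<sigma> = 1" using \<sigma> by auto
      then have "\<bar>y \<bullet> j\<bar> = cmod (\<sigma> * of_real (j \<bullet> y))" by (simp add: norm_mult inner_commute)
      also have "\<dots> \<le> cmod (\<sigma> * of_real (j \<bullet> y) + frechet_derivative f (at (x, y)) (j, 0)) + cmod (frechet_derivative f (at (x, y)) (j, 0))"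
        using norm_triangle_ineq4[of "\<sigma> * of_real (j \<bullet> y) + frechet_derivative f (at (x, y)) (j, 0)" "frechet_derivative f (at (x, y)) (j, 0)"] by simp
      also have "\<sigma> * of_real (j \<bullet> y) + frechet_derivative f (at (x, y)) (j, 0) = frechet_derivative ?\<Phi> (at (x, y)) (j, 0)"
        unfolding fd by simp
      also have "cmod (frechet_derivative f (at (x, y)) (j, 0)) \<le> (1 + norm y) / (4 * real DIM('a))"
        using small[OF y j(1), of x] by simp
      finally have "norm y / DIM('a) - (1 + norm y) / (4 * real DIM('a)) \<le> cmod (frechet_derivative ?\<Phi> (at (x, y)) (j, 0))"
        using j(2) by linarith
      \<comment> \<open>Equivalent to \<open>1 \<le> norm y\<close>: this is the reason for the
        fraction 1/4 together with \<open>1 \<le> R\<close>.\<close>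
      moreover have "1 / (4 * real DIM('a)) * (1 + norm y) \<le> norm y / DIM('a) - (1 + norm y) / (4 * real DIM('a))"
        using y R by (simp add: field_simps)
      ultimately show ?thesis by linarith
    qed
    then show "\<exists>j\<in>Basis. \<forall>x. 1 / (4 * real DIM('a)) * (1 + norm y) \<le> cmod (frechet_derivative ?\<Phi> (at (x, y)) (j, 0))"
      using j by blast
  qed
qed

section \<open>Symbol seminorms and uniformity in z\<close>

definition symbol_seminorm :: "real \<Rightarrow> 'a::euclidean_space list \<times> 'a list \<Rightarrow> ('a \<times> 'a \<Rightarrow> complex) \<Rightarrow> real" where
  "symbol_seminorm m = (\<lambda>(\<alpha>, \<beta>) p. SUP y. symbol_weighted m \<alpha> \<beta> p y)"

lemma symbol_topology_eq: "symbol_topology m = seminorm_topology (symbols m) (lists Basis \<times> lists Basis) (symbol_seminorm m)"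
  by (simp add: symbol_topology_def symbol_seminorm_def)

lemma symbol_weighted_le:
  assumes "p \<in> symbols m" "\<alpha> \<in> lists Basis" "\<beta> \<in> lists Basis"
  shows "symbol_weighted m \<alpha> \<beta> p y \<le> symbol_seminorm m (\<alpha>, \<beta>) p"
  using assms by (auto simp: symbol_seminorm_def symbols_def intro!: cSUP_upper)

lemma symbol_bound:
  assumes "p \<in> symbols m" "\<alpha> \<in> lists Basis" "\<beta> \<in> lists Basis"
  shows "cmod (iter_partial (map (\<lambda>e. (e, 0)) \<alpha> @ map (\<lambda>e. (0, e)) \<beta>) p (x, \<xi>))
    \<le> symbol_seminorm m (\<alpha>, \<beta>) p * (1 + norm \<xi>) powr (m - real (length \<beta>))"
proof -
  have pos: "0 < (1 + norm \<xi>) powr (m - real (length \<beta>))" by (simp add: add_pos_nonneg order_less_imp_not_eq2)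
  have "(1 + norm \<xi>) powr (- m + real (length \<beta>)) = 1 / (1 + norm \<xi>) powr (m - real (length \<beta>))"
    using powr_minus_divide[of "1 + norm \<xi>" "m - real (length \<beta>)"] by simp
  then show ?thesis
    using symbol_weighted_le[OF assms, of "(x, \<xi>)"] pos by (simp add: symbol_weighted_def pos_divide_le_eq)
qed

lemma symbol_seminorm_nonneg:
  assumes "p \<in> symbols m" "\<alpha> \<in> lists Basis" "\<beta> \<in> lists Basis"
  shows "0 \<le> symbol_seminorm m (\<alpha>, \<beta>) p"
proof -
  have "0 \<le> symbol_weighted m \<alpha> \<beta> p 0" by (simp add: symbol_weighted_def case_prod_unfold)
  then show ?thesis using symbol_weighted_le[OF assms] by (rule order_trans)
qed

text \<open>Each basis vector of the product lies in one factor, so \<open>es\<close> can be sorted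
  into x directions \<alpha> followed by \<xi> directions \<beta>. The gain of
  \<open>length \<beta>\<close> powers is dropped.\<close>

lemma symbol_bound_any_order:
  fixes p :: "'a::euclidean_space \<times> 'a \<Rightarrow> complex"
  assumes p: "p \<in> symbols m" and es: "es \<in> lists Basis"
  shows "\<exists>C\<ge>0. \<forall>x \<xi>. cmod (iter_partial es p (x, \<xi>)) \<le> C * (1 + norm \<xi>) powr m"
proof -
  define \<alpha> where "\<alpha> = map fst (filter (\<lambda>e. snd e = 0) es)"
  define \<beta> where "\<beta> = map snd (filter (\<lambda>e. \<not> snd e = 0) es)"
  have B: "e \<in> Basis" if "e \<in> set es" for e using that es by auto
  have \<alpha>: "\<alpha> \<in> lists Basis" and \<beta>: "\<beta> \<in> lists Basis"
    using B by (fastforce simp: \<alpha>_def \<beta>_def Basis_prod_def)+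
  have 0: "fst e = 0" if "e \<in> set es" "snd e \<noteq> 0" for e
    using B[OF that(1)] that(2) by (auto simp: Basis_prod_def)
  have 1: "map (\<lambda>e. (e, 0)) \<alpha> = filter (\<lambda>e. snd e = 0) es"
    unfolding \<alpha>_def map_map by (rule map_idI) auto
  have 2: "map (\<lambda>e. (0, e)) \<beta> = filter (\<lambda>e. \<not> snd e = 0) es"
    unfolding \<beta>_def map_map by (rule map_idI) (use 0 in \<open>auto simp: prod_eq_iff\<close>)
  have "mset es = mset (map (\<lambda>e. (e, 0)) \<alpha> @ map (\<lambda>e. (0, e)) \<beta>)"
    unfolding 1 2 by simp
  then have eq: "iter_partial es p = iter_partial (map (\<lambda>e. (e, 0)) \<alpha> @ map (\<lambda>e. (0, e)) \<beta>) p"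
    using p es by (intro iter_partial_mset) (auto simp: symbols_def)
  have "cmod (iter_partial es p (x, \<xi>)) \<le> symbol_seminorm m (\<alpha>, \<beta>) p * (1 + norm \<xi>) powr m" for x \<xi>
    unfolding eq using symbol_seminorm_nonneg[OF p \<alpha> \<beta>]
    by (intro order_trans[OF symbol_bound[OF p \<alpha> \<beta>]] mult_left_mono powr_mono) auto
  then show ?thesis using symbol_seminorm_nonneg[OF p \<alpha> \<beta>] by blast
qed

lemma symbol_seminorm_diff_self: 
  assumes "i \<in> lists Basis \<times> lists Basis"
  shows "symbol_seminorm m i (p - p) \<le> 0"
proof -
  have "p - p = (\<lambda>_. 0)" by (simp add: fun_eq_iff)
  moreover have "iter_partial es (\<lambda>_. 0) = (\<lambda>_. 0)" for es :: "('a \<times> 'a) list"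
    by (induction es) (auto simp: frechet_derivative_const)
  ultimately show ?thesis
    by (auto simp: symbol_seminorm_def symbol_weighted_def case_prod_unfold)
qed

lemma symbol_seminorm_triangle:
  assumes f: "f \<in> symbols m" and g: "g \<in> symbols m" and i: "i \<in> lists Basis \<times> lists Basis"
  shows "symbol_seminorm m i g \<le> symbol_seminorm m i (g - f) + symbol_seminorm m i f"
proof -
  obtain \<alpha> \<beta> where i: "i = (\<alpha>, \<beta>)" and \<alpha>: "\<alpha> \<in> lists Basis" and \<beta>: "\<beta> \<in> lists Basis" using i by auto
  have es: "map (\<lambda>e. (e, 0)) \<alpha> @ map (\<lambda>e. (0, e)) \<beta> \<in> lists Basis"
    using \<alpha> \<beta> by (auto simp: Basis_prod_def)
  have fg: "f \<in> C_infinity" "g \<in> C_infinity" using f g by (auto simp: symbols_def)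
  have le: "symbol_weighted m \<alpha> \<beta> (g - f) y \<le> symbol_weighted m \<alpha> \<beta> g y + symbol_weighted m \<alpha> \<beta> f y"
    and ge: "symbol_weighted m \<alpha> \<beta> g y \<le> symbol_weighted m \<alpha> \<beta> (g - f) y + symbol_weighted m \<alpha> \<beta> f y" for y
    unfolding symbol_weighted_def case_prod_unfold iter_partial_diff[OF fg(2,1) es] distrib_left[symmetric]
    using norm_triangle_sub[of "iter_partial (map (\<lambda>e. (e, 0)) \<alpha> @ map (\<lambda>e. (0, e)) \<beta>) g (fst y, snd y)"]
    by (intro mult_left_mono norm_triangle_ineq4; simp add: add.commute)+
  \<comment> \<open>The supremum for \<open>g - f\<close> dominates its values only once the range
    is known to be bounded, which follows from the bounds of \<open>f\<close> and
    \<open>g\<close>.\<close>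
  have "bdd_above (range (symbol_weighted m \<alpha> \<beta> (g - f)))"
  proof (rule bdd_aboveI2)
    show "symbol_weighted m \<alpha> \<beta> (g - f) y \<le> symbol_seminorm m i g + symbol_seminorm m i f" for y
      using le[of y] symbol_weighted_le[OF f \<alpha> \<beta>, of y] symbol_weighted_le[OF g \<alpha> \<beta>, of y] by (simp add: i)
  qed
  then have "symbol_weighted m \<alpha> \<beta> (g - f) y \<le> symbol_seminorm m i (g - f)" for y
    by (auto simp: symbol_seminorm_def i intro: cSUP_upper)
  then have "symbol_weighted m \<alpha> \<beta> g y \<le> symbol_seminorm m i (g - f) + symbol_seminorm m i f" for y
    using ge[of y] symbol_weighted_le[OF f \<alpha> \<beta>, of y] by (smt (verit) i)
  then show ?thesis by (auto simp: i symbol_seminorm_def[of m] intro!: cSUP_least)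
qed

text \<open>First x derivatives are the ones that compete with \<xi> in the phase. Bounding them
  uniformly over the compact interval makes the threshold for \<Delta> independent of z.\<close>

lemma symbol_family_uniform_bound:
  fixes b :: "real \<Rightarrow> 'a::euclidean_space \<times> 'a \<Rightarrow> complex"
  assumes b: "continuous_map (top_of_set {0..Z}) (symbol_topology 1) b"
  shows "\<exists>C\<ge>0. \<forall>z\<in>{0..Z}. \<forall>j\<in>Basis. \<forall>x \<xi>. cmod (iter_partial [(j, 0)] (b z) (x, \<xi>)) \<le> C * (1 + norm \<xi>)"
proof -
  have bs: "b z \<in> symbols 1" if "z \<in> {0..Z}" for z
    using continuous_map_image_subset_topspace[OF b] that by (auto simp: topspace_symbol_topology)
  have "\<exists>C. \<forall>z\<in>{0..Z}. symbol_seminorm 1 ([j], []) (b z) \<le> C" if j: "j \<in> Basis" for j :: 'a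
  proof (rule seminorm_bounded_on_compact[OF compact_Icc b[unfolded symbol_topology_eq]])
    show i: "([j], []) \<in> lists Basis \<times> lists Basis" using j by simp
    show "symbol_seminorm 1 ([j], []) (f - f) \<le> 0" for f by (rule symbol_seminorm_diff_self[OF i])
    show "symbol_seminorm 1 ([j], []) g \<le> symbol_seminorm 1 ([j], []) (g - f) + symbol_seminorm 1 ([j], []) f"
      if "f \<in> symbols 1" "g \<in> symbols 1" for f g by (rule symbol_seminorm_triangle[OF that i])
  qed
  then obtain C where C: "\<And>j z. j \<in> Basis \<Longrightarrow> z \<in> {0..Z} \<Longrightarrow> symbol_seminorm 1 ([j], []) (b z) \<le> C j" by metis
  show ?thesis
  proof (intro exI conjI ballI allI)
    show "0 \<le> (\<Sum>j\<in>Basis. \<bar>C j\<bar>)" by (simp add: sum_nonneg)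
    fix z x \<xi> and j :: 'a assume z: "z \<in> {0..Z}" and j: "j \<in> Basis"
    have "cmod (iter_partial [(j, 0)] (b z) (x, \<xi>)) \<le> symbol_seminorm 1 ([j], []) (b z) * (1 + norm \<xi>)"
      using symbol_bound[OF bs[OF z], of "[j]" "[]" x \<xi>] j by simp
    also have "symbol_seminorm 1 ([j], []) (b z) \<le> \<bar>C j\<bar>" using C[OF j z] by linarith
    also have "\<bar>C j\<bar> \<le> (\<Sum>j\<in>Basis. \<bar>C j\<bar>)" using j by (intro member_le_sum) auto
    finally show "cmod (iter_partial [(j, 0)] (b z) (x, \<xi>)) \<le> (\<Sum>j\<in>Basis. \<bar>C j\<bar>) * (1 + norm \<xi>)"
      by (simp add: mult_right_mono)
  qed
qed

theorem proposition2p8: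
  fixes Z :: real
    and a b b1 b0 c c1 c0 :: "real \<Rightarrow> (real^'n) \<times> (real^'n) \<Rightarrow> complex"
  assumes Z: "0 < Z"
    and b: "continuous_map (top_of_set {0..Z}) (symbol_topology 1) b"
    and c: "continuous_map (top_of_set {0..Z}) (symbol_topology 1) c"
    and b_split: "\<And>z x \<xi>. z \<in> {0..Z} \<Longrightarrow> b z (x, \<xi>) = b1 z (x, \<xi>) + b0 z (x, \<xi>)"
    and c_split: "\<And>z x \<xi>. z \<in> {0..Z} \<Longrightarrow> c z (x, \<xi>) = c1 z (x, \<xi>) + c0 z (x, \<xi>)"
    and b1: "continuous_map (top_of_set {0..Z}) (symbol_topology 1) b1"
    and c1: "continuous_map (top_of_set {0..Z}) (symbol_topology 1) c1"
    and b0: "continuous_map (top_of_set {0..Z}) (symbol_topology 0) b0"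
    and c0: "continuous_map (top_of_set {0..Z}) (symbol_topology 0) c0"
    and b1_hom: "\<And>z. z \<in> {0..Z} \<Longrightarrow> homogeneous_deg1_outside_ball (b1 z)"
    and c1_hom: "\<And>z. z \<in> {0..Z} \<Longrightarrow> homogeneous_deg1_outside_ball (c1 z)"
    and b1_real: "\<And>z x \<xi>. z \<in> {0..Z} \<Longrightarrow> b1 z (x, \<xi>) \<in> \<real>"
    and c1_nonneg: "\<And>z x \<xi>. z \<in> {0..Z} \<Longrightarrow> c1 z (x, \<xi>) \<in> \<real>\<^sub>\<ge>\<^sub>0"
    and a: "\<And>z x \<xi>. z \<in> {0..Z} \<Longrightarrow> a z (x, \<xi>) = - \<i> * b z (x, \<xi>) + c z (x, \<xi>)"
  shows "\<exists>\<Delta>2>0. \<forall>z\<in>{0..Z}. \<forall>z'\<in>{0..Z}. 0 \<le> z' - z \<and> z' - z \<le> \<Delta>2 \<longrightarrow>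
    (\<exists>G Gt.
       schwartz_operator_with_kernel (thin_slab_kernel a z' z) G \<and>
       schwartz_operator_with_kernel (transpose_kernel (thin_slab_kernel a z' z)) Gt \<and>
       continuous_map schwartz_topology schwartz_topology G \<and>
       continuous_map weak_dual_topology weak_dual_topology (dual_action Gt) \<and>
       continuous_map strong_dual_topology strong_dual_topology (dual_action Gt))"
proof -
  let ?n = "real DIM(real^'n)"
  obtain Cb where Cb: "0 \<le> Cb" "\<And>z j x \<xi>. z \<in> {0..Z} \<Longrightarrow> j \<in> Basis \<Longrightarrow>
      cmod (iter_partial [(j, 0)] (b z) (x, \<xi>)) \<le> Cb * (1 + norm \<xi>)"
    using symbol_family_uniform_bound[OF b] by blast
  obtain Cc where Cc: "0 \<le> Cc" "\<And>z j x \<xi>. z \<in> {0..Z} \<Longrightarrow> j \<in> Basis \<Longrightarrow>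
      cmod (iter_partial [(j, 0)] (c z) (x, \<xi>)) \<le> Cc * (1 + norm \<xi>)"
    using symbol_family_uniform_bound[OF c] by blast
  \<comment> \<open>Chosen so that \<open>\<Delta> * (Cb + Cc)\<close> stays below
    \<open>1 / (4 * n)\<close>, the room left by \<open>phase_bilinear_plus\<close>; the summand 1
    avoids division by zero.\<close>
  define \<Delta>2 where "\<Delta>2 = 1 / (4 * ?n * (Cb + Cc + 1))"
  have n: "0 < ?n" by simp
  have \<Delta>2: "0 < \<Delta>2" using Cb(1) Cc(1) n unfolding \<Delta>2_def by (intro divide_pos_pos mult_pos_pos) auto
  have \<Delta>2C: "\<Delta>2 * (Cb + Cc) \<le> 1 / (4 * ?n)"
  proof -
    have "\<Delta>2 * (Cb + Cc) = 1 / (4 * ?n) * ((Cb + Cc) / (Cb + Cc + 1))" by (simp add: \<Delta>2_def)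
    also have "\<dots> \<le> 1 / (4 * ?n) * 1" using Cb(1) Cc(1) n by (intro mult_left_mono) auto
    finally show ?thesis by simp
  qed
  show ?thesis
  proof (intro exI[of _ \<Delta>2] conjI ballI impI \<Delta>2)
    fix z z' assume z: "z \<in> {0..Z}" and "z' \<in> {0..Z}" and \<Delta>: "0 \<le> z' - z \<and> z' - z \<le> \<Delta>2"
    define \<Delta> where "\<Delta> = z' - z"
    have \<Delta>0: "0 \<le> \<Delta>" "\<Delta> \<le> \<Delta>2" using \<Delta> by (auto simp: \<Delta>_def)
    have bz: "b z \<in> symbols 1" and cz: "c z \<in> symbols 1" and b0z: "b0 z \<in> symbols 0" and c0z: "c0 z \<in> symbols 0"
      using continuous_map_image_subset_topspace[OF b] continuous_map_image_subset_topspace[OF c]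
        continuous_map_image_subset_topspace[OF b0] continuous_map_image_subset_topspace[OF c0] z
      by (auto simp: topspace_symbol_topology)
    have bC: "b z \<in> C_infinity" and cC: "c z \<in> C_infinity" using bz cz by (auto simp: symbols_def)
    \<comment> \<open>This is \<open>- \<Delta> * a z\<close>, written as a combination of
      \<open>b z\<close> and \<open>c z\<close> so that smoothness and derivative bounds are
      inherited.\<close>
    define f where "f w = complex_of_real \<Delta> * \<i> * b z w + - complex_of_real \<Delta> * c z w" for w
    have fa: "f (x, \<xi>) = - complex_of_real \<Delta> * a z (x, \<xi>)" for x \<xi>
      by (simp add: f_def a[OF z] algebra_simps)
    have fC: "f \<in> C_infinity" unfolding f_def[abs_def] by (rule C_infinity_lincomb[OF bC cC])
    have if_: "iter_partial es f = (\<lambda>w. complex_of_real \<Delta> * \<i> * iter_partial es (b z) w + - complex_of_real \<Delta> * iter_partial es (c z) w)"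
      if "es \<in> lists Basis" for es
      unfolding f_def[abs_def] by (rule iter_partial_lincomb[OF bC cC that])
    have if_le: "cmod (iter_partial es f w) \<le> \<Delta> * (cmod (iter_partial es (b z) w) + cmod (iter_partial es (c z) w))"
      if "es \<in> lists Basis" for es w
      unfolding if_[OF that] using \<Delta>0(1) by (intro order_trans[OF norm_triangle_ineq]) (simp add: norm_mult algebra_simps)
    have fbound: "\<exists>C\<ge>0. \<forall>x \<xi>. cmod (iter_partial es f (x, \<xi>)) \<le> C * (1 + norm \<xi>)" if es: "es \<in> lists Basis" for es
    proof -
      obtain B where B: "0 \<le> B" "\<forall>x \<xi>. cmod (iter_partial es (b z) (x, \<xi>)) \<le> B * (1 + norm \<xi>) powr 1"
        using symbol_bound_any_order[OF bz es] by blast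
      obtain C where C: "0 \<le> C" "\<forall>x \<xi>. cmod (iter_partial es (c z) (x, \<xi>)) \<le> C * (1 + norm \<xi>) powr 1"
        using symbol_bound_any_order[OF cz es] by blast
      have "cmod (iter_partial es f (x, \<xi>)) \<le> (\<Delta> * (B + C)) * (1 + norm \<xi>)" for x \<xi>
      proof -
        have "cmod (iter_partial es f (x, \<xi>)) \<le> \<Delta> * (B * (1 + norm \<xi>) + C * (1 + norm \<xi>))"
          using B(2)[rule_format, of x \<xi>] C(2)[rule_format, of x \<xi>] \<Delta>0(1)
          by (intro order_trans[OF if_le[OF es]] mult_left_mono add_mono) auto
        then show ?thesis by (simp add: algebra_simps)
      qed
      then show ?thesis using B C \<Delta>0 by (intro exI[of _ "\<Delta> * (B + C)"]) auto
    qed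
    obtain B0 where B0: "\<And>x \<xi>. cmod (b0 z (x, \<xi>)) \<le> B0"
      using symbol_bound[OF b0z, of "[]" "[]"] by (simp add: order_less_imp_not_eq2 add_pos_nonneg) blast
    obtain C0 where C0: "\<And>x \<xi>. cmod (c0 z (x, \<xi>)) \<le> C0"
      using symbol_bound[OF c0z, of "[]" "[]"] by (simp add: order_less_imp_not_eq2 add_pos_nonneg) blast
    \<comment> \<open>The real part of \<open>f\<close> is \<Delta> (- Im b - Re c). A real
      \<open>b1\<close> drops out and \<open>c1 \<ge> 0\<close> only helps, so just the bounded
      parts of order 0 remain.\<close>
    define M where "M = \<Delta> * (B0 + C0)"
    have re: "Re (f w) \<le> M" for w
    proof -
      obtain x \<xi> where w: "w = (x, \<xi>)" by (cases w)
      have "Im (b1 z (x, \<xi>)) = 0" using b1_real[OF z] by (simp add: complex_is_Real_iff)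
      moreover have "0 \<le> Re (c1 z (x, \<xi>))" using c1_nonneg[OF z] by (simp add: complex_nonneg_Reals_iff)
      moreover have "\<bar>Im (b0 z (x, \<xi>))\<bar> \<le> B0" using abs_Im_le_cmod B0 by (rule order_trans)
      moreover have "\<bar>Re (c0 z (x, \<xi>))\<bar> \<le> C0" using abs_Re_le_cmod C0 by (rule order_trans)
      ultimately have "- Im (b z w) - Re (c z w) \<le> B0 + C0"
        by (simp add: w b_split[OF z] c_split[OF z])
      from mult_left_mono[OF this \<Delta>0(1)] show ?thesis by (simp add: f_def M_def algebra_simps)
    qed
    let ?\<Phi> = "\<lambda>w. \<i> * of_real (fst w \<bullet> snd w) + f w"
    \<comment> \<open>The Fourier kernel; the trailing 0 is the perturbation of
      \<open>phase_bilinear_plus\<close>.\<close>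
    let ?\<Psi> = "\<lambda>w :: (real^'n) \<times> (real^'n). - \<i> * of_real (fst w \<bullet> snd w) + 0"
    have P: "phase ?\<Phi> M 1 (1 / (4 * ?n))"
    proof (rule phase_bilinear_plus[OF fC _ re])
      show "poly_bounded UNIV 1 (iter_partial es f)" if es: "es \<in> lists Basis" for es
      proof -
        obtain C where "\<forall>x \<xi>. cmod (iter_partial es f (x, \<xi>)) \<le> C * (1 + norm \<xi>)" using fbound[OF es] by blast
        then show ?thesis by (intro poly_boundedI[where C=C and N=0]) simp
      qed
      fix x y j :: "real^'n" assume j: "j \<in> Basis"
      then have "cmod (iter_partial [(j, 0)] f (x, y)) \<le> \<Delta> * (Cb * (1 + norm y) + Cc * (1 + norm y))"
        using Cb(2)[OF z j, of x y] Cc(2)[OF z j, of x y] \<Delta>0(1)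
        by (intro order_trans[OF if_le] mult_left_mono add_mono) (auto simp: Basis_prod_def)
      also have "\<dots> = \<Delta> * (Cb + Cc) * (1 + norm y)" by (simp add: algebra_simps)
      also have "\<Delta> * (Cb + Cc) \<le> 1 / (4 * ?n)"
        using \<Delta>0(2) Cb(1) Cc(1) by (intro order_trans[OF mult_right_mono \<Delta>2C]) auto
      finally show "cmod (iter_partial [(j, 0)] f (x, y)) \<le> (1 + norm y) / (4 * ?n)"
        by (simp add: mult_right_mono)
    qed auto
    have "\<exists>C\<ge>0. \<forall>j\<in>Basis. \<forall>x \<xi>. cmod (iter_partial [(0, j)] f (x, \<xi>)) \<le> C"
    proof -
      have "\<exists>C\<ge>0. \<forall>x \<xi>. cmod (iter_partial [(0, j)] f (x, \<xi>)) \<le> C" if j: "j \<in> Basis" for j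
      proof -
        let ?C = "\<Delta> * (symbol_seminorm 1 ([], [j]) (b z) + symbol_seminorm 1 ([], [j]) (c z))"
        have "cmod (iter_partial [(0, j)] f (x, \<xi>)) \<le> ?C" for x \<xi>
          using symbol_bound[OF bz, of "[]" "[j]" x \<xi>] symbol_bound[OF cz, of "[]" "[j]" x \<xi>] j \<Delta>0(1)
          by (intro order_trans[OF if_le] mult_left_mono add_mono) (auto simp: Basis_prod_def order_less_imp_not_eq2 add_pos_nonneg)
        moreover have "0 \<le> ?C" using \<Delta>0(1) j symbol_seminorm_nonneg[OF bz, of "[]" "[j]"] symbol_seminorm_nonneg[OF cz, of "[]" "[j]"] by auto
        ultimately show ?thesis by blast
      qed
      then obtain C where C: "\<And>j. j \<in> Basis \<Longrightarrow> 0 \<le> C j" "\<And>j x \<xi>. j \<in> Basis \<Longrightarrow> cmod (iter_partial [(0, j)] f (x, \<xi>)) \<le> C j"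
        by metis
      have "C j \<le> (\<Sum>j\<in>Basis. C j)" if "j \<in> Basis" for j using C(1) that by (intro member_le_sum) auto
      then show ?thesis
        using C by (intro exI[of _ "\<Sum>j\<in>Basis. C j"]) (meson order_trans sum_nonneg)
    qed
    then obtain C where C: "0 \<le> C" "\<And>j x \<xi>. j \<in> Basis \<Longrightarrow> cmod (iter_partial [(0, j)] f (x, \<xi>)) \<le> C" by blast
    \<comment> \<open>Here \<xi> is integrated and the perturbation is bounded by \<open>C\<close>.
      Beyond the radius \<open>1 + 4 * n * C\<close> this is below (1 + |y|) / (4 n).\<close>
    have "phase (\<lambda>w. \<i> * of_real (fst w \<bullet> snd w) + (f \<circ> prod.swap) w) M (1 + 4 * ?n * C) (1 / (4 * ?n))"
    proof (rule phase_bilinear_plus[OF C_infinity_swap_args[OF fC]])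
      show "poly_bounded UNIV 1 (iter_partial es (f \<circ> prod.swap))" if es: "es \<in> lists Basis" for es
      proof -
        have es': "map prod.swap es \<in> lists Basis" using es by (simp add: in_lists_conv_set)
        obtain B where B: "0 \<le> B" "\<forall>x \<xi>. cmod (iter_partial (map prod.swap es) f (x, \<xi>)) \<le> B * (1 + norm \<xi>)"
          using fbound[OF es'] by blast
        show ?thesis unfolding iter_partial_swap_args[OF fC es]
        \<comment> \<open>After the swap the growth of the symbol in \<xi> falls on the integration
          variable, where one power \<open>N = 1\<close> takes it.\<close>
        proof (rule poly_boundedI[where C=B and N=1])
          fix x y :: "real^'n"
          have "cmod (iter_partial (map prod.swap es) f (y, x)) \<le> B * (1 + norm x) * 1" using B by simp
          also have "\<dots> \<le> B * (1 + norm x) * (1 + norm y)" using B(1) by (intro mult_left_mono) auto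
          finally show "cmod ((iter_partial (map prod.swap es) f \<circ> prod.swap) (x, y)) \<le> B * (1 + norm x) ^ 1 * (1 + norm y) powr 1"
            by simp
        qed
      qed
      show "Re ((f \<circ> prod.swap) w) \<le> M" for w using re by simp
      show "1 \<le> 1 + 4 * ?n * C" using C(1) by simp
      fix x y j :: "real^'n" assume y: "1 + 4 * ?n * C \<le> norm y" and j: "j \<in> Basis"
      have "cmod (iter_partial [(j, 0)] (f \<circ> prod.swap) (x, y)) = cmod (iter_partial [(0, j)] f (y, x))"
        using j by (subst iter_partial_swap_args[OF fC]) (auto simp: Basis_prod_def)
      also have "\<dots> \<le> C" using C(2) j by blast
      also have "\<dots> \<le> (1 + norm y) / (4 * ?n)" using y n by (simp add: field_simps)
      finally show "cmod (iter_partial [(j, 0)] (f \<circ> prod.swap) (x, y)) \<le> (1 + norm y) / (4 * ?n)" .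
    qed auto
    moreover have "?\<Phi> \<circ> prod.swap = (\<lambda>w. \<i> * of_real (fst w \<bullet> snd w) + (f \<circ> prod.swap) w)"
      by (auto simp: inner_commute)
    ultimately have Ps: "phase (?\<Phi> \<circ> prod.swap) M (1 + 4 * ?n * C) (1 / (4 * ?n))" by simp
    have z0: "iter_partial es (\<lambda>_. 0) = (\<lambda>_. 0)" for es :: "((real^'n) \<times> (real^'n)) list"
      by (induction es) (auto simp: frechet_derivative_const)
    have P0: "phase ?\<Psi> 0 1 (1 / (4 * ?n))"
    proof (rule phase_bilinear_plus[where f="\<lambda>_. 0"])
      show "(\<lambda>_ :: (real^'n) \<times> (real^'n). 0 :: complex) \<in> C_infinity" using zero_in_schwartz by (rule schwartz_C_infinity)
      show "poly_bounded UNIV 1 (iter_partial es (\<lambda>_ :: (real^'n) \<times> (real^'n). 0))" for es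
        unfolding z0 by (rule poly_boundedI[where C=0 and N=0]) simp
      show "cmod (iter_partial [(j, 0)] (\<lambda>_. 0) (x, y)) \<le> (1 + norm y) / (4 * ?n)" for j x y :: "real^'n"
        unfolding z0 by simp
    qed auto
    show "\<exists>G Gt.
       schwartz_operator_with_kernel (thin_slab_kernel a z' z) G \<and>
       schwartz_operator_with_kernel (transpose_kernel (thin_slab_kernel a z' z)) Gt \<and>
       continuous_map schwartz_topology schwartz_topology G \<and>
       continuous_map weak_dual_topology weak_dual_topology (dual_action Gt) \<and>
       continuous_map strong_dual_topology strong_dual_topology (dual_action Gt)"
    proof (rule thin_slab_operators[OF P Ps P0])
      show "?\<Psi> \<circ> prod.swap = ?\<Psi>" by (auto simp: inner_commute)
      have "thin_slab_integrand a z' z = (\<lambda>(x', x) \<xi>. of_real (1 / (2 * pi) ^ CARD('n)) * exp (?\<Phi> (x', \<xi>)) * exp (?\<Psi> (x, \<xi>)))"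
      proof (intro ext, clarify)
        fix x' x \<xi> :: "real^'n"
        have "\<i> * of_real ((x' - x) \<bullet> \<xi>) + - of_real (z' - z) * a z (x', \<xi>) = ?\<Phi> (x', \<xi>) + ?\<Psi> (x, \<xi>)"
          by (simp add: fa \<Delta>_def inner_diff_left algebra_simps)
        then show "thin_slab_integrand a z' z (x', x) \<xi> = of_real (1 / (2 * pi) ^ CARD('n)) * exp (?\<Phi> (x', \<xi>)) * exp (?\<Psi> (x, \<xi>))"
          unfolding thin_slab_integrand_def prod.case mult.assoc exp_add[symmetric] by simp
      qed
      then show "thin_slab_kernel a z' z = has_oscillatory_integral (\<lambda>(x', x) \<xi>. of_real (1 / (2 * pi) ^ CARD('n)) * exp (?\<Phi> (x', \<xi>)) * exp (?\<Psi> (x, \<xi>)))"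
        by (simp add: thin_slab_kernel_def)
    qed
  qed
qed

end
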